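(* Let $n,d\ge 1$, let $\mathcal{G}\subseteq\mathcal{S}_n(\mathbb{R}[X])$, and let $G\subseteq\mathbb{R}[X]$ be a set such that $\mathbf{K}_{\mathcal{G}}=K_G$, $(M_G)^n\subseteq\mathcal{M}_{\mathcal{G}}$ and $(T_G)^n\subseteq\mathcal{T}_{\mathcal{G}}$. Let $\mathbf{D}=D(d_1,\dots,d_r)$, $r\le n$, be an $n\times n$ diagonal polynomial matrix in $\mathcal{S}_n(\mathbb{R}[X])$. Assume: (1) $M_G$ is Archimedean; (2) $\mathbf{D}\succcurlyeq\mathbf{0}$ on $\mathbf{K}_{\mathcal{G}}$; (3) each zero $p$ of each $d_i$ ($1\le i\le r$) in $\mathbf{K}_{\mathcal{G}}$ is a non-singular point of $\mathbb{R}^d$, and there exist $g_{i_1},\dots,g_{i_k}\in M_G$, $1\le k\le d$, which are part of a system of uniformizing parameters at $p$, such that $d_i$ satisfies the boundary Hessian conditions (BHC) with respect to $g_{i_1},\dots,g_{i_k}$ at $p$. Then $\mathbf{D}\in(M_G)^n\subseteq\mathcal{M}_{\mathcal{G}}$.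
   Context: $\mathbb{R}[X]=\mathbb{R}[x_1,\dots,x_d]$. For a commutative unital ring $R$, $\mathcal{M}_n(R)$ is the ring of $n\times n$ matrices over $R$, $\mathcal{S}_n(R)$ its subset of symmetric matrices, $\mathbf{I}_n$ the identity matrix. A quadratic module in $\mathcal{M}_n(R)$ is a set $\mathcal{M}\subseteq\mathcal{S}_n(R)$ with $\mathbf{I}_n\in\mathcal{M}$, $\mathcal{M}+\mathcal{M}\subseteq\mathcal{M}$, and $A^T\mathcal{M}A\subseteq\mathcal{M}$ for all $A\in\mathcal{M}_n(R)$. A preordering in $\mathcal{M}_n(R)$ is a quadratic module $\mathcal{T}$ such that $\mathcal{T}\cap(R\cdot\mathbf{I}_n)$ is closed under multiplication. $\mathcal{M}_{\mathcal{G}}$ and $\mathcal{T}_{\mathcal{G}}$ denote the smallest quadratic module and the smallest preordering in $\mathcal{M}_n(\mathbb{R}[X])$ containing $\mathcal{G}$; for $G\subseteq\mathbb{R}[X]$, $M_G$ and $T_G$ denote the smallest quadratic module and the smallest preordering of $\mathbb{R}[X]$ containing $G$ (a quadratic module of $\mathbb{R}[X]$ contains $1$ and is closed under addition and multiplication by squares, a preordering is closed under addition and multiplication and contains all squares). $M_G$ is Archimedean if for each $a\in\mathbb{R}[X]$ there is $k\in\mathbb{N}$ with $k-a^2\in M_G$. For a quadratic module $M\subseteq\mathbb{R}[X]$, $M^n$ denotes the set of all finite sums $\sum_i m_iA_i^TA_i$ with $m_i\in M$, $A_i\in\mathcal{M}_n(\mathbb{R}[X])$. $\mathbf{K}_{\mathcal{G}}=\{x\in\mathbb{R}^d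 : \mathbf{G}(x)\succcurlyeq\mathbf{0}\ \forall\,\mathbf{G}\in\mathcal{G}\}$ and $K_G=\{x\in\mathbb{R}^d: g(x)\ge 0\ \forall g\in G\}$. $D(d_1,\dots,d_r)$ is the $n\times n$ diagonal matrix with diagonal entries $d_1,\dots,d_r,0,\dots,0$. "$\succcurlyeq\mathbf 0$ on a set" means positive semidefinite at each point of the set. Boundary Hessian conditions: $f\in\mathbb{R}[X]$ satisfies BHC at a point $p\in K_G$ with respect to $t_1,\dots,t_k$, $1\le k\le d$, which are part of a system of uniformizing parameters $t_1,\dots,t_d$ at $p$ (i.e. a regular system of parameters of the local ring of $\mathbb{R}[X]$ at the maximal ideal of $p$, so that the completion of $\mathbb{R}[X]$ at $p$ is $\mathbb{R}[[t_1,\dots,t_d]]$), if $p$ is a non-singular point of $\mathbb{R}^d$ and, in the completion $\mathbb{R}[[t_1,\dots,t_d]]$ of $\mathbb{R}[X]$ at $p$, $f$ decomposes as $f=f_0+f_1+f_2+\cdots$ (where $f_j$ is homogeneous of degree $j$ in $t_1,\dots,t_d$ with coefficients in $\mathbb{R}$), $f_1=a_1t_1+\cdots+a_kt_k$ with $a_i>0$ for $i=1,\dots,k$, and the quadratic form $f_2(0,\dots,0,t_{k+1},\dots,t_d)$ is positive definite. *)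

theory Defs
  imports
    "HOL-Library.Poly_Mapping"
    "HOL-Library.Cardinality"
    "HOL-Computational_Algebra.Polynomial_Factorial"
    "HOL-Algebra.Ideal_Product"
    "HOL-Algebra.QuotRing"
    "Jordan_Normal_Form.Matrix"
begin

section \<open>Polynomials and points\<close>

text \<open>The ring \<open>\<real>[X]\<close> in \<open>d\<close> variables is \<open>'d mpoly\<close> and \<open>\<real>\<^sup>d\<close> is \<open>'d \<Rightarrow> real\<close>, where \<open>d = CARD('d)\<close>.
  The linear order on \<open>'d\<close> orders the variables; the library needs it to show that the polynomial
  ring is an integral domain.\<close>

type_synonym 'v mpoly = "('v \<Rightarrow>\<^sub>0 nat) \<Rightarrow>\<^sub>0 real"

text \<open>Evaluation at \<open>x\<close>, with real coefficients mapped into the target ring by \<open>\<phi>\<close>.\<close>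

definition mpoly_eval :: "(real \<Rightarrow> 'a::comm_ring_1) \<Rightarrow> ('v \<Rightarrow> 'a) \<Rightarrow> 'v mpoly \<Rightarrow> 'a" where
  "mpoly_eval \<phi> x f =
    (\<Sum>\<alpha>\<in>Poly_Mapping.keys f. \<phi> (Poly_Mapping.lookup f \<alpha>) *
       (\<Prod>v\<in>Poly_Mapping.keys \<alpha>. x v ^ Poly_Mapping.lookup \<alpha> v))"

abbreviation eval_at :: "('v \<Rightarrow> real) \<Rightarrow> 'v mpoly \<Rightarrow> real" where
  "eval_at \<equiv> mpoly_eval (\<lambda>c. c)"

definition pos_set :: "'v mpoly set \<Rightarrow> ('v \<Rightarrow> real) set" where
  "pos_set G = {x. \<forall>g\<in>G. eval_at x g \<ge> 0}"

section \<open>Quadratic modules and preorderings of polynomials\<close>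

definition quadratic_module :: "'a::comm_ring_1 set \<Rightarrow> bool" where
  "quadratic_module M \<longleftrightarrow>
     1 \<in> M \<and> (\<forall>a\<in>M. \<forall>b\<in>M. a + b \<in> M) \<and> (\<forall>a. \<forall>b\<in>M. a^2 * b \<in> M)"

definition preordering :: "'a::comm_ring_1 set \<Rightarrow> bool" where
  "preordering T \<longleftrightarrow>
     (\<forall>a\<in>T. \<forall>b\<in>T. a + b \<in> T) \<and> (\<forall>a\<in>T. \<forall>b\<in>T. a * b \<in> T) \<and> (\<forall>a. a^2 \<in> T)"

abbreviation qmod :: "'a::comm_ring_1 set \<Rightarrow> 'a set" where
  "qmod G \<equiv> quadratic_module hull G"

abbreviation preord :: "'a::comm_ring_1 set \<Rightarrow> 'a set" where
  "preord G \<equiv> preordering hull G"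

definition archimedean :: "'a::comm_ring_1 set \<Rightarrow> bool" where
  "archimedean M \<longleftrightarrow> (\<forall>a. \<exists>k::nat. of_nat k - a^2 \<in> M)"

section \<open>Quadratic modules and preorderings of matrices\<close>

definition sym_mats :: "nat \<Rightarrow> 'a mat set" where
  "sym_mats n = {A \<in> carrier_mat n n. transpose_mat A = A}"

definition mat_quadratic_module :: "nat \<Rightarrow> 'a::comm_ring_1 mat set \<Rightarrow> bool" where
  "mat_quadratic_module n M \<longleftrightarrow>
     M \<subseteq> sym_mats n \<and> 1\<^sub>m n \<in> M \<and> (\<forall>A\<in>M. \<forall>B\<in>M. A + B \<in> M) \<and>
     (\<forall>A\<in>carrier_mat n n. \<forall>B\<in>M. transpose_mat A * B * A \<in> M)"

definition scalar_mats :: "nat \<Rightarrow> 'a::comm_ring_1 mat set" where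
  "scalar_mats n = {a \<cdot>\<^sub>m 1\<^sub>m n | a. True}"

definition mat_preordering :: "nat \<Rightarrow> 'a::comm_ring_1 mat set \<Rightarrow> bool" where
  "mat_preordering n T \<longleftrightarrow> mat_quadratic_module n T \<and>
     (\<forall>A\<in>T \<inter> scalar_mats n. \<forall>B\<in>T \<inter> scalar_mats n. A * B \<in> T \<inter> scalar_mats n)"

abbreviation mat_qmod :: "nat \<Rightarrow> 'a::comm_ring_1 mat set \<Rightarrow> 'a mat set" where
  "mat_qmod n \<G> \<equiv> mat_quadratic_module n hull \<G>"

abbreviation mat_preord :: "nat \<Rightarrow> 'a::comm_ring_1 mat set \<Rightarrow> 'a mat set" where
  "mat_preord n \<G> \<equiv> mat_preordering n hull \<G>"

text \<open>\<open>M\<^sup>n\<close>: the finite sums \<open>\<Sum>\<^sub>i m\<^sub>i A\<^sub>i\<^sup>T A\<^sub>i\<close>, given by the list of pairs \<open>(m\<^sub>i, A\<^sub>i)\<close>.\<close>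

definition mat_power_module :: "nat \<Rightarrow> 'a::comm_ring_1 set \<Rightarrow> 'a mat set" where
  "mat_power_module n M =
     {foldr (+) (map (\<lambda>(m, A). m \<cdot>\<^sub>m (transpose_mat A * A)) xs) (0\<^sub>m n n) | xs.
        set xs \<subseteq> M \<times> carrier_mat n n}"

definition psd_mat :: "nat \<Rightarrow> real mat \<Rightarrow> bool" where
  "psd_mat n A \<longleftrightarrow> A \<in> sym_mats n \<and> (\<forall>v\<in>carrier_vec n. v \<bullet> (A *\<^sub>v v) \<ge> 0)"

definition psd_on :: "nat \<Rightarrow> ('v \<Rightarrow> real) set \<Rightarrow> 'v mpoly mat \<Rightarrow> bool" where
  "psd_on n K A \<longleftrightarrow> (\<forall>x\<in>K. psd_mat n (map_mat (eval_at x) A))"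

definition mat_pos_set :: "nat \<Rightarrow> 'v mpoly mat set \<Rightarrow> ('v \<Rightarrow> real) set" where
  "mat_pos_set n \<G> = {x. \<forall>A\<in>\<G>. psd_mat n (map_mat (eval_at x) A)}"

definition diag_D :: "nat \<Rightarrow> nat \<Rightarrow> (nat \<Rightarrow> 'a::zero) \<Rightarrow> 'a mat" where
  "diag_D n r f = mat_diag n (\<lambda>i. if i < r then f i else 0)"

section \<open>The local ring at a point and its completion\<close>

text \<open>The localization of \<open>\<real>[X]\<close> at the maximal ideal of \<open>p\<close>, as a subring of the field of fractions.\<close>

definition local_ring_at :: "('d::{finite,linorder} \<Rightarrow> real) \<Rightarrow> 'd mpoly fract ring" where
  "local_ring_at p =
     \<lparr>carrier = {Fract a b | a b. eval_at p b \<noteq> 0}, monoid.mult = (*), one = 1, zero = 0, add = (+)\<rparr>"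

definition max_ideal_at :: "('d::{finite,linorder} \<Rightarrow> real) \<Rightarrow> 'd mpoly fract set" where
  "max_ideal_at p = {Fract a b | a b. eval_at p a = 0 \<and> eval_at p b \<noteq> 0}"

text \<open>The completion is the inverse limit of the quotients by the powers of \<open>I\<close>: a coset of
  \<open>I\<^sup>N\<^sup>+\<^sup>1\<close> is mapped to the coset of \<open>I\<^sup>N\<close> that contains it.\<close>

definition ideal_pow :: "'a ring \<Rightarrow> 'a set \<Rightarrow> nat \<Rightarrow> 'a set" where
  "ideal_pow R I N = I [^]\<^bsub>ideals_set R\<^esub> N"

definition adic_completion :: "'a ring \<Rightarrow> 'a set \<Rightarrow> (nat \<Rightarrow> 'a set) set" where
  "adic_completion R I =
     {s. (\<forall>N. s N \<in> carrier (R Quot (ideal_pow R I N))) \<and> (\<forall>N. s (Suc N) \<subseteq> s N)}"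

definition to_completion :: "'a ring \<Rightarrow> 'a set \<Rightarrow> 'a \<Rightarrow> (nat \<Rightarrow> 'a set)" where
  "to_completion R I x = (\<lambda>N. ideal_pow R I N +>\<^bsub>R\<^esub> x)"

text \<open>Convergence in the inverse limit topology, every quotient being discrete.\<close>

definition adic_limit :: "'a ring \<Rightarrow> 'a set \<Rightarrow> (nat \<Rightarrow> nat \<Rightarrow> 'a set) \<Rightarrow> (nat \<Rightarrow> 'a set) \<Rightarrow> bool" where
  "adic_limit R I S s \<longleftrightarrow> (\<forall>J. S J \<in> adic_completion R I) \<and> s \<in> adic_completion R I \<and>
     (\<forall>N. \<forall>\<^sub>F J in sequentially. S J N = s N)"

section \<open>Uniformizing parameters and the boundary Hessian conditions\<close>

text \<open>Parameters are indexed from \<open>0\<close>, so \<open>t\<^sub>1, \<dots>, t\<^sub>d\<close> is \<open>t 0, \<dots>, t (d - 1)\<close>. The local ring has Krull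
  dimension \<open>d\<close>, so a regular system of parameters is a system of \<open>d\<close> generators of the maximal ideal.\<close>

definition uniformizing_system ::
    "('d::{finite,linorder} \<Rightarrow> real) \<Rightarrow> (nat \<Rightarrow> 'd mpoly fract) \<Rightarrow> bool" where
  "uniformizing_system p t \<longleftrightarrow>
     t ` {..<CARD('d)} \<subseteq> carrier (local_ring_at p) \<and>
     Idl\<^bsub>local_ring_at p\<^esub> (t ` {..<CARD('d)}) = max_ideal_at p"

definition extends_params ::
    "nat \<Rightarrow> (nat \<Rightarrow> 'd::{finite,linorder} mpoly) \<Rightarrow> (nat \<Rightarrow> 'd mpoly fract) \<Rightarrow> bool" where
  "extends_params k g t \<longleftrightarrow> (\<forall>j<k. t j = to_fract (g j))"

definition part_of_uniformizing_system ::
    "('d::{finite,linorder} \<Rightarrow> real) \<Rightarrow> nat \<Rightarrow> (nat \<Rightarrow> 'd mpoly) \<Rightarrow> bool" where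
  "part_of_uniformizing_system p k g \<longleftrightarrow>
     k \<le> CARD('d) \<and> (\<exists>t. uniformizing_system p t \<and> extends_params k g t)"

text \<open>Regularity of the local ring: its maximal ideal has \<open>d\<close> generators, \<open>d\<close> being the Krull dimension.\<close>

definition nonsingular_point :: "('d::{finite,linorder} \<Rightarrow> real) \<Rightarrow> bool" where
  "nonsingular_point p \<longleftrightarrow> (\<exists>t. uniformizing_system p t)"

definition homogeneous_form :: "nat \<Rightarrow> nat \<Rightarrow> nat mpoly \<Rightarrow> bool" where
  "homogeneous_form d j F \<longleftrightarrow>
     (\<forall>\<alpha>\<in>Poly_Mapping.keys F. Poly_Mapping.keys \<alpha> \<subseteq> {..<d} \<and>
        (\<Sum>i\<in>Poly_Mapping.keys \<alpha>. Poly_Mapping.lookup \<alpha> i) = j)"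

text \<open>\<open>f = f\<^sub>0 + f\<^sub>1 + f\<^sub>2 + \<cdots>\<close> in the completion at \<open>p\<close>, where \<open>f\<^sub>j = F j\<close> is a form of degree \<open>j\<close>
  in \<open>t\<^sub>1, \<dots>, t\<^sub>d\<close> with real coefficients.\<close>

definition expands_as ::
    "('d::{finite,linorder} \<Rightarrow> real) \<Rightarrow> (nat \<Rightarrow> 'd mpoly fract) \<Rightarrow> 'd mpoly \<Rightarrow>
     (nat \<Rightarrow> nat mpoly) \<Rightarrow> bool" where
  "expands_as p t f F \<longleftrightarrow>
     (\<forall>j. homogeneous_form CARD('d) j (F j)) \<and>
     (let emb = to_completion (local_ring_at p) (max_ideal_at p);
          ev = mpoly_eval (\<lambda>c. to_fract (Poly_Mapping.single 0 c)) t
      in adic_limit (local_ring_at p) (max_ideal_at p)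
           (\<lambda>J. emb (\<Sum>j<J. ev (F j))) (emb (to_fract f)))"

definition BHC ::
    "('d::{finite,linorder} \<Rightarrow> real) \<Rightarrow> nat \<Rightarrow> (nat \<Rightarrow> 'd mpoly) \<Rightarrow> 'd mpoly \<Rightarrow> bool" where
  "BHC p k g f \<longleftrightarrow>
     1 \<le> k \<and> k \<le> CARD('d) \<and> nonsingular_point p \<and>
     (\<exists>t F. uniformizing_system p t \<and> extends_params k g t \<and> expands_as p t f F \<and>
        (\<exists>a. (\<forall>i<k. a i > 0) \<and>
             F 1 = (\<Sum>i<k. Poly_Mapping.single (Poly_Mapping.single i 1) (a i))) \<and>
        (\<forall>y. (\<forall>i<k. y i = 0) \<and> (\<exists>i\<in>{k..<CARD('d)}. y i \<noteq> 0) \<longrightarrow> eval_at y (F 2) > 0))"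

end

(* Since a diagonal matrix with entries in M = M_G lies in M^n, the point is the scalar statement d_i in M.

   Truncating the expansion of f = d_i in the completion at a zero p modulo the cube of the maximal ideal
   gives f = sum a_i g_i + (quadratic form in polynomial parameters) + O(|x - p|^3).  Completing the
   coefficients a_i to squares s_i^2 absorbs every quadratic term that involves some g_i, with |g_i|^2 to
   spare, so f - sum s_i^2 g_i grows quadratically at p on a full neighbourhood in R^d.  In particular f has
   finitely many zeros on the compact set K.  Squares that are flat at the zeros and small elsewhere glue
   these corrections together; subtracting terms (1 - g/b)^(2k) g gives positivity on a box around K.

   It remains to treat h > 0 on a box except for finitely many nondegenerate interior minima.  A linear
   form l separating the zeros gives generators v of their vanishing ideal (as in the shape lemma) and
   h = v^T C v with C positive definite at the zeros; replacing C by C + kappa (|v|^2 I - v v^T) does not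
   change h and makes C positive definite on the box (Finsler).  Its Bernstein coefficients are then
   positive definite real matrices, which writes h in the preordering of the box, and this
   preordering lies in M because M contains a ball constraint. *)

theory Submission
  imports Defs
    "HOL-Analysis.Function_Topology"
    "HOL-Analysis.Convex"
    "HOL-Library.Landau_Symbols"
    "HOL-Computational_Algebra.Field_as_Ring"
begin

section \<open>Evaluation of polynomials\<close>

text \<open>The obstacle is the zeros: a certificate obtained by approximation carries an error, and
  at a zero of \<open>h\<close> there is no slack to absorb it. Writing \<open>h = v^T C v\<close>
  moves the zeros into \<open>v\<close>, and the approximation is applied to \<open>C\<close>, which
  has slack. But \<open>h(x)\<close> tests \<open>C(x)\<close> only in the direction
  \<open>v(x)\<close>. The term \<open>|v|^2 I - v v^T\<close> annihilates \<open>v(x)\<close> and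
  is positive on its orthogonal complement, so a large multiple repairs the remaining directions. At
  the zeros this term vanishes, hence \<open>C\<close> must be positive definite there beforehand,
  and that is what quadratic growth on a full neighbourhood provides. The given \<open>f\<close> has
  no such growth, since its linear part is negative on one side of the boundary of \<open>K\<close>;
  subtracting square multiples of the \<open>g_i\<close>, which lie in \<open>M\<close>, restores
  it.

  All gluing rests on counting orders. A change by O(|x - p|^3) cannot destroy quadratic growth, so
  each multiplier is either 1 + O(|x - p|^2) and meets a factor vanishing at \<open>p\<close>, or is
  itself O(|x - p|^4).\<close>

abbreviation Const :: "real \<Rightarrow> 'v mpoly" where
  "Const c \<equiv> Poly_Mapping.single 0 c"

definition Var :: "'v \<Rightarrow> 'v mpoly" where
  "Var v = Poly_Mapping.single (Poly_Mapping.single v 1) 1"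

lemma Const_add: "Const (a + b) = Const a + Const b"
  by (rule single_add)

lemma Const_mult: "Const (a * b) = Const a * Const b"
  by (simp add: mult_single)

lemma Const_sum: "Const (\<Sum>i\<in>S. f i) = (\<Sum>i\<in>S. Const (f i))"
  by (induction S rule: infinite_finite_induct) (auto simp: Const_add)

lemma Const_power: "Const (a ^ n) = Const a ^ n"
  by (induction n) (auto simp: Const_mult)

lemma Const_prod: "Const (\<Prod>i\<in>S. f i) = (\<Prod>i\<in>S. Const (f i))"
  by (induction S rule: infinite_finite_induct) (auto simp: Const_mult)

text \<open>A predicate on maps, so that the same facts about \<open>mpoly_eval\<close> and about
  completing squares serve three targets: the reals, the polynomials (through \<open>Const\<close>)
  and the field of fractions, where forms in uniformizing parameters are evaluated.\<close>

definition real_hom :: "(real \<Rightarrow> 'a::comm_ring_1) \<Rightarrow> bool" where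
  "real_hom \<phi> \<longleftrightarrow> \<phi> 0 = 0 \<and> \<phi> 1 = 1 \<and> (\<forall>a b. \<phi> (a + b) = \<phi> a + \<phi> b) \<and> (\<forall>a b. \<phi> (a * b) = \<phi> a * \<phi> b)"

definition monom_eval :: "('v \<Rightarrow> 'a::comm_ring_1) \<Rightarrow> ('v \<Rightarrow>\<^sub>0 nat) \<Rightarrow> 'a" where
  "monom_eval x \<alpha> = (\<Prod>v\<in>Poly_Mapping.keys \<alpha>. x v ^ Poly_Mapping.lookup \<alpha> v)"

lemma monom_eval_superset:
  assumes "finite S" "Poly_Mapping.keys \<alpha> \<subseteq> S"
  shows "monom_eval x \<alpha> = (\<Prod>v\<in>S. x v ^ Poly_Mapping.lookup \<alpha> v)"
  unfolding monom_eval_def using assms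
  by (intro prod.mono_neutral_left) (auto simp: in_keys_iff)

lemma monom_eval_0 [simp]: "monom_eval x 0 = 1"
  by (simp add: monom_eval_def)

lemma monom_eval_single [simp]: "monom_eval x (Poly_Mapping.single v n) = x v ^ n"
  by (simp add: monom_eval_def)

lemma monom_eval_add: "monom_eval x (\<alpha> + \<beta>) = monom_eval x \<alpha> * monom_eval x \<beta>"
proof -
  let ?S = "Poly_Mapping.keys \<alpha> \<union> Poly_Mapping.keys \<beta>"
  have "monom_eval x (\<alpha> + \<beta>) = (\<Prod>v\<in>?S. x v ^ Poly_Mapping.lookup (\<alpha> + \<beta>) v)"
    using Poly_Mapping.keys_add[of \<alpha> \<beta>] by (intro monom_eval_superset) auto
  moreover have "monom_eval x \<alpha> = (\<Prod>v\<in>?S. x v ^ Poly_Mapping.lookup \<alpha> v)"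
    by (intro monom_eval_superset) auto
  moreover have "monom_eval x \<beta> = (\<Prod>v\<in>?S. x v ^ Poly_Mapping.lookup \<beta> v)"
    by (intro monom_eval_superset) auto
  ultimately show ?thesis
    by (simp add: lookup_add power_add prod.distrib)
qed

lemma mpoly_eval_alt:
  "mpoly_eval \<phi> x f = (\<Sum>\<alpha>\<in>Poly_Mapping.keys f. \<phi> (Poly_Mapping.lookup f \<alpha>) * monom_eval x \<alpha>)"
  by (simp add: mpoly_eval_def monom_eval_def)

lemma mpoly_eval_superset:
  assumes "real_hom \<phi>" "finite S" "Poly_Mapping.keys f \<subseteq> S"
  shows "mpoly_eval \<phi> x f = (\<Sum>\<alpha>\<in>S. \<phi> (Poly_Mapping.lookup f \<alpha>) * monom_eval x \<alpha>)"
  unfolding mpoly_eval_alt using assms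
  by (intro sum.mono_neutral_left) (auto simp: in_keys_iff real_hom_def)

lemma mpoly_eval_0 [simp]: "mpoly_eval \<phi> x 0 = 0"
  by (simp add: mpoly_eval_def)

lemma mpoly_eval_add:
  assumes "real_hom \<phi>"
  shows "mpoly_eval \<phi> x (f + g) = mpoly_eval \<phi> x f + mpoly_eval \<phi> x g"
proof -
  let ?S = "Poly_Mapping.keys f \<union> Poly_Mapping.keys g"
  note sup = mpoly_eval_superset[OF assms, of ?S]
  show ?thesis
    using sup[of "f + g"] sup[of f] sup[of g] Poly_Mapping.keys_add[of f g] assms
    by (simp add: lookup_add distrib_right sum.distrib real_hom_def)
qed

lemma mpoly_eval_sum:
  assumes "real_hom \<phi>"
  shows "mpoly_eval \<phi> x (\<Sum>i\<in>S. f i) = (\<Sum>i\<in>S. mpoly_eval \<phi> x (f i))"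
  by (induction S rule: infinite_finite_induct) (auto simp: mpoly_eval_add[OF assms])

lemma mpoly_eval_single:
  assumes "real_hom \<phi>"
  shows "mpoly_eval \<phi> x (Poly_Mapping.single \<alpha> c) = \<phi> c * monom_eval x \<alpha>"
  using assms by (auto simp: mpoly_eval_alt real_hom_def)

lemma mpoly_sum_single:
  "f = (\<Sum>\<alpha>\<in>Poly_Mapping.keys f. Poly_Mapping.single \<alpha> (Poly_Mapping.lookup f \<alpha>))"
proof (rule poly_mapping_eqI)
  fix \<beta>
  show "Poly_Mapping.lookup f \<beta> = Poly_Mapping.lookup
          (\<Sum>\<alpha>\<in>Poly_Mapping.keys f. Poly_Mapping.single \<alpha> (Poly_Mapping.lookup f \<alpha>)) \<beta>"
    by (simp add: lookup_sum lookup_single when_def sum.delta in_keys_iff cong: if_cong)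
qed

lemma mpoly_single_induct [case_names single add]:
  fixes f :: "'v mpoly"
  assumes "\<And>\<alpha> c. P (Poly_Mapping.single \<alpha> c)" "\<And>f g. P f \<Longrightarrow> P g \<Longrightarrow> P (f + g)"
  shows "P f"
proof -
  have "P (\<Sum>\<alpha>\<in>S. Poly_Mapping.single \<alpha> (Poly_Mapping.lookup f \<alpha>))" if "finite S" for S
    using that
  proof (induction S rule: finite_induct)
    case empty
    show ?case using assms(1)[of 0 0] by simp
  qed (use assms in auto)
  then show ?thesis
    using mpoly_sum_single[of f] by (metis finite_keys)
qed

lemma mpoly_eval_mult:
  assumes "real_hom \<phi>"
  shows "mpoly_eval \<phi> x (f * g) = mpoly_eval \<phi> x f * mpoly_eval \<phi> x g"
proof (induction f rule: mpoly_single_induct)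
  case (single \<alpha> c)
  show ?case
  proof (induction g rule: mpoly_single_induct)
    case (single \<beta> d)
    then show ?case
      using assms by (simp add: mult_single mpoly_eval_single[OF assms] monom_eval_add real_hom_def)
  next
    case (add g h)
    then show ?case
      by (simp add: distrib_left mpoly_eval_add[OF assms])
  qed
next
  case (add f h)
  then show ?case
    by (simp add: distrib_right mpoly_eval_add[OF assms])
qed

lemma single_monom:
  fixes \<alpha> :: "'v \<Rightarrow>\<^sub>0 nat"
  assumes "finite S" "Poly_Mapping.keys \<alpha> \<subseteq> S"
  shows "Poly_Mapping.single \<alpha> c = Const c * (\<Prod>v\<in>S. Var v ^ Poly_Mapping.lookup \<alpha> v)"
proof -
  have pow: "Var v ^ n = Poly_Mapping.single (Poly_Mapping.single v n) (1::real)" for v :: 'v and n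
    by (induction n) (auto simp: Var_def mult_single single_add[symmetric])
  have "(\<Prod>v\<in>S. Poly_Mapping.single (g v) (1::real)) = Poly_Mapping.single (\<Sum>v\<in>S. g v) 1"
    for g :: "'v \<Rightarrow> ('v \<Rightarrow>\<^sub>0 nat)"
    by (induction S rule: infinite_finite_induct) (auto simp: mult_single)
  moreover have "(\<Sum>v\<in>S. Poly_Mapping.single v (Poly_Mapping.lookup \<alpha> v)) = \<alpha>"
  proof (rule poly_mapping_eqI)
    fix \<beta>
    show "Poly_Mapping.lookup (\<Sum>v\<in>S. Poly_Mapping.single v (Poly_Mapping.lookup \<alpha> v)) \<beta> =
        Poly_Mapping.lookup \<alpha> \<beta>"
      using assms by (auto simp: lookup_sum lookup_single when_def sum.delta in_keys_iff cong: if_cong)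
  qed
  ultimately show ?thesis
    by (simp add: pow mult_single)
qed

text \<open>Continuity, Lipschitz bounds, Bernstein expansions and first-order expansions are all
  obtained this way: the property, or a strengthening of it, passes through sums and products, which
  leaves constants and variables.\<close>

lemma mpoly_ring_induct [case_names Const Var add mult]:
  fixes f :: "'v mpoly"
  assumes "\<And>c. P (Const c)" "\<And>v. P (Var v)"
    "\<And>f g. P f \<Longrightarrow> P g \<Longrightarrow> P (f + g)" "\<And>f g. P f \<Longrightarrow> P g \<Longrightarrow> P (f * g)"
  shows "P f"
proof (induction f rule: mpoly_single_induct)
  case (single \<alpha> c)
  have pow: "P (Var v ^ n)" for v n
    by (induction n) (use assms(1)[of 1] assms(2,4) in auto)
  have "P (\<Prod>v\<in>S. Var v ^ Poly_Mapping.lookup \<alpha> v)" for S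
    by (induction S rule: infinite_finite_induct) (use assms(1)[of 1] assms(4) pow in auto)
  then show ?case
    using single_monom[of "Poly_Mapping.keys \<alpha>" \<alpha> c] assms(1)[of c] assms(4) by auto
qed (use assms in auto)

lemma real_hom_id: "real_hom (\<lambda>c. c)"
  by (simp add: real_hom_def)

lemma eval_add [simp]: "eval_at x (f + g) = eval_at x f + eval_at x g"
  by (rule mpoly_eval_add[OF real_hom_id])

lemma eval_mult [simp]: "eval_at x (f * g) = eval_at x f * eval_at x g"
  by (rule mpoly_eval_mult[OF real_hom_id])

lemma eval_Const [simp]: "eval_at x (Const c) = c"
  by (simp add: mpoly_eval_single[OF real_hom_id])

lemma eval_Var [simp]: "eval_at x (Var v) = x v"
  by (simp add: Var_def mpoly_eval_single[OF real_hom_id])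

lemma eval_1 [simp]: "eval_at x 1 = 1"
  using eval_Const[of x 1] by simp

lemma eval_uminus [simp]: "eval_at x (- f) = - eval_at x f"
  using eval_add[of x f "- f"] by simp

lemma eval_diff [simp]: "eval_at x (f - g) = eval_at x f - eval_at x g"
  using eval_add[of x f "- g"] by simp

lemma eval_power [simp]: "eval_at x (f ^ n) = eval_at x f ^ n"
  by (induction n) auto

lemma eval_sum [simp]: "eval_at x (\<Sum>i\<in>S. f i) = (\<Sum>i\<in>S. eval_at x (f i))"
  by (rule mpoly_eval_sum[OF real_hom_id])

lemma eval_prod [simp]: "eval_at x (\<Prod>i\<in>S. f i) = (\<Prod>i\<in>S. eval_at x (f i))"
  by (induction S rule: infinite_finite_induct) auto

lemma continuous_eval [continuous_intros]: "continuous_on S (\<lambda>x. eval_at x f)"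
proof (induction f rule: mpoly_ring_induct)
  case (Var v)
  then show ?case
    by (auto intro: continuous_on_subset[OF continuous_on_product_coordinates])
qed (auto intro: continuous_intros)

lemma continuous_eval_compose [continuous_intros]:
  assumes "continuous_on S g"
  shows "continuous_on S (\<lambda>s. eval_at (g s) f)"
  by (rule continuous_on_compose2[OF continuous_eval assms]) auto

lemma continuous_coord:
  fixes g :: "'a::topological_space \<Rightarrow> 'i \<Rightarrow> real"
  assumes "continuous_on S g"
  shows "continuous_on S (\<lambda>s. g s i)"
  using continuous_on_product_then_coordinatewise[OF assms] .

lemma eval_tendsto: "((\<lambda>x. eval_at x f) \<longlongrightarrow> eval_at p f) (nhds p)"
proof -
  have "((\<lambda>x. eval_at x f) \<longlongrightarrow> eval_at p f) (at p)"
    using continuous_eval[of UNIV f] by (simp add: continuous_on_def)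
  then show ?thesis
    using tendsto_at_iff_tendsto_nhds[of "\<lambda>x. eval_at x f" p] by blast
qed

section \<open>Compactness\<close>

text \<open>Points are functions with the product topology, so this is Tychonoff's theorem. The
  index type may be infinite, as for vectors indexed by \<open>nat\<close>.\<close>

lemma compact_box:
  fixes l u :: "'i \<Rightarrow> real"
  shows "compact {x. \<forall>i. l i \<le> x i \<and> x i \<le> u i}"
proof -
  have "compactin (product_topology (\<lambda>i. euclidean) UNIV) (PiE UNIV (\<lambda>i. {l i..u i}))"
    by (subst compactin_PiE) auto
  then have "compact (PiE UNIV (\<lambda>i. {l i..u i}))"
    by (simp add: euclidean_product_topology)
  moreover have "PiE UNIV (\<lambda>i. {l i..u i}) = {x. \<forall>i. l i \<le> x i \<and> x i \<le> u i}"
    by (auto simp: PiE_def)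
  ultimately show ?thesis by simp
qed

lemma compact_pos_lower_bound:
  fixes f :: "'a::topological_space \<Rightarrow> real"
  assumes "compact S" "continuous_on S f" "\<And>x. x \<in> S \<Longrightarrow> f x > 0"
  obtains c where "c > 0" "\<And>x. x \<in> S \<Longrightarrow> c \<le> f x"
proof (cases "S = {}")
  case True
  then show ?thesis using that[of 1] by auto
next
  case False
  then obtain x where "x \<in> S" "\<forall>y\<in>S. f x \<le> f y"
    using continuous_attains_inf[OF assms(1) _ assms(2)] by auto
  then show ?thesis using that[of "f x"] assms(3) by auto
qed

lemma compact_upper_bound:
  fixes f :: "'a::topological_space \<Rightarrow> real"
  assumes "compact S" "continuous_on S f"
  obtains c where "c > 0" "\<And>x. x \<in> S \<Longrightarrow> \<bar>f x\<bar> \<le> c"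
proof (cases "S = {}")
  case True
  then show ?thesis using that[of 1] by auto
next
  case False
  have "continuous_on S (\<lambda>x. \<bar>f x\<bar>)"
    using assms(2) by (intro continuous_intros)
  then obtain x where "x \<in> S" "\<forall>y\<in>S. \<bar>f y\<bar> \<le> \<bar>f x\<bar>"
    using continuous_attains_sup[OF assms(1) False] by auto
  then show ?thesis using that[of "\<bar>f x\<bar> + 1"] by force
qed

lemma compact_Int_closed_cond:
  fixes f :: "'a::topological_space \<Rightarrow> real"
  assumes "compact S" "continuous_on UNIV f"
  shows "compact {x\<in>S. f x \<le> 0}"
proof -
  have "closed {x. f x \<le> 0}"
    using assms(2) by (intro closed_Collect_le) (auto intro: continuous_intros)
  then have "compact (S \<inter> {x. f x \<le> 0})"
    by (rule compact_Int_closed[OF assms(1)])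
  moreover have "S \<inter> {x. f x \<le> 0} = {x\<in>S. f x \<le> 0}" by auto
  ultimately show ?thesis by simp
qed

text \<open>Finsler's lemma with continuous functions in place of quadratic forms.\<close>

lemma compact_positive_multiple:
  fixes \<phi> \<psi> :: "'a::topological_space \<Rightarrow> real"
  assumes S: "compact S" and cont: "continuous_on UNIV \<phi>" "continuous_on UNIV \<psi>"
    and \<psi>: "\<And>x. x \<in> S \<Longrightarrow> \<psi> x \<ge> 0"
    and \<phi>: "\<And>x. x \<in> S \<Longrightarrow> \<psi> x = 0 \<Longrightarrow> \<phi> x > 0"
  obtains \<kappa> \<delta> where "\<kappa> > 0" "\<delta> > 0" "\<And>x. x \<in> S \<Longrightarrow> \<phi> x + \<kappa> * \<psi> x \<ge> \<delta>"
proof -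
  let ?Z = "{x\<in>S. \<phi> x \<le> 0}"
  have Z: "compact ?Z"
    by (rule compact_Int_closed_cond[OF S cont(1)])
  have "\<psi> x > 0" if "x \<in> ?Z" for x
    using that \<psi>[of x] \<phi>[of x] by force
  then obtain c where c: "c > 0" "\<And>x. x \<in> ?Z \<Longrightarrow> c \<le> \<psi> x"
    using compact_pos_lower_bound[OF Z continuous_on_subset[OF cont(2)]] by blast
  obtain b where b: "b > 0" "\<And>x. x \<in> S \<Longrightarrow> \<bar>\<phi> x\<bar> \<le> b"
    using compact_upper_bound[OF S continuous_on_subset[OF cont(1)]] by blast
  \<comment> \<open>On \<open>?Z\<close> this factor makes \<open>l * \<psi> x\<close> at least
    \<open>b + 1\<close>, which outweighs \<open>\<phi> x \<ge> - b\<close>; off \<open>?Z\<close>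
    the function \<open>\<phi>\<close> is positive already.\<close>
  define l where "l = (b + 1) / c"
  have l: "l > 0" using b c by (simp add: l_def)
  have "\<phi> x + l * \<psi> x > 0" if "x \<in> S" for x
  proof (cases "\<phi> x \<le> 0")
    case True
    then have "c \<le> \<psi> x" using c that by auto
    then have "l * c \<le> l * \<psi> x" using l by (intro mult_left_mono) auto
    moreover have "l * c = b + 1" using c by (simp add: l_def)
    ultimately show ?thesis using b(2)[OF that] by linarith
  next
    case False
    then show ?thesis using \<psi>[OF that] l by (simp add: add_pos_nonneg)
  qed
  moreover have "continuous_on S (\<lambda>x. \<phi> x + l * \<psi> x)"
    by (intro continuous_intros continuous_on_subset[OF cont(1)] continuous_on_subset[OF cont(2)]) auto
  ultimately obtain \<delta> where "\<delta> > 0" "\<And>x. x \<in> S \<Longrightarrow> \<delta> \<le> \<phi> x + l * \<psi> x"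
    using compact_pos_lower_bound[OF S, of "\<lambda>x. \<phi> x + l * \<psi> x"] by blast
  then show ?thesis using that l by blast
qed

section \<open>Orders of vanishing and quadratic growth\<close>

definition rho :: "('d::finite \<Rightarrow> real) \<Rightarrow> ('d \<Rightarrow> real) \<Rightarrow> real" where
  "rho p x = sqrt (\<Sum>i\<in>UNIV. (x i - p i)^2)"

definition sq_dist_poly :: "('d::finite \<Rightarrow> real) \<Rightarrow> 'd mpoly" where
  "sq_dist_poly p = (\<Sum>i\<in>UNIV. (Var i - Const (p i))^2)"

lemma rho_nonneg [simp]: "rho p x \<ge> 0"
  by (simp add: rho_def sum_nonneg)

lemma rho_sq: "(rho p x)^2 = (\<Sum>i\<in>UNIV. (x i - p i)^2)"
  by (simp add: rho_def sum_nonneg)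

lemma eval_sq_dist_poly [simp]: "eval_at x (sq_dist_poly p) = (rho p x)^2"
  by (simp add: sq_dist_poly_def rho_sq)

lemma coord_le_rho: "\<bar>x i - p i\<bar> \<le> rho p x"
proof -
  have "(x i - p i)^2 \<le> (rho p x)^2"
    unfolding rho_sq by (rule member_le_sum) auto
  then show ?thesis
    by (metis abs_le_square_iff abs_of_nonneg rho_nonneg)
qed

lemma rho_eq_0_iff [simp]: "rho p x = 0 \<longleftrightarrow> x = p"
  by (auto simp: rho_def sum_nonneg_eq_0_iff fun_eq_iff)

lemma rho_self [simp]: "rho p p = 0"
  by simp

lemma rho_pos_iff [simp]: "0 < rho p x \<longleftrightarrow> x \<noteq> p"
  using rho_nonneg[of p x] rho_eq_0_iff[of p x] by linarith

lemma rho_tendsto: "((\<lambda>x. rho p x) \<longlongrightarrow> 0) (nhds p)"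
  using tendsto_real_sqrt[OF eval_tendsto[of "sq_dist_poly p" p]] by (simp add: real_sqrt_unique)

lemma eventually_rho_less: "\<delta> > 0 \<Longrightarrow> \<forall>\<^sub>F x in nhds p. rho p x < \<delta>"
  using order_tendstoD(2)[OF rho_tendsto] by auto

lemma tendsto_bigo_1:
  fixes f :: "'a \<Rightarrow> real"
  assumes "(f \<longlongrightarrow> l) F"
  shows "f \<in> O[F](\<lambda>_. 1)"
proof (rule bigoI)
  have "\<forall>\<^sub>F x in F. \<bar>f x\<bar> < \<bar>l\<bar> + 1"
    by (rule order_tendstoD(2)[OF tendsto_rabs[OF assms]]) simp
  then show "\<forall>\<^sub>F x in F. norm (f x) \<le> (\<bar>l\<bar> + 1) * norm (1::real)"
    by eventually_elim auto
qed

lemma eval_bigo_1: "(\<lambda>x. eval_at x f) \<in> O[nhds p](\<lambda>_. 1)"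
  by (rule tendsto_bigo_1[OF eval_tendsto])

lemma rho_bigo_1: "(\<lambda>x. rho p x) \<in> O[nhds p](\<lambda>_. 1)"
  by (rule tendsto_bigo_1[OF rho_tendsto])

lemma bigo_mult_bounded:
  fixes f g h :: "'a \<Rightarrow> real"
  assumes "f \<in> O[F](h)" "g \<in> O[F](\<lambda>_. 1)"
  shows "(\<lambda>x. f x * g x) \<in> O[F](h)" "(\<lambda>x. g x * f x) \<in> O[F](h)"
  using landau_o.big.mult[OF assms] landau_o.big.mult[OF assms(2,1)] by auto

lemma bigo_rho_mono:
  assumes "f \<in> O[nhds p](\<lambda>x. rho p x ^ n)" "m \<le> n"
  shows "f \<in> O[nhds p](\<lambda>x. rho p x ^ m)"
proof -
  have 1: "(\<lambda>x. rho p x ^ k) \<in> O[nhds p](\<lambda>_. 1)" for k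
    using landau_o.big_power[OF rho_bigo_1, where m = k] by simp
  have "(\<lambda>x. rho p x ^ m * rho p x ^ (n - m)) \<in> O[nhds p](\<lambda>x. rho p x ^ m)"
    by (rule bigo_mult_bounded(1)[OF _ 1]) simp
  then have "(\<lambda>x. rho p x ^ n) \<in> O[nhds p](\<lambda>x. rho p x ^ m)"
    using assms(2) by (simp add: power_add[symmetric])
  then show ?thesis
    using assms(1) landau_o.big_trans by blast
qed

lemma bigo_rho_mult:
  assumes "f \<in> O[nhds p](\<lambda>x. rho p x ^ m)" "g \<in> O[nhds p](\<lambda>x. rho p x ^ n)"
  shows "(\<lambda>x. f x * g x) \<in> O[nhds p](\<lambda>x. rho p x ^ (m + n))"
  using landau_o.big.mult[OF assms] by (simp add: power_add)

text \<open>A Lipschitz estimate at \<open>p\<close>. Products go through by f g - f(p) g(p) = (f -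
  f(p)) g + f(p) (g - g(p)), where \<open>g\<close> is bounded near \<open>p\<close>.\<close>

lemma eval_diff_bigo: "(\<lambda>x. eval_at x f - eval_at p f) \<in> O[nhds p](\<lambda>x. rho p x)"
proof (induction f rule: mpoly_ring_induct)
  case (Var v)
  have "norm (x v - p v) \<le> 1 * norm (rho p x)" for x
    using coord_le_rho[of x v p] by simp
  then show ?case
    by (intro bigoI[where c = 1]) auto
next
  case (add f g)
  then show ?case
    using sum_in_bigo(1)[OF add] by (simp add: algebra_simps)
next
  case (mult f g)
  have "(\<lambda>x. (eval_at x f - eval_at p f) * eval_at x g + eval_at p f * (eval_at x g - eval_at p g))
      \<in> O[nhds p](\<lambda>x. rho p x)"
    by (intro sum_in_bigo bigo_mult_bounded mult eval_bigo_1) auto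
  then show ?case
    by (simp add: algebra_simps)
qed auto

lemma eval_zero_bigo: "eval_at p f = 0 \<Longrightarrow> (\<lambda>x. eval_at x f) \<in> O[nhds p](\<lambda>x. rho p x ^ 1)"
  using eval_diff_bigo[of f p] by simp

text \<open>The filter is \<open>nhds p\<close> and not \<open>at p\<close>, so the bound may be
  read off at \<open>p\<close> itself, where \<open>rho\<close> is 0.\<close>

lemma eval_at_0_of_bigo:
  assumes "(\<lambda>x. eval_at x f) \<in> O[nhds p](\<lambda>x. rho p x ^ n)" "n > 0"
  shows "eval_at p f = 0"
proof -
  obtain c where "\<forall>\<^sub>F x in nhds p. norm (eval_at x f) \<le> c * norm (rho p x ^ n)"
    using assms(1) by (elim landau_o.bigE)
  then have "norm (eval_at p f) \<le> c * norm (rho p p ^ n)"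
    by (rule eventually_nhds_x_imp_x)
  then show ?thesis using assms(2) by (simp add: power_0_left)
qed

text \<open>A nondegenerate local minimum without derivatives, on a full neighbourhood in R^d. It
  gives only that the value at \<open>p\<close> is at least 0; that the value is 0 is stated
  separately where it matters.\<close>

definition growth :: "('d::finite \<Rightarrow> real) \<Rightarrow> 'd mpoly \<Rightarrow> bool" where
  "growth p h \<longleftrightarrow> (\<exists>c>0. \<forall>\<^sub>F x in nhds p. eval_at x h \<ge> c * (rho p x)^2)"

text \<open>On the ball of radius \<open>\<epsilon> / c\<close> one of the three factors
  \<open>rho\<close> is traded for the small constant. This is what makes cubic terms negligible
  against \<open>growth\<close>.\<close>

lemma bigo_3_small:
  assumes "f \<in> O[nhds p](\<lambda>x. rho p x ^ 3)" "\<epsilon> > 0"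
  shows "\<forall>\<^sub>F x in nhds p. \<bar>f x\<bar> \<le> \<epsilon> * (rho p x)^2"
proof -
  obtain c where c: "c > 0" "\<forall>\<^sub>F x in nhds p. norm (f x) \<le> c * norm (rho p x ^ 3)"
    using assms(1) by (elim landau_o.bigE)
  have "\<forall>\<^sub>F x in nhds p. rho p x < \<epsilon> / c"
    using c assms(2) by (intro eventually_rho_less) auto
  with c(2) show ?thesis
  proof eventually_elim
    case (elim x)
    have "\<bar>f x\<bar> \<le> c * (rho p x ^ 3)" using elim by simp
    also have "\<dots> = (c * rho p x) * (rho p x)^2" by (simp add: power_numeral_reduce)
    also have "\<dots> \<le> \<epsilon> * (rho p x)^2"
      using elim c by (intro mult_right_mono) (auto simp: field_simps)
    finally show ?case .
  qed
qed

lemma growth_add_bigo_3: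
  assumes "growth p h" "(\<lambda>x. eval_at x r) \<in> O[nhds p](\<lambda>x. rho p x ^ 3)"
  shows "growth p (h + r)"
proof -
  obtain c where c: "c > 0" "\<forall>\<^sub>F x in nhds p. eval_at x h \<ge> c * (rho p x)^2"
    using assms(1) by (auto simp: growth_def)
  have "\<forall>\<^sub>F x in nhds p. \<bar>eval_at x r\<bar> \<le> (c / 2) * (rho p x)^2"
    using c by (intro bigo_3_small assms) auto
  with c(2) have "\<forall>\<^sub>F x in nhds p. eval_at x (h + r) \<ge> (c / 2) * (rho p x)^2"
    by eventually_elim (auto simp: abs_le_iff)
  then show ?thesis
    unfolding growth_def using c by (intro exI[of _ "c/2"]) auto
qed

lemma growth_diff_bigo_3:
  assumes "growth p h" "(\<lambda>x. eval_at x r) \<in> O[nhds p](\<lambda>x. rho p x ^ 3)"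
  shows "growth p (h - r)"
  using growth_add_bigo_3[OF assms(1), of "- r"] assms(2) by simp

text \<open>From a b - 1 = a (b - 1) + (a - 1). Order 2 is the order required of cutoffs: such a
  factor changes a polynomial vanishing at \<open>p\<close> by O(rho^3).\<close>

lemma near_1_mult:
  assumes "(\<lambda>x. eval_at x a - 1) \<in> O[nhds p](\<lambda>x. rho p x ^ 2)"
    and "(\<lambda>x. eval_at x b - 1) \<in> O[nhds p](\<lambda>x. rho p x ^ 2)"
  shows "(\<lambda>x. eval_at x (a * b) - 1) \<in> O[nhds p](\<lambda>x. rho p x ^ 2)"
proof -
  have "(\<lambda>x. eval_at x a * (eval_at x b - 1) + (eval_at x a - 1)) \<in> O[nhds p](\<lambda>x. rho p x ^ 2)"
    by (intro sum_in_bigo bigo_mult_bounded assms eval_bigo_1)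
  then show ?thesis by (simp add: algebra_simps)
qed

section \<open>Positive definite forms are sums of squares\<close>

lemma real_hom_Const: "real_hom Const"
  by (simp add: real_hom_def Const_add Const_mult)

lemma real_hom_diff:
  assumes "real_hom \<phi>"
  shows "\<phi> (a - b) = \<phi> a - \<phi> b"
proof -
  have "\<phi> (a - b) + \<phi> b = \<phi> (a - b + b)" using assms unfolding real_hom_def by metis
  then show ?thesis by (simp add: algebra_simps)
qed

lemma real_hom_of_nat: "real_hom \<phi> \<Longrightarrow> \<phi> (of_nat n) = of_nat n"
  by (induction n) (auto simp: real_hom_def)

text \<open>One step of symmetric Gauss elimination; the remaining coefficients form the Schur
  complement of the pivot \<open>c k k\<close>. The map \<open>\<phi>\<close> allows the same
  identity to be used over the reals, to see positivity, and over the polynomials, to see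
  membership.\<close>

lemma complete_square_identity:
  fixes v :: "'i \<Rightarrow> 'a::comm_ring_1" and c :: "'i \<Rightarrow> 'i \<Rightarrow> real"
  assumes hom: "real_hom \<phi>" and S: "finite S" "k \<notin> S"
    and sym: "\<And>i j. c i j = c j i" and a: "c k k \<noteq> 0"
  shows "(\<Sum>i\<in>insert k S. \<Sum>j\<in>insert k S. \<phi> (c i j) * v i * v j) =
         \<phi> (c k k) * (v k + (\<Sum>j\<in>S. \<phi> (c k j / c k k) * v j))^2 +
         (\<Sum>i\<in>S. \<Sum>j\<in>S. \<phi> (c i j - c k i * c k j / c k k) * v i * v j)"
proof -
  define s where "s = (\<Sum>j\<in>S. \<phi> (c k j / c k k) * v j)"
  have m: "\<phi> (x * y) = \<phi> x * \<phi> y" for x y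
    using hom by (simp add: real_hom_def)
  have as: "\<phi> (c k k) * s = (\<Sum>j\<in>S. \<phi> (c k j) * v j)"
    using a by (simp add: s_def sum_distrib_left mult.assoc[symmetric] m[symmetric])
  have ass: "\<phi> (c k k) * (s * s) = (\<Sum>i\<in>S. \<Sum>j\<in>S. \<phi> (c k i * c k j / c k k) * v i * v j)"
  proof -
    have "\<phi> (c k k) * (s * s) = (\<Sum>i\<in>S. \<phi> (c k i) * v i) * s"
      by (simp add: as[symmetric] mult.assoc)
    also have "\<dots> = (\<Sum>i\<in>S. \<Sum>j\<in>S. \<phi> (c k i) * v i * (\<phi> (c k j / c k k) * v j))"
      by (simp add: s_def sum_product)
    also have "\<dots> = (\<Sum>i\<in>S. \<Sum>j\<in>S. \<phi> (c k i * (c k j / c k k)) * v i * v j)"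
      by (simp only: m mult_ac)
    finally show ?thesis by simp
  qed
  have "(\<Sum>i\<in>insert k S. \<Sum>j\<in>insert k S. \<phi> (c i j) * v i * v j) =
      \<phi> (c k k) * v k * v k + (\<Sum>j\<in>S. \<phi> (c k j) * v k * v j) +
      (\<Sum>i\<in>S. \<phi> (c i k) * v i * v k) + (\<Sum>i\<in>S. \<Sum>j\<in>S. \<phi> (c i j) * v i * v j)"
    using S by (simp add: sum.distrib algebra_simps)
  also have "(\<Sum>j\<in>S. \<phi> (c k j) * v k * v j) = v k * (\<phi> (c k k) * s)"
    unfolding as by (simp add: sum_distrib_left mult_ac)
  also have "(\<Sum>i\<in>S. \<phi> (c i k) * v i * v k) = v k * (\<phi> (c k k) * s)"
    unfolding as by (simp add: sum_distrib_left mult_ac sym[of _ k])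
  also have "(\<Sum>i\<in>S. \<Sum>j\<in>S. \<phi> (c i j) * v i * v j) =
      (\<Sum>i\<in>S. \<Sum>j\<in>S. \<phi> (c i j - c k i * c k j / c k k) * v i * v j) + \<phi> (c k k) * (s * s)"
    unfolding ass by (simp add: sum.distrib[symmetric] real_hom_diff[OF hom] algebra_simps)
  finally show ?thesis
    unfolding s_def[symmetric] by (simp add: power2_eq_square algebra_simps)
qed

text \<open>Diagonalization by induction on the number of variables: the pivot is positive, as
  testing at a unit vector shows, and the Schur complement is again positive definite. The
  \<open>v i\<close> are arbitrary elements, so the form becomes a sum of squares in the
  cone.\<close>

lemma symmetric_pd_form_in_cone:
  fixes T :: "'v mpoly set" and c :: "'i \<Rightarrow> 'i \<Rightarrow> real"
  assumes T: "0 \<in> T" "\<And>a b. a \<in> T \<Longrightarrow> b \<in> T \<Longrightarrow> a + b \<in> T" "\<And>a. a^2 \<in> T"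
    and S: "finite S" and sym: "\<And>i j. c i j = c j i"
    and pos: "\<And>w. (\<exists>i\<in>S. w i \<noteq> 0) \<Longrightarrow> (\<Sum>i\<in>S. \<Sum>j\<in>S. c i j * w i * w j) > (0::real)"
  shows "(\<Sum>i\<in>S. \<Sum>j\<in>S. Const (c i j) * v i * v j) \<in> T"
  using S sym pos
proof (induction S arbitrary: c rule: finite_induct)
  case empty
  then show ?case using T by simp
next
  case (insert k S)
  have ckk: "c k k > 0"
  proof -
    let ?w = "\<lambda>i. if i = k then 1 else 0 :: real"
    have "0 < (\<Sum>i\<in>insert k S. \<Sum>j\<in>insert k S. c i j * ?w i * ?w j)"
      by (intro insert.prems(2) bexI[of _ k]) auto
    also have "\<dots> = (\<Sum>i\<in>insert k S. \<Sum>j\<in>insert k S. if j = k then (if i = k then c k k else 0) else 0)"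
      by (intro sum.cong) auto
    also have "\<dots> = c k k"
      using insert.hyps by (simp add: sum.delta)
    finally show ?thesis .
  qed
  let ?d = "\<lambda>i j. c i j - c k i * c k j / c k k"
  have "(\<Sum>i\<in>S. \<Sum>j\<in>S. Const (?d i j) * v i * v j) \<in> T"
  proof (rule insert.IH)
    show "?d i j = ?d j i" for i j
      using insert.prems(1)[of i j] by (simp add: mult.commute)
    fix w :: "'i \<Rightarrow> real" assume w: "\<exists>i\<in>S. w i \<noteq> 0"
    \<comment> \<open>The value at \<open>k\<close> is chosen so that the completed square vanishes
      and the Schur complement alone remains.\<close>
    let ?w = "\<lambda>i. if i = k then - (\<Sum>j\<in>S. c k j / c k k * w j) else w i"
    have w_eq: "?w i = w i" if "i \<in> S" for i
      using insert.hyps that by auto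
    have "0 < (\<Sum>i\<in>insert k S. \<Sum>j\<in>insert k S. c i j * ?w i * ?w j)"
      by (rule insert.prems(2)) (use w w_eq in force)
    also have "\<dots> = c k k * (?w k + (\<Sum>j\<in>S. c k j / c k k * ?w j))^2 +
        (\<Sum>i\<in>S. \<Sum>j\<in>S. ?d i j * ?w i * ?w j)"
      using ckk by (intro complete_square_identity real_hom_id insert.hyps insert.prems(1)) auto
    also have "(\<Sum>j\<in>S. c k j / c k k * ?w j) = (\<Sum>j\<in>S. c k j / c k k * w j)"
      by (intro sum.cong) (simp_all add: w_eq)
    also have "(\<Sum>i\<in>S. \<Sum>j\<in>S. ?d i j * ?w i * ?w j) = (\<Sum>i\<in>S. \<Sum>j\<in>S. ?d i j * w i * w j)"
      by (intro sum.cong) (simp_all add: w_eq)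
    finally show "(\<Sum>i\<in>S. \<Sum>j\<in>S. ?d i j * w i * w j) > 0"
      by simp
  qed
  moreover have "Const (c k k) * u^2 \<in> T" for u
  proof -
    have "Const (c k k) * u^2 = (Const (sqrt (c k k)) * u)^2"
      using ckk by (simp add: power_mult_distrib Const_power[symmetric] del: real_sqrt_power)
    then show ?thesis using T(3) by simp
  qed
  ultimately show ?case
    using T(2) ckk
    by (subst complete_square_identity[OF real_hom_Const insert.hyps insert.prems(1)]) auto
qed

text \<open>Completing squares requires a symmetric matrix, while the coefficient matrices met later
  need not be symmetric; averaging with the transpose does not change the form.\<close>

lemma symmetrize_form:
  fixes c :: "'i \<Rightarrow> 'i \<Rightarrow> real"
  assumes hom: "real_hom \<phi>"
  shows "(\<Sum>i\<in>S. \<Sum>j\<in>S. \<phi> ((c i j + c j i) / 2) * v i * v j) =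
    (\<Sum>i\<in>S. \<Sum>j\<in>S. \<phi> (c i j) * v i * v j)"
proof -
  have add: "\<phi> (x + y) = \<phi> x + \<phi> y" for x y
    using hom by (simp add: real_hom_def)
  have half: "\<phi> (x / 2) + \<phi> (x / 2) = \<phi> x" for x
    by (simp flip: add)
  have swap: "(\<Sum>i\<in>S. \<Sum>j\<in>S. \<phi> (c j i / 2) * v i * v j) = (\<Sum>i\<in>S. \<Sum>j\<in>S. \<phi> (c i j / 2) * v i * v j)"
    by (subst sum.swap) (simp add: mult_ac)
  have "(\<Sum>i\<in>S. \<Sum>j\<in>S. \<phi> ((c i j + c j i) / 2) * v i * v j) =
      (\<Sum>i\<in>S. \<Sum>j\<in>S. \<phi> (c i j / 2) * v i * v j) + (\<Sum>i\<in>S. \<Sum>j\<in>S. \<phi> (c j i / 2) * v i * v j)"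
    by (simp only: add_divide_distrib add distrib_right sum.distrib)
  then show ?thesis
    unfolding swap by (simp only: sum.distrib[symmetric] distrib_right[symmetric] half)
qed

lemma pd_form_in_cone:
  fixes T :: "'v mpoly set" and c :: "'i \<Rightarrow> 'i \<Rightarrow> real"
  assumes "0 \<in> T" "\<And>a b. a \<in> T \<Longrightarrow> b \<in> T \<Longrightarrow> a + b \<in> T" "\<And>a. a^2 \<in> T" "finite S"
    and pos: "\<And>w. (\<exists>i\<in>S. w i \<noteq> 0) \<Longrightarrow> (\<Sum>i\<in>S. \<Sum>j\<in>S. c i j * w i * w j) > (0::real)"
  shows "(\<Sum>i\<in>S. \<Sum>j\<in>S. Const (c i j) * v i * v j) \<in> T"
  unfolding symmetrize_form[OF real_hom_Const, symmetric, of c]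
proof (rule symmetric_pd_form_in_cone[OF assms(1-4)])
  fix w :: "'i \<Rightarrow> real" assume "\<exists>i\<in>S. w i \<noteq> 0"
  then show "(\<Sum>i\<in>S. \<Sum>j\<in>S. (c i j + c j i) / 2 * w i * w j) > 0"
    unfolding symmetrize_form[OF real_hom_id] by (rule pos)
qed (simp_all add: add.commute)

section \<open>Bernstein coefficients\<close>

text \<open>For \<open>k \<le> N\<close> this is binom(a, k) / binom(N, k), the coefficient of the
  power \<open>y^k\<close> at index \<open>a\<close> in the Bernstein basis of degree
  \<open>N\<close>. As a product its limit is visible, each factor being close to a / N.\<close>

definition bern_coeff :: "nat \<Rightarrow> nat \<Rightarrow> nat \<Rightarrow> real" where
  "bern_coeff N k a = (\<Prod>t<k. (real a - real t) / (real N - real t))"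

lemma bern_coeff_eq_0: "a < k \<Longrightarrow> bern_coeff N k a = 0"
  unfolding bern_coeff_def by (rule prod_zero) auto

text \<open>The identity binom(N, a) binom(a, k) = binom(N, k) binom(N - k, a - k), divided by
  binom(N, k). For \<open>a < k\<close> the product contains the factor 0.\<close>

lemma bern_coeff_binomial:
  "k \<le> N \<Longrightarrow> a \<le> N \<Longrightarrow>
   bern_coeff N k a * real (N choose a) = (if k \<le> a then real ((N - k) choose (a - k)) else 0)"
proof (induction k)
  case 0
  then show ?case by (simp add: bern_coeff_def)
next
  case (Suc k)
  show ?case
  proof (cases "k < a")
    case True
    have IH: "bern_coeff N k a * real (N choose a) = real ((N - k) choose (a - k))"
      using Suc True by simp
    have "(a - k) * ((N - k) choose (a - k)) = (N - k) * ((N - k - 1) choose (a - k - 1))"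
      using True by (intro times_binomial_minus1_eq) auto
    then have eq: "(real a - real k) * real ((N - k) choose (a - k)) =
        (real N - real k) * real ((N - Suc k) choose (a - Suc k))"
      using True Suc.prems
      by (metis (no_types, lifting) Suc_leD diff_Suc_eq_diff_pred diff_commute less_imp_le_nat of_nat_diff of_nat_mult)
    have "bern_coeff N (Suc k) a * real (N choose a) =
        (real a - real k) * (bern_coeff N k a * real (N choose a)) / (real N - real k)"
      by (simp add: bern_coeff_def)
    also have "\<dots> = real ((N - Suc k) choose (a - Suc k))"
      using Suc.prems eq by (simp add: IH)
    finally show ?thesis using True by simp
  next
    case False
    have "bern_coeff N (Suc k) a = 0"
      using False by (intro bern_coeff_eq_0) auto
    then show ?thesis using False by simp
  qed
qed

lemma bern_coeff_bounds:
  assumes "k \<le> N" "a \<le> N"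
  shows "0 \<le> bern_coeff N k a" "bern_coeff N k a \<le> 1"
proof -
  have "0 \<le> bern_coeff N k a \<and> bern_coeff N k a \<le> 1"
  proof (cases "a < k")
    case True
    then have "bern_coeff N k a = 0"
      by (rule bern_coeff_eq_0)
    then show ?thesis by simp
  next
    case False
    then have "\<forall>t<k. 0 \<le> (real a - real t) / (real N - real t) \<and> (real a - real t) / (real N - real t) \<le> 1"
      using assms by (auto simp: divide_simps)
    then show ?thesis
      unfolding bern_coeff_def by (auto intro!: prod_nonneg prod_le_1)
  qed
  then show "0 \<le> bern_coeff N k a" "bern_coeff N k a \<le> 1" by auto
qed

text \<open>Uniform in \<open>a\<close>. Passing from \<open>k\<close> to \<open>k + 1\<close>,
  replacing the new factor \<open>u\<close> by \<open>y\<close> = a / N costs at most k / (N - k),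
  and the error made so far is multiplied by \<open>y\<close>, which is at most 1.\<close>

lemma bern_coeff_limit:
  assumes "\<epsilon> > 0"
  shows "\<exists>N0. \<forall>N\<ge>N0. \<forall>a\<le>N. \<bar>bern_coeff N k a - (real a / real N) ^ k\<bar> \<le> \<epsilon>"
  using assms
proof (induction k arbitrary: \<epsilon>)
  case 0
  then show ?case by (simp add: bern_coeff_def)
next
  case (Suc k)
  from Suc.IH[of "\<epsilon>/2"] Suc.prems obtain N0 where N0:
    "\<And>N a. N \<ge> N0 \<Longrightarrow> a \<le> N \<Longrightarrow> \<bar>bern_coeff N k a - (real a / real N) ^ k\<bar> \<le> \<epsilon>/2"
    by auto
  obtain N1 :: nat where N1: "real N1 \<ge> 2 * real k / \<epsilon>"
    using real_arch_simple by blast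
  show ?case
  proof (intro exI[of _ "max N0 (N1 + k + 1)"] allI impI)
    fix N a assume N: "N \<ge> max N0 (N1 + k + 1)" and a: "a \<le> N"
    define u where "u = (real a - real k) / (real N - real k)"
    define y where "y = real a / real N"
    have y: "0 \<le> y" "y \<le> 1" using a N by (auto simp: y_def divide_simps)
    have "\<bar>bern_coeff N k a\<bar> * \<bar>u - y\<bar> \<le> \<epsilon>/2"
    proof (cases "a < k")
      case True
      then have "bern_coeff N k a = 0"
        by (rule bern_coeff_eq_0)
      then show ?thesis using Suc.prems by simp
    next
      case False
      have pos: "real N - real k > 0" "real N > 0" using N by auto
      have "u - y = - (real k * (real N - real a) / ((real N - real k) * real N))"
        using pos by (simp add: u_def y_def field_simps)
      moreover have "0 \<le> real k * (real N - real a) / ((real N - real k) * real N)"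
        using pos a by auto
      ultimately have "\<bar>u - y\<bar> = real k * (real N - real a) / ((real N - real k) * real N)"
        by linarith
      also have "\<dots> = real k / (real N - real k) * ((real N - real a) / real N)"
        by simp
      also have "\<dots> \<le> real k / (real N - real k) * 1"
        using pos a by (intro mult_left_mono) (auto simp: divide_simps)
      also have "\<dots> \<le> \<epsilon> / 2"
      proof -
        have "2 * real k \<le> \<epsilon> * real N1"
          using N1 Suc.prems by (simp add: field_simps)
        also have "\<dots> \<le> \<epsilon> * (real N - real k)"
          using N Suc.prems by (intro mult_left_mono) auto
        finally show ?thesis using pos by (simp add: field_simps)
      qed
      finally have "\<bar>u - y\<bar> \<le> \<epsilon>/2" .
      moreover have "\<bar>bern_coeff N k a\<bar> \<le> 1"
        using bern_coeff_bounds[of k N a] N a by auto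
      ultimately have "\<bar>bern_coeff N k a\<bar> * \<bar>u - y\<bar> \<le> 1 * (\<epsilon>/2)"
        by (intro mult_mono) auto
      then show ?thesis by simp
    qed
    moreover have "\<bar>bern_coeff N k a - y ^ k\<bar> * y \<le> \<epsilon>/2 * 1"
      using N0[of N a] N a y Suc.prems by (intro mult_mono) (auto simp: y_def)
    moreover have "bern_coeff N (Suc k) a - y ^ Suc k =
        bern_coeff N k a * (u - y) + (bern_coeff N k a - y ^ k) * y"
      by (simp add: bern_coeff_def u_def algebra_simps)
    ultimately have "\<bar>bern_coeff N (Suc k) a - y ^ Suc k\<bar> \<le> \<epsilon>"
      using y abs_triangle_ineq[of "bern_coeff N k a * (u - y)" "(bern_coeff N k a - y ^ k) * y"]
      by (simp add: abs_mult)
    then show "\<bar>bern_coeff N (Suc k) a - (real a / real N) ^ Suc k\<bar> \<le> \<epsilon>"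
      by (simp add: y_def)
  qed
qed

text \<open>Insert (y + z)^(N - k) = 1 after \<open>y ^ k\<close> and expand by the binomial
  theorem.\<close>

lemma bern_expand_power:
  fixes y z :: "'a::comm_ring_1"
  assumes hom: "real_hom \<phi>" and yz: "y + z = 1" and k: "k \<le> N"
  shows "y ^ k = (\<Sum>a\<le>N. \<phi> (bern_coeff N k a) * (of_nat (N choose a) * y ^ a * z ^ (N - a)))"
proof -
  have m: "\<phi> (bern_coeff N k a) * of_nat (N choose a) =
      (if k \<le> a then of_nat ((N - k) choose (a - k)) else 0)" if "a \<le> N" for a
  proof -
    have "\<phi> (bern_coeff N k a) * of_nat (N choose a) = \<phi> (bern_coeff N k a * real (N choose a))"
      using hom by (simp add: real_hom_def real_hom_of_nat[OF hom, symmetric])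
    then show ?thesis
      using hom by (simp add: bern_coeff_binomial[OF k that] real_hom_of_nat) (simp add: real_hom_def)
  qed
  have "(\<Sum>a\<le>N. \<phi> (bern_coeff N k a) * (of_nat (N choose a) * y ^ a * z ^ (N - a))) =
      (\<Sum>a\<le>N. if k \<le> a then of_nat ((N - k) choose (a - k)) * y ^ a * z ^ (N - a) else 0)"
    by (intro sum.cong refl) (simp add: mult.assoc[symmetric] m)
  also have "\<dots> = (\<Sum>a\<in>{k..N}. of_nat ((N - k) choose (a - k)) * y ^ a * z ^ (N - a))"
    by (intro sum.mono_neutral_cong_right) auto
  also have "\<dots> = (\<Sum>b\<le>N - k. of_nat ((N - k) choose b) * y ^ (b + k) * z ^ (N - (b + k)))"
    by (rule sum.reindex_bij_witness[of _ "\<lambda>b. b + k" "\<lambda>a. a - k"]) (use k in auto)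
  also have "\<dots> = y ^ k * (\<Sum>b\<le>N - k. of_nat ((N - k) choose b) * y ^ b * z ^ (N - k - b))"
    by (simp add: sum_distrib_left power_add mult_ac add.commute)
  also have "(\<Sum>b\<le>N - k. of_nat ((N - k) choose b) * y ^ b * z ^ (N - k - b)) = (y + z) ^ (N - k)"
    by (rule binomial_ring[symmetric])
  finally show ?thesis using yz by simp
qed

lemma prod_sum_PiE:
  fixes f :: "'i \<Rightarrow> 'b \<Rightarrow> 'a::comm_semiring_1"
  assumes "finite I"
  shows "(\<Prod>i\<in>I. \<Sum>y\<in>B. f i y) = (\<Sum>g\<in>PiE I (\<lambda>_. B). \<Prod>i\<in>I. f i (g i))"
  using assms
proof (induction I rule: finite_induct)
  case (insert i I)
  have inj: "inj_on (\<lambda>(y, g). g(i := y)) (B \<times> PiE I (\<lambda>_. B))"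
    by (rule inj_combinator) (use insert in auto)
  have "(\<Sum>g\<in>PiE (insert i I) (\<lambda>_. B). \<Prod>j\<in>insert i I. f j (g j)) =
      (\<Sum>(y, g)\<in>B \<times> PiE I (\<lambda>_. B). \<Prod>j\<in>insert i I. f j ((g(i := y)) j))"
    unfolding PiE_insert_eq by (subst sum.reindex[OF inj]) (auto simp: case_prod_unfold)
  also have "\<dots> = (\<Sum>(y, g)\<in>B \<times> PiE I (\<lambda>_. B). f i y * (\<Prod>j\<in>I. f j (g j)))"
  proof (intro sum.cong refl, clarify)
    fix y and g
    have "(\<Prod>j\<in>I. f j ((g(i := y)) j)) = (\<Prod>j\<in>I. f j (g j))"
      using insert.hyps by (intro prod.cong) auto
    then show "(\<Prod>j\<in>insert i I. f j ((g(i := y)) j)) = f i y * (\<Prod>j\<in>I. f j (g j))"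
      using insert.hyps by simp
  qed
  also have "\<dots> = (\<Sum>y\<in>B. f i y) * (\<Sum>g\<in>PiE I (\<lambda>_. B). \<Prod>j\<in>I. f j (g j))"
    by (simp add: sum_product sum.cartesian_product)
  finally show ?case
    using insert by simp
qed simp

section \<open>The tensor product Bernstein basis on the box [-r, r]^d\<close>

definition ycoord :: "real \<Rightarrow> 'd \<Rightarrow> 'd mpoly" where
  "ycoord r i = Const (1 / (2 * r)) * (Const r + Var i)"

definition zcoord :: "real \<Rightarrow> 'd \<Rightarrow> 'd mpoly" where
  "zcoord r i = Const (1 / (2 * r)) * (Const r - Var i)"

text \<open>A product of one-variable Bernstein polynomials, each of degree \<open>N\<close>. The
  affine coordinates \<open>ycoord\<close> and \<open>zcoord\<close> map [-r, r] to [0, 1], have sum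
  1, and are positive multiples of the two box constraints; for this reason the basis lies in every
  preordering that contains these constraints.\<close>

definition bern_poly :: "real \<Rightarrow> nat \<Rightarrow> ('d::finite \<Rightarrow> nat) \<Rightarrow> 'd mpoly" where
  "bern_poly r N \<alpha> =
     (\<Prod>i\<in>UNIV. of_nat (N choose \<alpha> i) * ycoord r i ^ \<alpha> i * zcoord r i ^ (N - \<alpha> i))"

abbreviation bern_grid :: "nat \<Rightarrow> ('d::finite \<Rightarrow> nat) set" where
  "bern_grid N \<equiv> PiE UNIV (\<lambda>_. {..N})"

definition bern_node :: "real \<Rightarrow> nat \<Rightarrow> ('d \<Rightarrow> nat) \<Rightarrow> 'd \<Rightarrow> real" where
  "bern_node r N \<alpha> i = r * (2 * real (\<alpha> i) / real N - 1)"

definition bern_rep :: "real \<Rightarrow> real \<Rightarrow> 'd::finite mpoly \<Rightarrow> nat \<Rightarrow> (('d \<Rightarrow> nat) \<Rightarrow> real) \<Rightarrow> bool" where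
  "bern_rep r \<epsilon> f N c \<longleftrightarrow>
     f = (\<Sum>\<alpha>\<in>bern_grid N. Const (c \<alpha>) * bern_poly r N \<alpha>) \<and>
     (\<forall>\<alpha>\<in>bern_grid N. \<bar>c \<alpha> - eval_at (bern_node r N \<alpha>) f\<bar> \<le> \<epsilon>)"

text \<open>The Bernstein coefficients approach the values of \<open>f\<close> at the nodes,
  uniformly over the grid. The statement is for all large \<open>N\<close>, so that finitely many
  polynomials, such as the entries of a matrix, can be expanded in one common degree.\<close>

definition bern_approx :: "real \<Rightarrow> 'd::finite mpoly \<Rightarrow> bool" where
  "bern_approx r f \<longleftrightarrow> (\<forall>\<epsilon>>0. \<exists>N0. \<forall>N\<ge>N0. \<exists>c. bern_rep r \<epsilon> f N c)"

lemma ycoord_zcoord: "r > 0 \<Longrightarrow> ycoord r i + zcoord r i = 1"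
proof -
  assume r: "r > 0"
  have "ycoord r i + zcoord r i = Const (1 / (2 * r)) * (Const r + Const r)"
    by (simp add: ycoord_def zcoord_def algebra_simps)
  also have "\<dots> = Const (1 / (2 * r) * (r + r))"
    by (simp only: Const_mult Const_add)
  finally show ?thesis using r by simp
qed

lemma Var_ycoord: "r > 0 \<Longrightarrow> Var i = Const (2 * r) * ycoord r i - Const r"
proof -
  assume r: "r > 0"
  have "Const (2 * r) * ycoord r i = Const (2 * r * (1 / (2 * r))) * (Const r + Var i)"
    unfolding ycoord_def by (simp only: Const_mult mult.assoc)
  then show ?thesis using r by simp
qed

lemma eval_ycoord_node:
  "r > 0 \<Longrightarrow> eval_at (bern_node r N \<alpha>) (ycoord r i) = real (\<alpha> i) / real N"
  by (simp add: ycoord_def bern_node_def field_simps)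

lemma bern_approx_add:
  assumes "bern_approx r f" "bern_approx r g"
  shows "bern_approx r (f + g)"
  unfolding bern_approx_def
proof (intro allI impI)
  fix \<epsilon> :: real assume "\<epsilon> > 0"
  then have e: "\<epsilon> / 2 > 0" by simp
  obtain N1 where N1: "\<And>N. N \<ge> N1 \<Longrightarrow> \<exists>c. bern_rep r (\<epsilon> / 2) f N c"
    using assms(1) e unfolding bern_approx_def by meson
  obtain N2 where N2: "\<And>N. N \<ge> N2 \<Longrightarrow> \<exists>c. bern_rep r (\<epsilon> / 2) g N c"
    using assms(2) e unfolding bern_approx_def by meson
  show "\<exists>N0. \<forall>N\<ge>N0. \<exists>c. bern_rep r \<epsilon> (f + g) N c"
  proof (intro exI[of _ "max N1 N2"] allI impI)
    fix N assume N: "N \<ge> max N1 N2"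
    obtain c where c: "f = (\<Sum>\<alpha>\<in>bern_grid N. Const (c \<alpha>) * bern_poly r N \<alpha>)"
      "\<And>\<alpha>. \<alpha> \<in> bern_grid N \<Longrightarrow> \<bar>c \<alpha> - eval_at (bern_node r N \<alpha>) f\<bar> \<le> \<epsilon> / 2"
      using N1[of N] N by (auto simp: bern_rep_def)
    obtain e where e: "g = (\<Sum>\<alpha>\<in>bern_grid N. Const (e \<alpha>) * bern_poly r N \<alpha>)"
      "\<And>\<alpha>. \<alpha> \<in> bern_grid N \<Longrightarrow> \<bar>e \<alpha> - eval_at (bern_node r N \<alpha>) g\<bar> \<le> \<epsilon> / 2"
      using N2[of N] N by (auto simp: bern_rep_def)
    have "f + g = (\<Sum>\<alpha>\<in>bern_grid N. Const (c \<alpha> + e \<alpha>) * bern_poly r N \<alpha>)"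
      by (subst c(1), subst e(1)) (simp add: Const_add distrib_right sum.distrib)
    moreover have "\<bar>c \<alpha> + e \<alpha> - eval_at (bern_node r N \<alpha>) (f + g)\<bar> \<le> \<epsilon>"
      if "\<alpha> \<in> bern_grid N" for \<alpha>
      using c(2)[OF that] e(2)[OF that] unfolding eval_add by linarith
    ultimately show "\<exists>c. bern_rep r \<epsilon> (f + g) N c"
      unfolding bern_rep_def by (intro exI[of _ "\<lambda>\<alpha>. c \<alpha> + e \<alpha>"]) blast
  qed
qed

lemma bern_approx_scale:
  assumes "bern_approx r f"
  shows "bern_approx r (Const s * f)"
  unfolding bern_approx_def
proof (intro allI impI)
  fix \<epsilon> :: real assume "\<epsilon> > 0"
  \<comment> \<open>The summand 1 covers the case \<open>s = 0\<close>.\<close>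
  then have e: "\<epsilon> / (\<bar>s\<bar> + 1) > 0" by (simp add: add_nonneg_pos)
  obtain N1 where N1: "\<And>N. N \<ge> N1 \<Longrightarrow> \<exists>c. bern_rep r (\<epsilon> / (\<bar>s\<bar> + 1)) f N c"
    using assms(1) e unfolding bern_approx_def by meson
  show "\<exists>N0. \<forall>N\<ge>N0. \<exists>c. bern_rep r \<epsilon> (Const s * f) N c"
  proof (intro exI[of _ N1] allI impI)
    fix N assume N: "N \<ge> N1"
    obtain c where c: "f = (\<Sum>\<alpha>\<in>bern_grid N. Const (c \<alpha>) * bern_poly r N \<alpha>)"
      "\<And>\<alpha>. \<alpha> \<in> bern_grid N \<Longrightarrow> \<bar>c \<alpha> - eval_at (bern_node r N \<alpha>) f\<bar> \<le> \<epsilon> / (\<bar>s\<bar> + 1)"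
      using N1[of N] N by (auto simp: bern_rep_def)
    have "Const s * f = (\<Sum>\<alpha>\<in>bern_grid N. Const (s * c \<alpha>) * bern_poly r N \<alpha>)"
      by (subst c(1)) (simp add: Const_mult sum_distrib_left mult.assoc)
    moreover have "\<bar>s * c \<alpha> - eval_at (bern_node r N \<alpha>) (Const s * f)\<bar> \<le> \<epsilon>"
      if "\<alpha> \<in> bern_grid N" for \<alpha>
    proof -
      have "\<bar>s * c \<alpha> - eval_at (bern_node r N \<alpha>) (Const s * f)\<bar> =
          \<bar>s\<bar> * \<bar>c \<alpha> - eval_at (bern_node r N \<alpha>) f\<bar>"
        by (simp add: abs_mult[symmetric] right_diff_distrib)
      also have "\<dots> \<le> (\<bar>s\<bar> + 1) * (\<epsilon> / (\<bar>s\<bar> + 1))"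
        using c(2)[OF that] by (intro mult_mono) auto
      also have "\<dots> = \<epsilon>" by (simp add: add_nonneg_eq_0_iff)
      finally show ?thesis .
    qed
    ultimately show "\<exists>c. bern_rep r \<epsilon> (Const s * f) N c"
      unfolding bern_rep_def by (intro exI[of _ "\<lambda>\<alpha>. s * c \<alpha>"]) blast
  qed
qed

text \<open>The expansion is the tensor product of the one-variable expansions. All coefficients and
  their limits lie in [0, 1], so the error of a product is at most the sum of the errors of its
  factors; hence the share \<open>\<epsilon> / D\<close> for each variable.\<close>

lemma bern_approx_monomial:
  fixes k :: "'d::finite \<Rightarrow> nat"
  assumes r: "r > 0"
  shows "bern_approx r (\<Prod>i\<in>UNIV. ycoord r i ^ k i)"
  unfolding bern_approx_def
proof (intro allI impI)
  fix \<epsilon> :: real assume e: "\<epsilon> > 0"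
  define D where "D = real (CARD('d))"
  have D: "D > 0" by (simp add: D_def)
  have "\<forall>i. \<exists>N0. \<forall>N\<ge>N0. \<forall>a\<le>N. \<bar>bern_coeff N (k i) a - (real a / real N) ^ k i\<bar> \<le> \<epsilon> / D"
    using e D by (intro allI bern_coeff_limit) auto
  then obtain N0 where N0: "\<And>i N a. N \<ge> N0 i \<Longrightarrow> a \<le> N \<Longrightarrow>
      \<bar>bern_coeff N (k i) a - (real a / real N) ^ k i\<bar> \<le> \<epsilon> / D"
    by metis
  show "\<exists>N0. \<forall>N\<ge>N0. \<exists>c. bern_rep r \<epsilon> (\<Prod>i\<in>UNIV. ycoord r i ^ k i) N c"
  proof (intro exI[of _ "(\<Sum>i\<in>UNIV. N0 i + k i)"] allI impI)
    fix N assume N: "N \<ge> (\<Sum>i\<in>UNIV. N0 i + k i)"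
    have N': "N0 i + k i \<le> N" for i
      using N member_le_sum[of i UNIV "\<lambda>i. N0 i + k i"] by simp
    let ?c = "\<lambda>\<alpha>. \<Prod>i\<in>UNIV. bern_coeff N (k i) (\<alpha> i)"
    have "(\<Prod>i\<in>UNIV. ycoord r i ^ k i) = (\<Prod>i\<in>UNIV. \<Sum>a\<le>N. Const (bern_coeff N (k i) a) *
        (of_nat (N choose a) * ycoord r i ^ a * zcoord r i ^ (N - a)))"
      using N' by (intro prod.cong refl bern_expand_power real_hom_Const ycoord_zcoord r)
        (metis add_leD2)
    also have "\<dots> = (\<Sum>\<alpha>\<in>bern_grid N. \<Prod>i\<in>UNIV. Const (bern_coeff N (k i) (\<alpha> i)) *
        (of_nat (N choose \<alpha> i) * ycoord r i ^ \<alpha> i * zcoord r i ^ (N - \<alpha> i)))"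
      by (rule prod_sum_PiE) simp
    also have "\<dots> = (\<Sum>\<alpha>\<in>bern_grid N. Const (?c \<alpha>) * bern_poly r N \<alpha>)"
      by (simp add: prod.distrib Const_prod bern_poly_def)
    finally have eq: "(\<Prod>i\<in>UNIV. ycoord r i ^ k i) =
        (\<Sum>\<alpha>\<in>bern_grid N. Const (?c \<alpha>) * bern_poly r N \<alpha>)" .
    moreover have "\<bar>?c \<alpha> - eval_at (bern_node r N \<alpha>) (\<Prod>i\<in>UNIV. ycoord r i ^ k i)\<bar> \<le> \<epsilon>"
      if \<alpha>: "\<alpha> \<in> bern_grid N" for \<alpha>
    proof -
      have aN: "\<alpha> i \<le> N" for i
        using \<alpha> by (auto simp: PiE_iff)
      have "norm (?c \<alpha> - (\<Prod>i\<in>UNIV. (real (\<alpha> i) / real N) ^ k i)) \<le>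
          (\<Sum>i\<in>UNIV. norm (bern_coeff N (k i) (\<alpha> i) - (real (\<alpha> i) / real N) ^ k i))"
      proof (rule norm_prod_diff)
        fix i
        show "norm (bern_coeff N (k i) (\<alpha> i)) \<le> 1"
          using bern_coeff_bounds[of "k i" N "\<alpha> i"] N'[of i] aN[of i] by auto
        show "norm ((real (\<alpha> i) / real N) ^ k i) \<le> 1"
          using aN[of i] by (auto simp: power_abs intro!: power_le_one divide_le_eq_1[THEN iffD2])
      qed
      also have "\<dots> \<le> (\<Sum>i\<in>(UNIV :: 'd set). \<epsilon> / D)"
        using N0 N' aN by (intro sum_mono) (metis add_leD1 real_norm_def)
      also have "\<dots> = \<epsilon>"
        using D by (simp add: D_def)
      finally show ?thesis
        by (simp add: eval_ycoord_node[OF r])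
    qed
    ultimately show "\<exists>c. bern_rep r \<epsilon> (\<Prod>i\<in>UNIV. ycoord r i ^ k i) N c"
      unfolding bern_rep_def by (intro exI[of _ ?c]) blast
  qed
qed

text \<open>The coefficients of a product are not visible from those of its factors. The induction
  therefore shows that multiplication by \<open>f\<close> preserves a property of \<open>h\<close>,
  namely that \<open>h\<close> times every monomial \<open>Y k\<close> is approximable; such a
  statement composes, and it is applied to \<open>h = 1\<close>.\<close>

lemma bern_approx_all:
  fixes f :: "'d::finite mpoly"
  assumes r: "r > 0"
  shows "bern_approx r f"
proof -
  define Y where "Y = (\<lambda>k::'d \<Rightarrow> nat. \<Prod>i\<in>UNIV. ycoord r i ^ k i)"
  have Y_Suc: "ycoord r v * Y k = Y (k(v := Suc (k v)))" for v k
  proof -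
    have "Y (k(v := Suc (k v))) = (\<Prod>i\<in>UNIV. (if i = v then ycoord r v else 1) * ycoord r i ^ k i)"
      unfolding Y_def by (intro prod.cong) auto
    also have "\<dots> = ycoord r v * Y k"
      by (simp add: prod.distrib Y_def)
    finally show ?thesis by simp
  qed
  have "\<forall>h. (\<forall>k. bern_approx r (h * Y k)) \<longrightarrow> (\<forall>k. bern_approx r (f * h * Y k))"
  proof (induction f rule: mpoly_ring_induct)
    case (Const c)
    then show ?case
      by (auto simp: mult.assoc intro!: bern_approx_scale)
  next
    case (Var v)
    show ?case
    proof (intro allI impI)
      fix h k assume h: "\<forall>k. bern_approx r (h * Y k)"
      have "Var v * h * Y k = Const (2 * r) * (h * Y (k(v := Suc (k v)))) + Const (- r) * (h * Y k)"
        unfolding Y_Suc[symmetric] Var_ycoord[OF r, of v] single_uminus by (simp add: algebra_simps)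
      then show "bern_approx r (Var v * h * Y k)"
        using h by (auto intro!: bern_approx_add bern_approx_scale)
    qed
  next
    case (add f g)
    then show ?case
      by (auto simp: distrib_right intro!: bern_approx_add)
  next
    case (mult f g)
    show ?case
    proof (intro allI impI)
      fix h k assume "\<forall>k. bern_approx r (h * Y k)"
      then have "\<forall>k. bern_approx r (g * h * Y k)" using mult(2) by blast
      then have "bern_approx r (f * (g * h) * Y k)" using mult(1) by blast
      then show "bern_approx r (f * g * h * Y k)" by (simp only: mult.assoc)
    qed
  qed
  moreover have "\<forall>k. bern_approx r (1 * Y k)"
    unfolding Y_def mult_1_left by (intro allI bern_approx_monomial r)
  ultimately have "bern_approx r (f * 1 * Y (\<lambda>_. 0))"
    by blast
  then show ?thesis by (simp add: Y_def)
qed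

section \<open>Positive definite matrices over the box and preorderings\<close>

lemma preordering_add: "preordering T \<Longrightarrow> a \<in> T \<Longrightarrow> b \<in> T \<Longrightarrow> a + b \<in> T"
  and preordering_mult: "preordering T \<Longrightarrow> a \<in> T \<Longrightarrow> b \<in> T \<Longrightarrow> a * b \<in> T"
  and preordering_square: "preordering T \<Longrightarrow> a^2 \<in> T"
  by (auto simp: preordering_def)

lemma preordering_0: "preordering T \<Longrightarrow> 0 \<in> T"
  using preordering_square[of T 0] by simp

lemma preordering_1: "preordering T \<Longrightarrow> 1 \<in> T"
  using preordering_square[of T 1] by simp

lemma preordering_Const: "preordering T \<Longrightarrow> c \<ge> 0 \<Longrightarrow> Const c \<in> T"
  using preordering_square[of T "Const (sqrt c)"] by (simp add: Const_power[symmetric] del: real_sqrt_power)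

lemma preordering_sum:
  "preordering T \<Longrightarrow> (\<And>i. i \<in> S \<Longrightarrow> f i \<in> T) \<Longrightarrow> (\<Sum>i\<in>S. f i) \<in> T"
  by (induction S rule: infinite_finite_induct) (auto intro: preordering_add preordering_0)

lemma preordering_prod:
  "preordering T \<Longrightarrow> (\<And>i. i \<in> S \<Longrightarrow> f i \<in> T) \<Longrightarrow> (\<Prod>i\<in>S. f i) \<in> T"
  by (induction S rule: infinite_finite_induct) (auto intro: preordering_mult preordering_1)

lemma preordering_power: "preordering T \<Longrightarrow> a \<in> T \<Longrightarrow> a ^ n \<in> T"
  by (induction n) (auto intro: preordering_mult preordering_1)

lemma preordering_of_nat: "preordering T \<Longrightarrow> of_nat n \<in> T"
  by (induction n) (auto intro: preordering_add preordering_0 preordering_1)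

lemma bern_poly_in_preordering:
  assumes T: "preordering T" and r: "r > 0"
    and box: "\<And>i. Const r + Var i \<in> T" "\<And>i. Const r - Var i \<in> T"
  shows "bern_poly r N \<alpha> \<in> T"
  unfolding bern_poly_def ycoord_def zcoord_def using r
  by (intro preordering_prod preordering_mult preordering_power preordering_of_nat
      preordering_Const T box) auto

text \<open>In the Bernstein basis \<open>C\<close> has real matrices as coefficients. In large
  degree each of them is close to the value of \<open>C\<close> at a node in the box and so is
  positive definite; applied to \<open>v\<close> it gives a sum of squares, which is multiplied by a
  basis polynomial from \<open>T\<close>.\<close>

lemma pd_matrix_in_preordering:
  fixes C :: "'d::finite \<Rightarrow> 'd \<Rightarrow> 'd mpoly" and v :: "'d \<Rightarrow> 'd mpoly"
  assumes T: "preordering T" and r: "r > 0"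
    and box: "\<And>i. Const r + Var i \<in> T" "\<And>i. Const r - Var i \<in> T"
    and \<delta>: "\<delta> > 0"
    and pd: "\<And>x w. (\<forall>i. \<bar>x i\<bar> \<le> r) \<Longrightarrow>
      (\<Sum>i\<in>UNIV. \<Sum>j\<in>UNIV. eval_at x (C i j) * w i * w j) \<ge> \<delta> * (\<Sum>i\<in>UNIV. (w i)^2)"
  shows "(\<Sum>i\<in>UNIV. \<Sum>j\<in>UNIV. C i j * v i * v j) \<in> T"
proof -
  define D where "D = real (CARD('d))"
  have D: "D > 0" by (simp add: D_def)
  \<comment> \<open>There are \<open>D^2\<close> entries, each off by at most \<open>e\<close>, and
    the products of two components of \<open>w\<close> are bounded by the squared length
    \<open>W\<close>; the form thus loses at most half of \<open>\<delta> * W\<close>.\<close>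
  define e where "e = \<delta> / (2 * D^2)"
  have e: "e > 0" using \<delta> D by (simp add: e_def)
  have "\<exists>N0. \<forall>N\<ge>N0. \<exists>c. bern_rep r e (C i j) N c" for i j
    using bern_approx_all[OF r, of "C i j"] e unfolding bern_approx_def by blast
  then obtain N0 where N0: "\<And>i j N. N \<ge> N0 i j \<Longrightarrow> \<exists>c. bern_rep r e (C i j) N c"
    by metis
  define N where "N = (\<Sum>i\<in>UNIV. \<Sum>j\<in>UNIV. N0 i j)"
  have "N0 i j \<le> N" for i j
  proof -
    have "N0 i j \<le> (\<Sum>j\<in>UNIV. N0 i j)" by (rule member_le_sum) auto
    also have "\<dots> \<le> N" unfolding N_def by (rule member_le_sum) auto
    finally show ?thesis .
  qed
  then have "\<exists>c. bern_rep r e (C i j) N c" for i j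
    using N0 by blast
  then obtain c where "\<And>i j. bern_rep r e (C i j) N (c i j)"
    by metis
  then have c1: "\<And>i j. C i j = (\<Sum>\<alpha>\<in>bern_grid N. Const (c i j \<alpha>) * bern_poly r N \<alpha>)"
    and c2: "\<And>i j \<alpha>. \<alpha> \<in> bern_grid N \<Longrightarrow> \<bar>c i j \<alpha> - eval_at (bern_node r N \<alpha>) (C i j)\<bar> \<le> e"
    unfolding bern_rep_def by blast+
  have pos: "(\<Sum>i\<in>UNIV. \<Sum>j\<in>UNIV. c i j \<alpha> * w i * w j) > 0"
    if \<alpha>: "\<alpha> \<in> bern_grid N" and w: "\<exists>i\<in>UNIV. w i \<noteq> 0" for \<alpha> and w :: "'d \<Rightarrow> real"
  proof -
    define W where "W = (\<Sum>i\<in>UNIV. (w i)^2)"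
    have W: "W > 0"
      using w unfolding W_def by (auto intro: sum_pos2)
    let ?x = "bern_node r N \<alpha>"
    have x: "\<forall>i. \<bar>?x i\<bar> \<le> r"
    proof
      fix i
      have "\<alpha> i \<le> N" using \<alpha> by (auto simp: PiE_iff)
      \<comment> \<open>This includes \<open>N = 0\<close>: the quotient is then 0 by convention and
        the node is a corner of the box.\<close>
      then have "0 \<le> real (\<alpha> i) / real N" "real (\<alpha> i) / real N \<le> 1"
        by (auto intro: divide_le_eq_1[THEN iffD2])
      then have "\<bar>2 * (real (\<alpha> i) / real N) - 1\<bar> \<le> 1" by (simp add: abs_le_iff)
      then have "r * \<bar>2 * (real (\<alpha> i) / real N) - 1\<bar> \<le> r * 1"
        using r by (intro mult_left_mono) auto
      then show "\<bar>?x i\<bar> \<le> r"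
        using r by (simp add: bern_node_def abs_mult)
    qed
    have ww: "\<bar>w i * w j\<bar> \<le> W" for i j
    proof -
      have sq: "(w i)^2 \<le> W" for i
        unfolding W_def by (rule member_le_sum) auto
      have "\<bar>w i * w j\<bar> \<le> ((w i)^2 + (w j)^2) / 2"
        using sum_squares_bound[of "\<bar>w i\<bar>" "\<bar>w j\<bar>"] by (simp add: abs_mult)
      also have "\<dots> \<le> (W + W) / 2"
        by (intro divide_right_mono add_mono sq) auto
      finally show ?thesis by simp
    qed
    have "(\<Sum>i\<in>UNIV. \<Sum>j\<in>UNIV. eval_at ?x (C i j) * w i * w j) -
        (\<Sum>i\<in>UNIV. \<Sum>j\<in>UNIV. c i j \<alpha> * w i * w j) \<le> (\<Sum>i\<in>(UNIV::'d set). \<Sum>j\<in>(UNIV::'d set). e * W)"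
      unfolding sum_subtractf[symmetric]
    proof (intro sum_mono)
      fix i j
      have "eval_at ?x (C i j) * w i * w j - c i j \<alpha> * w i * w j =
          (eval_at ?x (C i j) - c i j \<alpha>) * (w i * w j)" by (simp add: algebra_simps)
      also have "\<dots> \<le> \<bar>eval_at ?x (C i j) - c i j \<alpha>\<bar> * \<bar>w i * w j\<bar>"
        by (metis abs_ge_self abs_mult)
      also have "\<dots> \<le> e * W"
        using c2[OF \<alpha>, of i j] ww[of i j] e by (intro mult_mono) auto
      finally show "eval_at ?x (C i j) * w i * w j - c i j \<alpha> * w i * w j \<le> e * W" .
    qed
    also have "\<dots> = \<delta> / 2 * W"
      using D by (simp add: e_def D_def[symmetric] power2_eq_square)
    finally have "(\<Sum>i\<in>UNIV. \<Sum>j\<in>UNIV. c i j \<alpha> * w i * w j) \<ge> \<delta> * W - \<delta> / 2 * W"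
      using pd[OF x, of w] unfolding W_def by linarith
    moreover have "\<delta> * W - \<delta> / 2 * W = \<delta> / 2 * W" by (simp add: field_simps)
    moreover have "\<delta> / 2 * W > 0" using \<delta> W by simp
    ultimately show ?thesis by linarith
  qed
  have "(\<Sum>i\<in>UNIV. \<Sum>j\<in>UNIV. C i j * v i * v j) =
      (\<Sum>i\<in>UNIV. \<Sum>j\<in>UNIV. \<Sum>\<alpha>\<in>bern_grid N. bern_poly r N \<alpha> * (Const (c i j \<alpha>) * v i * v j))"
  proof (intro sum.cong refl)
    fix i j
    have "C i j * v i * v j = (\<Sum>\<alpha>\<in>bern_grid N. Const (c i j \<alpha>) * bern_poly r N \<alpha>) * (v i * v j)"
      by (simp only: c1 mult.assoc)
    then show "C i j * v i * v j = (\<Sum>\<alpha>\<in>bern_grid N. bern_poly r N \<alpha> * (Const (c i j \<alpha>) * v i * v j))"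
      by (simp only: sum_distrib_right sum_distrib_left mult_ac)
  qed
  also have "\<dots> = (\<Sum>i\<in>UNIV. \<Sum>\<alpha>\<in>bern_grid N. \<Sum>j\<in>UNIV. bern_poly r N \<alpha> * (Const (c i j \<alpha>) * v i * v j))"
    by (intro sum.cong refl sum.swap)
  also have "\<dots> = (\<Sum>\<alpha>\<in>bern_grid N. \<Sum>i\<in>UNIV. \<Sum>j\<in>UNIV. bern_poly r N \<alpha> * (Const (c i j \<alpha>) * v i * v j))"
    by (rule sum.swap)
  also have "\<dots> = (\<Sum>\<alpha>\<in>bern_grid N. bern_poly r N \<alpha> * (\<Sum>i\<in>UNIV. \<Sum>j\<in>UNIV. Const (c i j \<alpha>) * v i * v j))"
    by (simp add: sum_distrib_left)
  also have "\<dots> \<in> T"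
  proof (rule preordering_sum[OF T])
    fix \<alpha> :: "'d \<Rightarrow> nat" assume \<alpha>: "\<alpha> \<in> bern_grid N"
    have "(\<Sum>i\<in>UNIV. \<Sum>j\<in>UNIV. Const (c i j \<alpha>) * v i * v j) \<in> T"
      using T pos[OF \<alpha>]
      by (intro pd_form_in_cone) (auto intro: preordering_0 preordering_add preordering_square)
    then show "bern_poly r N \<alpha> * (\<Sum>i\<in>UNIV. \<Sum>j\<in>UNIV. Const (c i j \<alpha>) * v i * v j) \<in> T"
      by (intro preordering_mult T bern_poly_in_preordering r box)
  qed
  finally show ?thesis .
qed

section \<open>Coordinates adapted to a finite set of points\<close>

definition upoly :: "real poly \<Rightarrow> 'v mpoly \<Rightarrow> 'v mpoly" where
  "upoly a l = poly (map_poly Const a) l"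

lemma upoly_0 [simp]: "upoly 0 l = 0"
  by (simp add: upoly_def)

lemma upoly_pCons [simp]: "upoly (pCons c a) l = Const c + l * upoly a l"
  by (simp add: upoly_def map_poly_pCons)

lemma upoly_add: "upoly (a + b) l = upoly a l + upoly b l"
proof (induction a b rule: poly_induct2)
  case (pCons c a d b)
  then show ?case by (simp add: Const_add algebra_simps)
qed simp

lemma upoly_smult: "upoly (Polynomial.smult c a) l = Const c * upoly a l"
  by (induction a) (auto simp: Const_mult algebra_simps)

lemma upoly_mult: "upoly (a * b) l = upoly a l * upoly b l"
  by (induction a) (auto simp: upoly_add upoly_smult algebra_simps)

lemma eval_upoly [simp]: "eval_at x (upoly a l) = poly a (eval_at x l)"
  by (induction a) auto

text \<open>For finite \<open>S\<close> this is the square of the ideal generated by the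
  \<open>V i\<close>, with the coefficient matrix kept explicit because it becomes the matrix
  \<open>C\<close>.\<close>

definition square_span :: "'i set \<Rightarrow> ('i \<Rightarrow> 'a::comm_ring_1) \<Rightarrow> 'a set" where
  "square_span S V = {\<Sum>i\<in>S. \<Sum>j\<in>S. H i j * V i * V j | H. True}"

lemma square_spanI: "(\<Sum>i\<in>S. \<Sum>j\<in>S. H i j * V i * V j) \<in> square_span S V"
  by (auto simp: square_span_def)

lemma square_span_0: "0 \<in> square_span S V"
  using square_spanI[where H = "\<lambda>_ _. 0"] by simp

lemma square_span_add:
  assumes "f \<in> square_span S V" "g \<in> square_span S V"
  shows "f + g \<in> square_span S V"
proof -
  obtain H K where "f = (\<Sum>i\<in>S. \<Sum>j\<in>S. H i j * V i * V j)" "g = (\<Sum>i\<in>S. \<Sum>j\<in>S. K i j * V i * V j)"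
    using assms by (auto simp: square_span_def)
  then have "f + g = (\<Sum>i\<in>S. \<Sum>j\<in>S. (H i j + K i j) * V i * V j)"
    by (simp add: sum.distrib algebra_simps)
  then show ?thesis by (auto intro: square_spanI[where H = "\<lambda>i j. H i j + K i j"])
qed

lemma square_span_mult:
  assumes "f \<in> square_span S V"
  shows "g * f \<in> square_span S V"
proof -
  obtain H where "f = (\<Sum>i\<in>S. \<Sum>j\<in>S. H i j * V i * V j)"
    using assms by (auto simp: square_span_def)
  then have "g * f = (\<Sum>i\<in>S. \<Sum>j\<in>S. (g * H i j) * V i * V j)"
    by (simp add: sum_distrib_left mult.assoc)
  then show ?thesis by (auto intro: square_spanI[where H = "\<lambda>i j. g * H i j"])
qed

lemma square_span_linear_product:
  "(\<Sum>i\<in>S. b i * V i) * (\<Sum>j\<in>S. c j * V j) \<in> square_span S V"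
proof -
  have "(\<Sum>i\<in>S. b i * V i) * (\<Sum>j\<in>S. c j * V j) = (\<Sum>i\<in>S. \<Sum>j\<in>S. (b i * c j) * V i * V j)"
    by (simp add: sum_product mult_ac)
  then show ?thesis by (auto intro: square_spanI[where H = "\<lambda>i j. b i * c j"])
qed

text \<open>A Taylor expansion of first order along the curve on which all \<open>V i\<close> with
  \<open>i\<close> in \<open>S\<close> vanish, the curve being parametrized by the value of
  \<open>l\<close>. The coefficients up to order 1 depend on \<open>l\<close> alone, so divisibility
  in one variable applies to them.\<close>

definition first_order_form :: "'v mpoly \<Rightarrow> 'i set \<Rightarrow> ('i \<Rightarrow> 'v mpoly) \<Rightarrow> 'v mpoly \<Rightarrow> bool" where
  "first_order_form l S V f \<longleftrightarrow>
     (\<exists>a b. f - (upoly a l + (\<Sum>i\<in>S. upoly (b i) l * V i)) \<in> square_span S V)"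

lemma first_order_form_upoly: "first_order_form l S V (upoly a l)"
  unfolding first_order_form_def by (intro exI[of _ a] exI[of _ "\<lambda>_. 0"]) (simp add: square_span_0)

lemma first_order_form_add:
  assumes "first_order_form l S V f" "first_order_form l S V g"
  shows "first_order_form l S V (f + g)"
proof -
  obtain a b a' b' where
    *: "f - (upoly a l + (\<Sum>i\<in>S. upoly (b i) l * V i)) \<in> square_span S V"
    "g - (upoly a' l + (\<Sum>i\<in>S. upoly (b' i) l * V i)) \<in> square_span S V"
    using assms by (auto simp: first_order_form_def)
  have "f + g - (upoly (a + a') l + (\<Sum>i\<in>S. upoly (b i + b' i) l * V i)) \<in> square_span S V"
    using square_span_add[OF *] by (simp add: upoly_add sum.distrib algebra_simps)
  then show ?thesis
    unfolding first_order_form_def by (intro exI[of _ "a + a'"] exI[of _ "\<lambda>i. b i + b' i"])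
qed

text \<open>With affine parts A + B and A' + B', the product has affine part A A' + (A B' + A' B).
  The term B B' is quadratic in the \<open>V i\<close>, and the old remainders are multiplied by
  polynomials, which the square of an ideal permits.\<close>

lemma first_order_form_mult:
  assumes "first_order_form l S V f" "first_order_form l S V g"
  shows "first_order_form l S V (f * g)"
proof -
  obtain a b a' b' where
    *: "f - (upoly a l + (\<Sum>i\<in>S. upoly (b i) l * V i)) \<in> square_span S V"
    "g - (upoly a' l + (\<Sum>i\<in>S. upoly (b' i) l * V i)) \<in> square_span S V"
    using assms by (auto simp: first_order_form_def)
  define A B A' B' where "A = upoly a l" and "B = (\<Sum>i\<in>S. upoly (b i) l * V i)"
    and "A' = upoly a' l" and "B' = (\<Sum>i\<in>S. upoly (b' i) l * V i)"
  have "(\<Sum>i\<in>S. upoly (a * b' i + a' * b i) l * V i) = A * B' + A' * B"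
    by (simp add: A_def B_def A'_def B'_def upoly_add upoly_mult sum.distrib sum_distrib_left
        algebra_simps)
  then have "f * g - (upoly (a * a') l + (\<Sum>i\<in>S. upoly (a * b' i + a' * b i) l * V i)) =
      B * B' + (g * (f - (A + B)) + (A + B) * (g - (A' + B')))"
    by (simp add: A_def A'_def upoly_mult) (simp add: algebra_simps)
  moreover have "B * B' \<in> square_span S V"
    unfolding B_def B'_def by (rule square_span_linear_product)
  moreover have "g * (f - (A + B)) \<in> square_span S V" "(A + B) * (g - (A' + B')) \<in> square_span S V"
    using * by (simp_all add: square_span_mult A_def B_def A'_def B'_def)
  ultimately have "f * g - (upoly (a * a') l + (\<Sum>i\<in>S. upoly (a * b' i + a' * b i) l * V i))
      \<in> square_span S V"
    by (simp add: square_span_add)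
  then show ?thesis
    unfolding first_order_form_def by (intro exI[of _ "a * a'"] exI[of _ "\<lambda>i. a * b' i + a' * b i"])
qed

lemma first_order_form_Const: "first_order_form l S V (Const c)"
  using first_order_form_upoly[of l S V "[:c:]"] by simp

lemma first_order_form_self: "first_order_form l S V l"
  using first_order_form_upoly[of l S V "[:0, 1:]"] by simp

lemma first_order_form_gen:
  assumes "finite S" "k \<in> S"
  shows "first_order_form l S V (V k)"
proof -
  have "(\<Sum>i\<in>S. upoly (if i = k then 1 else 0) l * V i) = V k"
    using assms by (simp add: if_distrib[of "\<lambda>a. upoly a l * _"] sum.delta one_pCons cong: if_cong)
  then show ?thesis
    unfolding first_order_form_def
    by (intro exI[of _ 0] exI[of _ "\<lambda>i. if i = k then 1 else 0"]) (simp add: square_span_0)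
qed

lemma first_order_form_sum:
  "(\<And>i. i \<in> I \<Longrightarrow> first_order_form l S V (f i)) \<Longrightarrow> first_order_form l S V (\<Sum>i\<in>I. f i)"
  by (induction I rule: infinite_finite_induct)
    (use first_order_form_Const[of l S V 0] in \<open>auto intro: first_order_form_add\<close>)

section \<open>Univariate tools and a linear form that separates finitely many points\<close>

lemma coprime_linear:
  fixes a b :: real
  assumes "a \<noteq> b"
  shows "coprime [:- a, 1:] [:- b, 1:]"
proof (rule coprimeI)
  fix d assume "d dvd [:- a, 1:]" "d dvd [:- b, 1:]"
  then have "d dvd [:- a, 1:] - [:- b, 1:]" by (rule dvd_diff)
  then have "d dvd [:b - a:]" by simp
  moreover have "is_unit [:b - a:]"
    using assms by (simp add: is_unit_const_poly_iff dvd_field_iff)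
  ultimately show "is_unit d" by (rule dvd_trans)
qed

lemma prod_linear_power_dvd:
  fixes s :: "'i \<Rightarrow> real"
  assumes "finite P" "inj_on s P" "\<And>p. p \<in> P \<Longrightarrow> [:- s p, 1:] ^ n dvd a"
  shows "(\<Prod>p\<in>P. [:- s p, 1:]) ^ n dvd a"
  using assms
proof (induction P rule: finite_induct)
  case (insert p P)
  have "coprime [:- s p, 1:] (\<Prod>p\<in>P. [:- s p, 1:])"
  proof (rule prod_coprime_right)
    fix p' assume "p' \<in> P"
    then have "s p \<noteq> s p'"
      using insert by (auto simp: inj_on_def)
    then show "coprime [:- s p, 1:] [:- s p', 1:]" by (rule coprime_linear)
  qed
  then have "coprime ([:- s p, 1:] ^ n) ((\<Prod>p\<in>P. [:- s p, 1:]) ^ n)"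
    by (simp add: coprime_power_left_iff coprime_power_right_iff)
  moreover have "(\<Prod>p\<in>P. [:- s p, 1:]) ^ n dvd a"
    using insert by (auto simp: inj_on_def)
  moreover have "[:- s p, 1:] ^ n dvd a"
    using insert by blast
  ultimately have "[:- s p, 1:] ^ n * (\<Prod>p\<in>P. [:- s p, 1:]) ^ n dvd a"
    by (intro divides_mult)
  then show ?case
    by (simp only: prod.insert[OF insert.hyps] power_mult_distrib)
qed simp

lemma poly_interpolation:
  fixes y :: "real \<Rightarrow> real"
  assumes "finite S"
  shows "\<exists>q. \<forall>s\<in>S. poly q s = y s"
  using assms
proof (induction S rule: finite_induct)
  case (insert t S)
  then obtain q where q: "\<And>s. s \<in> S \<Longrightarrow> poly q s = y s" by auto
  define W where "W = (\<Prod>s\<in>S. [:- s, 1:])"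
  have W: "poly W s = 0" if "s \<in> S" for s
    using that insert.hyps by (auto simp: W_def poly_prod)
  have Wt: "poly W t \<noteq> 0"
    using insert.hyps by (auto simp: W_def poly_prod)
  have "\<forall>s\<in>insert t S. poly (q + Polynomial.smult ((y t - poly q t) / poly W t) W) s = y s"
    using q W Wt by auto
  then show ?case by blast
qed auto

text \<open>Coefficient vectors are taken on a monomial curve in a parameter \<open>t\<close>. Two
  distinct points have equal images only if \<open>t\<close> is a root of the nonzero polynomial
  \<open>R\<close>, so finitely many points exclude finitely many values of
  \<open>t\<close>.\<close>

lemma separating_functional:
  fixes P :: "('d::finite \<Rightarrow> real) set"
  assumes "finite P"
  shows "\<exists>c. c i0 = 1 \<and> inj_on (\<lambda>p. \<Sum>i\<in>UNIV. c i * p i) P"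
proof -
  obtain e :: "'d \<Rightarrow> nat" where e: "inj e"
    using finite_imp_inj_to_nat_seg[of "UNIV :: 'd set"] by auto
  \<comment> \<open>The exponent 0 is reserved for \<open>i0\<close>, which forces the coefficient 1
    there; the shift by 1 keeps the exponents distinct.\<close>
  define k where "k = (\<lambda>i. if i = i0 then 0 else e i + 1)"
  have k: "k i = k j \<Longrightarrow> i = j" for i j
    using e by (auto simp: k_def inj_def split: if_splits)
  define R where "R = (\<lambda>pq :: ('d \<Rightarrow> real) \<times> ('d \<Rightarrow> real). \<Sum>i\<in>UNIV. monom (fst pq i - snd pq i) (k i))"
  define Z where "Z = (\<Union>pq\<in>{pq\<in>P \<times> P. fst pq \<noteq> snd pq}. {t. poly (R pq) t = 0})"
  have "R pq \<noteq> 0" if ne: "fst pq \<noteq> snd pq" for pq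
  proof -
    obtain i where i: "fst pq i \<noteq> snd pq i" using ne by auto
    have "coeff (R pq) (k i) = (\<Sum>j\<in>UNIV. if j = i then fst pq i - snd pq i else 0)"
      unfolding R_def coeff_sum by (intro sum.cong) (auto dest: k)
    also have "\<dots> \<noteq> 0" using i by simp
    finally show ?thesis by auto
  qed
  then have "finite Z"
    unfolding Z_def using assms by (intro finite_UN_I) (auto intro: poly_roots_finite)
  then have "Z \<noteq> UNIV"
    using infinite_UNIV_char_0[where 'a = real] by auto
  then obtain t where t: "t \<notin> Z" by auto
  have "inj_on (\<lambda>p. \<Sum>i\<in>UNIV. t ^ k i * p i) P"
  proof (rule inj_onI, rule ccontr)
    fix p q assume pq: "p \<in> P" "q \<in> P" "(\<Sum>i\<in>UNIV. t ^ k i * p i) = (\<Sum>i\<in>UNIV. t ^ k i * q i)" "p \<noteq> q"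
    have "poly (R (p, q)) t = (\<Sum>i\<in>UNIV. t ^ k i * p i) - (\<Sum>i\<in>UNIV. t ^ k i * q i)"
      by (simp add: R_def poly_sum poly_monom sum_subtractf[symmetric] algebra_simps)
    then have "t \<in> Z" using pq by (auto simp: Z_def)
    then show False using t by simp
  qed
  then show ?thesis
    by (intro exI[of _ "\<lambda>i. t ^ k i"]) (simp add: k_def)
qed

text \<open>A linear form injective on \<open>P\<close> makes \<open>P\<close> a graph over its
  values, with interpolating polynomials \<open>q i\<close> for the coordinates. Because
  \<open>c i0 = 1\<close>, the form can replace the variable \<open>i0\<close>; together with the
  differences Var j - q_j(lin) for the other \<open>j\<close> it is a polynomial coordinate system
  of R^d.\<close>

locale adapted_coordinates =
  fixes P :: "('d::finite \<Rightarrow> real) set" and i0 :: 'd and c :: "'d \<Rightarrow> real" and q :: "'d \<Rightarrow> real poly"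
  assumes fin: "finite P" and c_i0: "c i0 = 1"
    and inj: "inj_on (\<lambda>p. \<Sum>i\<in>UNIV. c i * p i) P"
    and q: "\<And>p i. p \<in> P \<Longrightarrow> poly (q i) (\<Sum>i\<in>UNIV. c i * p i) = p i"
begin

definition s :: "('d \<Rightarrow> real) \<Rightarrow> real" where "s x = (\<Sum>i\<in>UNIV. c i * x i)"

definition lin :: "'d mpoly" where "lin = (\<Sum>i\<in>UNIV. Const (c i) * Var i)"

definition W :: "real poly" where "W = (\<Prod>p\<in>P. [:- s p, 1:])"

text \<open>The \<open>V i\<close> with \<open>i \<noteq> i0\<close> cut out the interpolating
  curve, and \<open>V i0\<close> singles out the points of \<open>P\<close> on it. There are as many
  generators as variables, so quadratic forms in them are indexed by the variables.\<close>

definition V :: "'d \<Rightarrow> 'd mpoly" where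
  "V i = (if i = i0 then upoly W lin else Var i - upoly (q i) lin)"

text \<open>The point at which \<open>lin\<close> has the value \<open>\<sigma>\<close> and \<open>V i\<close> the value \<open>u i\<close>, \<open>i \<noteq> i0\<close>.\<close>

definition pt :: "real \<Rightarrow> ('d \<Rightarrow> real) \<Rightarrow> 'd \<Rightarrow> real" where
  "pt \<sigma> u i = (if i = i0 then \<sigma> - (\<Sum>j\<in>-{i0}. c j * (poly (q j) \<sigma> + u j)) else poly (q i) \<sigma> + u i)"

lemma eval_lin [simp]: "eval_at x lin = s x"
  by (simp add: lin_def s_def)

lemma s_split: "s x = x i0 + (\<Sum>j\<in>-{i0}. c j * x j)"
  unfolding s_def by (subst sum.remove[of UNIV i0]) (auto simp: c_i0 Compl_eq_Diff_UNIV)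

lemma s_pt [simp]: "s (pt \<sigma> u) = \<sigma>"
proof -
  have "(\<Sum>j\<in>-{i0}. c j * pt \<sigma> u j) = (\<Sum>j\<in>-{i0}. c j * (poly (q j) \<sigma> + u j))"
    by (intro sum.cong) (auto simp: pt_def)
  then show ?thesis unfolding s_split by (simp add: pt_def)
qed

lemma V_pt: "i \<noteq> i0 \<Longrightarrow> eval_at (pt \<sigma> u) (V i) = u i"
  by (simp add: V_def) (simp add: pt_def)

lemma V_i0: "eval_at x (V i0) = poly W (s x)"
  by (simp add: V_def)

lemma inj_s: "inj_on s P"
  using inj by (simp add: s_def[abs_def])

lemma q_s: "p \<in> P \<Longrightarrow> poly (q i) (s p) = p i"
  using q by (simp add: s_def)

lemma pt_self: "p \<in> P \<Longrightarrow> pt (s p) (\<lambda>_. 0) = p"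
proof (rule ext)
  fix i assume p: "p \<in> P"
  have "s p - (\<Sum>j\<in>-{i0}. c j * p j) = p i0"
    using s_split[of p] by linarith
  then show "pt (s p) (\<lambda>_. 0) i = p i"
    using p by (simp add: pt_def q_s)
qed

lemma W_zero_iff: "poly W \<sigma> = 0 \<longleftrightarrow> \<sigma> \<in> s ` P"
  using fin by (auto simp: W_def poly_prod)

lemma V_zero_iff: "(\<forall>i. eval_at x (V i) = 0) \<longleftrightarrow> x \<in> P"
proof
  assume V0: "\<forall>i. eval_at x (V i) = 0"
  then obtain p where p: "p \<in> P" "s x = s p"
    using V_i0[of x] W_zero_iff[of "s x"] by auto
  have "x i = p i" if "i \<noteq> i0" for i
    using V0[rule_format, of i] that p q_s[of p i] by (simp add: V_def)
  moreover have "x i0 = p i0"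
  proof -
    have "(\<Sum>j\<in>-{i0}. c j * x j) = (\<Sum>j\<in>-{i0}. c j * p j)"
      using calculation by (intro sum.cong) auto
    then show ?thesis using p(2) s_split[of x] s_split[of p] by simp
  qed
  ultimately have "x = p" by (metis ext)
  then show "x \<in> P" using p by simp
next
  assume "x \<in> P"
  then show "\<forall>i. eval_at x (V i) = 0"
    using q_s[of x] W_zero_iff[of "s x"] by (auto simp: V_def)
qed

lemma pt_continuous: "continuous_on UNIV (\<lambda>t. pt (a + t * b) (\<lambda>i. t * w i))"
proof (rule continuous_on_coordinatewise_then_product)
  fix i
  show "continuous_on UNIV (\<lambda>t. pt (a + t * b) (\<lambda>i. t * w i) i)"
    unfolding pt_def by (cases "i = i0") (auto intro!: continuous_intros)
qed

text \<open>Lines in the new coordinates are the test curves through \<open>p\<close>; limits along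
  them extract the coefficients of an expansion at \<open>p\<close>.\<close>

lemma pt_filterlim:
  assumes "p \<in> P"
  shows "filterlim (\<lambda>t. pt (s p + t * b) (\<lambda>i. t * w i)) (nhds p) (at 0)"
proof -
  have "((\<lambda>t. pt (s p + t * b) (\<lambda>i. t * w i)) \<longlongrightarrow> pt (s p + 0 * b) (\<lambda>i. 0 * w i)) (at 0)"
    using pt_continuous[of "s p" b w] unfolding continuous_on_def by blast
  then show ?thesis by (simp add: pt_self[OF assms])
qed

text \<open>It suffices to treat the variables: Var j = q_j(lin) + V j for
  \<open>j \<noteq> i0\<close>, and the variable \<open>i0\<close> is recovered from
  \<open>lin\<close>, where its coefficient is 1.\<close>

lemma first_order_form_all: "first_order_form lin (-{i0}) V f"
proof (induction f rule: mpoly_ring_induct)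
  case (Const a)
  show ?case by (rule first_order_form_Const)
next
  case (Var v)
  have *: "first_order_form lin (-{i0}) V (Var j)" if "j \<noteq> i0" for j
  proof -
    have "Var j = upoly (q j) lin + V j" using that by (simp add: V_def)
    then show ?thesis
      using that by (auto intro!: first_order_form_add first_order_form_upoly first_order_form_gen)
  qed
  show ?case
  proof (cases "v = i0")
    case True
    have "lin = Var i0 + (\<Sum>j\<in>-{i0}. Const (c j) * Var j)"
      unfolding lin_def by (subst sum.remove[of UNIV i0]) (auto simp: c_i0 Compl_eq_Diff_UNIV)
    then have "Var i0 = lin + (\<Sum>j\<in>-{i0}. Const (- c j) * Var j)"
      by (simp add: single_uminus sum_negf)
    moreover have "first_order_form lin (-{i0}) V (lin + (\<Sum>j\<in>-{i0}. Const (- c j) * Var j))"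
      by (intro first_order_form_add first_order_form_self first_order_form_sum
          first_order_form_mult first_order_form_Const *) auto
    ultimately show ?thesis using True by simp
  qed (use * in auto)
qed (auto intro: first_order_form_add first_order_form_mult)

text \<open>Write \<open>h\<close> as a(lin) + sum b_i(lin) V_i plus a quadratic part. A local
  minimum with value 0 at \<open>p\<close> forces a double root of \<open>a\<close> at
  \<open>s p\<close> (move along the curve) and a root of each \<open>b k\<close> (move in the
  direction of \<open>V k\<close>). Over all of \<open>P\<close>, W^2 divides \<open>a\<close> and
  \<open>W\<close> divides \<open>b k\<close>; since \<open>V i0\<close> is W(lin), these parts are
  quadratic in the \<open>V i\<close> too.\<close>

lemma quadratic_representation:
  assumes zero: "\<And>p. p \<in> P \<Longrightarrow> eval_at p h = 0"
    and nonneg: "\<And>p. p \<in> P \<Longrightarrow> \<forall>\<^sub>F x in nhds p. eval_at x h \<ge> 0"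
  obtains C where "h = (\<Sum>i\<in>UNIV. \<Sum>j\<in>UNIV. C i j * V i * V j)"
proof -
  let ?S = "-{i0}"
  obtain a b H where "h - (upoly a lin + (\<Sum>i\<in>?S. upoly (b i) lin * V i)) =
      (\<Sum>i\<in>?S. \<Sum>j\<in>?S. H i j * V i * V j)"
    using first_order_form_all[of h] by (auto simp: first_order_form_def square_span_def)
  then have h: "h = upoly a lin + (\<Sum>i\<in>?S. upoly (b i) lin * V i) +
      (\<Sum>i\<in>?S. \<Sum>j\<in>?S. H i j * V i * V j)"
    by (simp add: algebra_simps)
  have h_pt: "eval_at (pt \<sigma> u) h = poly a \<sigma> + (\<Sum>i\<in>?S. poly (b i) \<sigma> * u i) +
      (\<Sum>i\<in>?S. \<Sum>j\<in>?S. eval_at (pt \<sigma> u) (H i j) * u i * u j)" for \<sigma> u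
    by (subst h) (simp add: V_pt cong: sum.cong_simp)
  have a_zero: "poly a (s p) = 0" if p: "p \<in> P" for p
    using h_pt[of "s p" "\<lambda>_. 0"] zero[OF p] pt_self[OF p] by simp
  have a_sq: "[:- s p, 1:] ^ 2 dvd a" if p: "p \<in> P" for p
  proof -
    \<comment> \<open>On the curve all \<open>V i\<close> with \<open>i \<noteq> i0\<close> vanish,
      so \<open>h\<close> restricts to the univariate polynomial \<open>a\<close>.\<close>
    have "\<forall>\<^sub>F t in at 0. eval_at (pt (s p + t * 1) (\<lambda>i. t * 0)) h \<ge> 0"
      using nonneg[OF p] pt_filterlim[OF p] by (rule eventually_compose_filterlim)
    then have "\<forall>\<^sub>F t in at 0. poly a (s p + t) \<ge> 0"
      by (simp add: h_pt)
    then obtain d where d: "d > 0" "\<And>t. t \<noteq> 0 \<Longrightarrow> \<bar>t\<bar> < d \<Longrightarrow> poly a (s p + t) \<ge> 0"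
      unfolding eventually_at by (auto simp: dist_real_def)
    have "poly (pderiv a) (s p) = 0"
    proof (rule DERIV_local_min[OF poly_DERIV d(1)], intro allI impI)
      fix y assume y: "\<bar>s p - y\<bar> < d"
      show "poly a (s p) \<le> poly a y"
        using d(2)[of "y - s p"] y a_zero[OF p] by (cases "y = s p") auto
    qed
    moreover obtain a1 where a1: "a = [:- s p, 1:] * a1"
      using a_zero[OF p] by (auto simp: poly_eq_0_iff_dvd elim: dvdE)
    moreover have "poly (pderiv ([:- s p, 1:] * a1)) (s p) = poly a1 (s p)"
      unfolding pderiv_mult by (simp add: pderiv_pCons)
    ultimately have "[:- s p, 1:] dvd a1"
      by (simp add: poly_eq_0_iff_dvd[symmetric])
    then show ?thesis
      unfolding a1 power2_eq_square by (rule mult_dvd_mono[OF dvd_refl])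
  qed
  have b_zero: "[:- s p, 1:] ^ 1 dvd b k" if p: "p \<in> P" and k: "k \<noteq> i0" for p k
  proof -
    define e where "e = (\<lambda>i. if i = k then 1 else 0 :: real)"
    define \<gamma> where "\<gamma> = (\<lambda>t. pt (s p + t * 0) (\<lambda>i. t * e i))"
    have lim: "filterlim \<gamma> (nhds p) (at 0)"
      unfolding \<gamma>_def by (rule pt_filterlim[OF p])
    have "eval_at (\<gamma> t) h = t * (poly (b k) (s p) + t * eval_at (\<gamma> t) (H k k))" for t
    proof -
      have 1: "(\<Sum>i\<in>?S. poly (b i) (s p) * (t * e i)) = poly (b k) (s p) * t"
      proof -
        have "(\<Sum>i\<in>?S. poly (b i) (s p) * (t * e i)) = (\<Sum>i\<in>?S. if i = k then poly (b k) (s p) * t else 0)"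
          by (intro sum.cong) (auto simp: e_def)
        then show ?thesis using k by simp
      qed
      have 2: "(\<Sum>i\<in>?S. \<Sum>j\<in>?S. eval_at (\<gamma> t) (H i j) * (t * e i) * (t * e j)) =
          eval_at (\<gamma> t) (H k k) * t * t"
      proof -
        have "(\<Sum>i\<in>?S. \<Sum>j\<in>?S. eval_at (\<gamma> t) (H i j) * (t * e i) * (t * e j)) =
          (\<Sum>i\<in>?S. \<Sum>j\<in>?S. if j = k then (if i = k then eval_at (\<gamma> t) (H k k) * t * t else 0) else 0)"
          by (intro sum.cong) (auto simp: e_def)
        then show ?thesis using k by simp
      qed
      show ?thesis
        using h_pt[of "s p + t * 0" "\<lambda>i. t * e i"] 1 2 a_zero[OF p]
        by (simp add: \<gamma>_def algebra_simps)
    qed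
    moreover have "\<forall>\<^sub>F t in at 0. eval_at (\<gamma> t) h \<ge> 0"
      using nonneg[OF p] lim by (rule eventually_compose_filterlim)
    ultimately have ev: "\<forall>\<^sub>F t in at 0. t * (poly (b k) (s p) + t * eval_at (\<gamma> t) (H k k)) \<ge> 0"
      by simp
    have "((\<lambda>t. eval_at (\<gamma> t) (H k k)) \<longlongrightarrow> eval_at p (H k k)) (at 0)"
      using filterlim_compose[OF eval_tendsto lim] by simp
    then have L: "((\<lambda>t. poly (b k) (s p) + t * eval_at (\<gamma> t) (H k k)) \<longlongrightarrow>
        poly (b k) (s p) + 0 * eval_at p (H k k)) (at 0)"
      by (intro tendsto_intros)
    \<comment> \<open>The product of \<open>t\<close> and the bracket is nonnegative, so the bracket
      has the sign of \<open>t\<close>; its two one-sided limits at 0 agree and must therefore be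
      0.\<close>
    have "poly (b k) (s p) \<ge> 0"
    proof (rule tendsto_lowerbound)
      show "((\<lambda>t. poly (b k) (s p) + t * eval_at (\<gamma> t) (H k k)) \<longlongrightarrow> poly (b k) (s p)) (at_right 0)"
        using L filterlim_at_split by auto
      show "\<forall>\<^sub>F t in at_right 0. 0 \<le> poly (b k) (s p) + t * eval_at (\<gamma> t) (H k k)"
        using ev[unfolded eventually_at_split, THEN conjunct2] eventually_at_right_less[of 0]
        by eventually_elim (auto simp: zero_le_mult_iff)
    qed simp
    moreover have "poly (b k) (s p) \<le> 0"
    proof (rule tendsto_upperbound)
      show "((\<lambda>t. poly (b k) (s p) + t * eval_at (\<gamma> t) (H k k)) \<longlongrightarrow> poly (b k) (s p)) (at_left 0)"
        using L filterlim_at_split by auto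
      have neg: "\<forall>\<^sub>F t in at_left (0::real). t < 0"
        by (simp add: eventually_at_filter)
      show "\<forall>\<^sub>F t in at_left 0. poly (b k) (s p) + t * eval_at (\<gamma> t) (H k k) \<le> 0"
        using ev[unfolded eventually_at_split, THEN conjunct1] neg
        by eventually_elim (auto simp: zero_le_mult_iff)
    qed simp
    ultimately have "poly (b k) (s p) = 0" by simp
    then show ?thesis by (simp add: poly_eq_0_iff_dvd)
  qed
  have "W ^ 2 dvd a"
    unfolding W_def by (rule prod_linear_power_dvd[OF fin inj_s]) (rule a_sq)
  then obtain a' where a': "a = W ^ 2 * a'" by (auto elim: dvdE)
  have "W ^ 1 dvd b k" if "k \<noteq> i0" for k
    unfolding W_def by (rule prod_linear_power_dvd[OF fin inj_s]) (rule b_zero[OF _ that])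
  then have "\<forall>k. \<exists>b'. k \<noteq> i0 \<longrightarrow> b k = W * b'" by (auto elim!: dvdE)
  then obtain b' where b': "\<And>k. k \<noteq> i0 \<Longrightarrow> b k = W * b' k" by metis
  \<comment> \<open>The quotients by W^2 and \<open>W\<close> go into row \<open>i0\<close>, whose
    entries are multiplied by the factor \<open>V i0\<close>. The result is not symmetric in
    general.\<close>
  define C where "C = (\<lambda>i j. if i = i0 then (if j = i0 then upoly a' lin else upoly (b' j) lin)
      else if j = i0 then 0 else H i j)"
  have split: "(\<Sum>i\<in>UNIV. f i) = f i0 + (\<Sum>i\<in>?S. f i)" for f :: "'d \<Rightarrow> 'd mpoly"
    by (subst sum.remove[of UNIV i0]) (auto simp: Compl_eq_Diff_UNIV)
  have "(\<Sum>i\<in>UNIV. \<Sum>j\<in>UNIV. C i j * V i * V j) =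
      upoly a' lin * V i0 * V i0 + (\<Sum>j\<in>?S. upoly (b' j) lin * V i0 * V j) +
      (\<Sum>i\<in>?S. \<Sum>j\<in>?S. H i j * V i * V j)"
    unfolding split by (simp add: C_def cong: sum.cong_simp)
  also have "upoly a' lin * V i0 * V i0 = upoly a lin"
    by (simp add: a' V_def upoly_mult power2_eq_square mult_ac)
  also have "(\<Sum>j\<in>?S. upoly (b' j) lin * V i0 * V j) = (\<Sum>j\<in>?S. upoly (b j) lin * V j)"
    by (intro sum.cong) (auto simp: b' V_def[of i0] upoly_mult mult_ac)
  finally show ?thesis by (intro that[of C]) (simp only: h)
qed

text \<open>The \<open>V i\<close> are O(rho), so near \<open>p\<close> growth yields
  \<open>h \<ge> c |V|^2\<close> for some positive \<open>c\<close>. Along a curve with V = t (w +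
  o(1)), division by t^2 and the limit give a positive lower bound for the form of \<open>C\<close>
  at \<open>p\<close> on \<open>w\<close>.\<close>

lemma representation_pd_at_zero:
  assumes h: "h = (\<Sum>i\<in>UNIV. \<Sum>j\<in>UNIV. C i j * V i * V j)"
    and p: "p \<in> P" and gr: "growth p h" and w: "w \<noteq> (\<lambda>_. 0)"
  shows "(\<Sum>i\<in>UNIV. \<Sum>j\<in>UNIV. eval_at p (C i j) * w i * w j) > 0"
proof -
  obtain c0 where c0: "c0 > 0" "\<forall>\<^sub>F x in nhds p. eval_at x h \<ge> c0 * (rho p x)^2"
    using gr by (auto simp: growth_def)
  have "(\<lambda>x. \<Sum>i\<in>UNIV. (eval_at x (V i))^2) \<in> O[nhds p](\<lambda>x. rho p x ^ 2)"
  proof (rule big_sum_in_bigo)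
    fix i
    have "(\<lambda>x. eval_at x (V i)) \<in> O[nhds p](\<lambda>x. rho p x ^ 1)"
      using V_zero_iff[of p] p by (intro eval_zero_bigo) auto
    from landau_o.big_power[OF this, where m = 2]
    show "(\<lambda>x. (eval_at x (V i))^2) \<in> O[nhds p](\<lambda>x. rho p x ^ 2)" by simp
  qed
  then obtain L where L: "L > 0"
    "\<forall>\<^sub>F x in nhds p. norm (\<Sum>i\<in>UNIV. (eval_at x (V i))^2) \<le> L * norm (rho p x ^ 2)"
    by (elim landau_o.bigE)
  have ev: "\<forall>\<^sub>F x in nhds p. eval_at x h \<ge> c0 / L * (\<Sum>i\<in>UNIV. (eval_at x (V i))^2)"
    using c0(2) L(2)
  proof eventually_elim
    case (elim x)
    have "(\<Sum>i\<in>UNIV. (eval_at x (V i))^2) \<le> L * (rho p x)^2"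
      using elim(2) by (simp add: abs_le_iff)
    then have "c0 / L * (\<Sum>i\<in>UNIV. (eval_at x (V i))^2) \<le> c0 / L * (L * (rho p x)^2)"
      using c0 L by (intro mult_left_mono) auto
    then show ?case using elim(1) L by simp
  qed
  define W1 where "W1 = (\<Prod>p'\<in>P - {p}. [:- s p', 1:])"
  have W_split: "W = [:- s p, 1:] * W1"
    unfolding W_def W1_def by (rule prod.remove[OF fin p])
  have W1: "poly W1 (s p) \<noteq> 0"
    using fin inj_s p by (auto simp: W1_def poly_prod inj_on_def)
  \<comment> \<open>The derivative of \<open>W\<close> at \<open>s p\<close> is the value of
    \<open>W1\<close> there, so with this speed \<open>V i0\<close> has first-order coefficient
    \<open>w i0\<close>.\<close>
  define b where "b = w i0 / poly W1 (s p)"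
  define \<gamma> where "\<gamma> = (\<lambda>t. pt (s p + t * b) (\<lambda>i. t * w i))"
  have lim: "filterlim \<gamma> (nhds p) (at 0)"
    unfolding \<gamma>_def by (rule pt_filterlim[OF p])
  define u where "u = (\<lambda>i t. if i = i0 then b * poly W1 (s p + t * b) else w i)"
  have Vu: "eval_at (\<gamma> t) (V i) = t * u i t" for i t
    by (cases "i = i0") (auto simp: u_def \<gamma>_def V_pt V_i0 W_split algebra_simps)
  have ulim: "((\<lambda>t. u i t) \<longlongrightarrow> w i) (at 0)" for i
  proof (cases "i = i0")
    case True
    have "((\<lambda>t. b * poly W1 (s p + t * b)) \<longlongrightarrow> b * poly W1 (s p + 0 * b)) (at 0)"
      by (intro tendsto_intros tendsto_poly)
    then show ?thesis using True W1 by (simp add: u_def b_def)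
  qed (simp add: u_def)
  have "\<forall>\<^sub>F t in at 0. eval_at (\<gamma> t) h \<ge> c0 / L * (\<Sum>i\<in>UNIV. (eval_at (\<gamma> t) (V i))^2)"
    using ev lim by (rule eventually_compose_filterlim)
  moreover have "\<forall>\<^sub>F t in at (0::real). t \<noteq> 0"
    by (simp add: eventually_at_filter)
  ultimately have "\<forall>\<^sub>F t in at 0. c0 / L * (\<Sum>i\<in>UNIV. (u i t)^2) \<le>
      (\<Sum>i\<in>UNIV. \<Sum>j\<in>UNIV. eval_at (\<gamma> t) (C i j) * u i t * u j t)"
  proof eventually_elim
    case (elim t)
    have "eval_at (\<gamma> t) h = (\<Sum>i\<in>UNIV. \<Sum>j\<in>UNIV. eval_at (\<gamma> t) (C i j) * (t * u i t) * (t * u j t))"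
      by (subst h) (simp add: Vu)
    also have "\<dots> = t^2 * (\<Sum>i\<in>UNIV. \<Sum>j\<in>UNIV. eval_at (\<gamma> t) (C i j) * u i t * u j t)"
      by (simp add: sum_distrib_left power2_eq_square mult_ac)
    finally have "t^2 * (c0 / L * (\<Sum>i\<in>UNIV. (u i t)^2)) \<le>
        t^2 * (\<Sum>i\<in>UNIV. \<Sum>j\<in>UNIV. eval_at (\<gamma> t) (C i j) * u i t * u j t)"
      using elim(1) by (simp add: Vu power_mult_distrib sum_distrib_left[symmetric] mult_ac)
    then show ?case using elim(2) by (subst (asm) mult_le_cancel_left_pos) auto
  qed
  moreover have "((\<lambda>t. \<Sum>i\<in>UNIV. \<Sum>j\<in>UNIV. eval_at (\<gamma> t) (C i j) * u i t * u j t) \<longlongrightarrow>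
      (\<Sum>i\<in>UNIV. \<Sum>j\<in>UNIV. eval_at p (C i j) * w i * w j)) (at 0)"
    by (intro tendsto_intros ulim filterlim_compose[OF eval_tendsto lim])
  moreover have "((\<lambda>t. c0 / L * (\<Sum>i\<in>UNIV. (u i t)^2)) \<longlongrightarrow> c0 / L * (\<Sum>i\<in>UNIV. (w i)^2)) (at 0)"
    by (intro tendsto_intros ulim)
  ultimately have "c0 / L * (\<Sum>i\<in>UNIV. (w i)^2) \<le> (\<Sum>i\<in>UNIV. \<Sum>j\<in>UNIV. eval_at p (C i j) * w i * w j)"
    by (intro tendsto_le[OF _ _ _, of "at (0::real)"]) auto
  moreover have "(\<Sum>i\<in>UNIV. (w i)^2) > 0"
  proof -
    obtain i where "w i \<noteq> 0" using w by auto
    then show ?thesis by (intro sum_pos2[of _ i]) auto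
  qed
  then have "c0 / L * (\<Sum>i\<in>UNIV. (w i)^2) > 0"
    using c0 L by simp
  ultimately show ?thesis by linarith
qed

end

section \<open>Finsler's modification and membership in the preordering of the box\<close>

lemma lagrange_identity_unit:
  fixes v w :: "'i \<Rightarrow> real"
  assumes "(\<Sum>i\<in>S. (w i)^2) = 1"
  shows "(\<Sum>i\<in>S. (v i - (\<Sum>j\<in>S. v j * w j) * w i)^2) = (\<Sum>i\<in>S. (v i)^2) - (\<Sum>i\<in>S. v i * w i)^2"
proof -
  define b where "b = (\<Sum>j\<in>S. v j * w j)"
  have "(\<Sum>i\<in>S. (v i - b * w i)^2) = (\<Sum>i\<in>S. (v i)^2 - 2 * b * (v i * w i) + b^2 * (w i)^2)"
    by (intro sum.cong) (auto simp: power2_eq_square algebra_simps)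
  also have "\<dots> = (\<Sum>i\<in>S. (v i)^2) - 2 * b * b + b^2 * 1"
    unfolding sum.distrib sum_subtractf sum_distrib_left[symmetric] assms b_def[symmetric] ..
  finally show ?thesis by (simp add: b_def power2_eq_square)
qed

text \<open>Coordinates outside \<open>I\<close> are pinned to 0; otherwise they would be unbounded
  and the set not compact.\<close>

lemma compact_unit_sphere:
  assumes "finite I"
  shows "compact {w :: 'i \<Rightarrow> real. (\<forall>i. i \<notin> I \<longrightarrow> w i = 0) \<and> (\<Sum>i\<in>I. (w i)^2) = 1}"
proof -
  let ?b = "\<lambda>i. if i \<in> I then 1 else 0 :: real"
  have "closed {w :: 'i \<Rightarrow> real. (\<Sum>i\<in>I. (w i)^2) = 1}"
    by (intro closed_Collect_eq continuous_intros continuous_on_product_coordinates)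
  moreover have "compact {w. \<forall>i. - ?b i \<le> w i \<and> w i \<le> ?b i}"
    by (rule compact_box)
  ultimately have "compact ({w. \<forall>i. - ?b i \<le> w i \<and> w i \<le> ?b i} \<inter> {w. (\<Sum>i\<in>I. (w i)^2) = 1})"
    by blast
  moreover have "{w. \<forall>i. - ?b i \<le> w i \<and> w i \<le> ?b i} \<inter> {w. (\<Sum>i\<in>I. (w i)^2) = 1} =
      {w. (\<forall>i. i \<notin> I \<longrightarrow> w i = 0) \<and> (\<Sum>i\<in>I. (w i)^2) = 1}"
  proof -
    have "w i = 0" if "\<forall>i. - ?b i \<le> w i \<and> w i \<le> ?b i" "i \<notin> I" for w i
      using that(1)[rule_format, of i] that(2) by simp
    moreover have "- ?b i \<le> w i \<and> w i \<le> ?b i"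
      if w: "\<forall>i. i \<notin> I \<longrightarrow> w i = 0" "(\<Sum>i\<in>I. (w i)^2) = 1" for w i
    proof (cases "i \<in> I")
      case True
      have "(w i)^2 \<le> 1"
        unfolding w(2)[symmetric] using assms True by (intro member_le_sum) auto
      then have "\<bar>w i\<bar> \<le> 1" by (simp add: abs_square_le_1)
      then show ?thesis using True by (simp add: abs_le_iff)
    qed (use w(1) in simp)
    ultimately show ?thesis by blast
  qed
  ultimately show ?thesis by simp
qed

lemma form_bound_from_sphere:
  fixes Q :: "'i \<Rightarrow> 'i \<Rightarrow> real"
  assumes I: "finite I"
    and "\<And>w. (\<And>i. i \<notin> I \<Longrightarrow> w i = 0) \<Longrightarrow> (\<Sum>i\<in>I. (w i)^2) = 1 \<Longrightarrow> (\<Sum>i\<in>I. \<Sum>j\<in>I. Q i j * w i * w j) \<ge> \<delta>"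
  shows "(\<Sum>i\<in>I. \<Sum>j\<in>I. Q i j * w i * w j) \<ge> \<delta> * (\<Sum>i\<in>I. (w i)^2)"
proof (cases "\<forall>i\<in>I. w i = 0")
  case False
  define n where "n = sqrt (\<Sum>i\<in>I. (w i)^2)"
  have n2: "n^2 = (\<Sum>i\<in>I. (w i)^2)" by (simp add: n_def sum_nonneg)
  moreover have "(\<Sum>i\<in>I. (w i)^2) > 0"
    using False I by (auto intro: sum_pos2)
  ultimately have n: "n \<noteq> 0" by auto
  let ?w = "\<lambda>i. if i \<in> I then w i / n else 0"
  have "(\<Sum>i\<in>I. (?w i)^2) = (\<Sum>i\<in>I. (w i / n)^2)" by (intro sum.cong) auto
  also have "\<dots> = 1"
    using n by (simp add: power_divide sum_divide_distrib[symmetric] n2[symmetric])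
  finally have "\<delta> \<le> (\<Sum>i\<in>I. \<Sum>j\<in>I. Q i j * ?w i * ?w j)"
    by (intro assms(2)) auto
  also have "\<dots> = (\<Sum>i\<in>I. \<Sum>j\<in>I. Q i j * (w i / n) * (w j / n))" by (intro sum.cong) auto
  also have "\<dots> = (\<Sum>i\<in>I. \<Sum>j\<in>I. Q i j * w i * w j) / n^2"
    by (simp add: sum_divide_distrib power2_eq_square)
  finally show ?thesis
    using n by (simp add: n2[symmetric] pos_le_divide_eq)
qed simp

text \<open>The form of C + k (n I - v v^T). It is used over the polynomials with \<open>f\<close>
  equal to \<open>v\<close> and \<open>n\<close> its squared length, where the added term cancels,
  and over the reals with \<open>f\<close> a unit vector, where the term is a multiple of the defect
  in the Cauchy-Schwarz inequality.\<close>

lemma finsler_sum: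
  fixes v f :: "'i \<Rightarrow> 'a::comm_ring_1"
  assumes "finite S"
  shows "(\<Sum>i\<in>S. \<Sum>j\<in>S. (C i j + k * ((if i = j then n else 0) - v i * v j)) * f i * f j) =
    (\<Sum>i\<in>S. \<Sum>j\<in>S. C i j * f i * f j) + k * (n * (\<Sum>i\<in>S. (f i)^2) - (\<Sum>i\<in>S. v i * f i)^2)"
proof -
  have "(\<Sum>i\<in>S. \<Sum>j\<in>S. (C i j + k * ((if i = j then n else 0) - v i * v j)) * f i * f j) =
      (\<Sum>i\<in>S. \<Sum>j\<in>S. C i j * f i * f j + (if i = j then k * n * (f i)^2 else 0) - k * ((v i * f i) * (v j * f j)))"
    by (intro sum.cong refl) (auto simp: algebra_simps power2_eq_square)
  also have "\<dots> = (\<Sum>i\<in>S. \<Sum>j\<in>S. C i j * f i * f j) + (\<Sum>i\<in>S. k * n * (f i)^2) -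
      k * (\<Sum>i\<in>S. \<Sum>j\<in>S. (v i * f i) * (v j * f j))"
    using assms by (simp only: sum.distrib sum_subtractf sum_distrib_left sum.delta if_True cong: sum.cong)
      (simp add: sum.delta cong: if_cong)
  also have "(\<Sum>i\<in>S. \<Sum>j\<in>S. (v i * f i) * (v j * f j)) = (\<Sum>i\<in>S. v i * f i)^2"
    by (simp only: power2_eq_square sum_product)
  also have "(\<Sum>i\<in>S. k * n * (f i)^2) = k * (n * (\<Sum>i\<in>S. (f i)^2))"
    by (simp only: sum_distrib_left mult.assoc)
  finally show ?thesis
    by (simp only: right_diff_distrib add_diff_eq)
qed

text \<open>The modification is chosen by compactness on the box times the unit sphere. Where its
  form \<open>\<psi>\<close> vanishes, v(x) = b w. If b = 0, then \<open>x\<close> lies in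
  \<open>P\<close>, where \<open>C\<close> is positive definite; otherwise h(x) = b^2 w^T C(x) w is
  positive. Hence the form of \<open>C\<close> is positive wherever \<open>\<psi>\<close> is 0, and
  a multiple of \<open>\<psi>\<close> makes it positive everywhere.\<close>

theorem positive_with_zeros_in_preordering:
  fixes h :: "'d::finite mpoly"
  assumes T: "preordering T" and r: "r > 0"
    and box: "\<And>i. Const r + Var i \<in> T" "\<And>i. Const r - Var i \<in> T"
    and fin: "finite P" and zero: "\<And>p. p \<in> P \<Longrightarrow> eval_at p h = 0"
    and gr: "\<And>p. p \<in> P \<Longrightarrow> growth p h"
    and pos: "\<And>x. (\<forall>i. \<bar>x i\<bar> \<le> r) \<Longrightarrow> x \<notin> P \<Longrightarrow> eval_at x h > 0"
  shows "h \<in> T"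
proof -
  \<comment> \<open>Any variable can be the distinguished one.\<close>
  define i0 :: 'd where "i0 = undefined"
  obtain c where c: "c i0 = 1" "inj_on (\<lambda>p. \<Sum>i\<in>UNIV. c i * p i) P"
    using separating_functional[OF fin] by blast
  have "\<exists>q. \<forall>p\<in>P. poly q (\<Sum>i\<in>UNIV. c i * p i) = p k" for k
  proof -
    let ?s = "\<lambda>p. \<Sum>i\<in>UNIV. c i * p i"
    obtain q where "\<forall>t\<in>?s ` P. poly q t = inv_into P ?s t k"
      using poly_interpolation[of "?s ` P" "\<lambda>t. inv_into P ?s t k"] fin by auto
    moreover have "inv_into P ?s (?s p) = p" if "p \<in> P" for p
      using inv_into_f_f[OF c(2) that] by simp
    ultimately show ?thesis by (intro exI[of _ q]) auto
  qed
  then obtain q where q: "\<And>k p. p \<in> P \<Longrightarrow> poly (q k) (\<Sum>i\<in>UNIV. c i * p i) = p k"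
    by metis
  interpret adapted_coordinates P i0 c q
    by standard (use fin c q in auto)
  have "\<forall>\<^sub>F x in nhds p. eval_at x h \<ge> 0" if p: "p \<in> P" for p
  proof -
    obtain c0 where "c0 > 0" "\<forall>\<^sub>F x in nhds p. eval_at x h \<ge> c0 * (rho p x)^2"
      using gr[OF p] by (auto simp: growth_def)
    then show ?thesis
      by (auto elim!: eventually_mono intro: order_trans[rotated])
  qed
  then obtain C where C: "h = (\<Sum>i\<in>UNIV. \<Sum>j\<in>UNIV. C i j * V i * V j)"
    using quadratic_representation[of h] zero by blast
  have abs_box: "\<bar>t\<bar> \<le> r \<longleftrightarrow> - r \<le> t \<and> t \<le> r" for t :: real
    by linarith
  define \<phi> where "\<phi> = (\<lambda>z. \<Sum>i\<in>UNIV. \<Sum>j\<in>UNIV. eval_at (fst z) (C i j) * snd z i * snd z j)"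
  define v where "v = (\<lambda>x i. eval_at x (V i))"
  define \<psi> where "\<psi> = (\<lambda>z. (\<Sum>i\<in>UNIV. (v (fst z) i)^2) * (\<Sum>i\<in>UNIV. (snd z i)^2) -
      (\<Sum>i\<in>UNIV. v (fst z) i * snd z i)^2)"
  define Z where "Z = {x :: 'd \<Rightarrow> real. \<forall>i. - r \<le> x i \<and> x i \<le> r} \<times> {w :: 'd \<Rightarrow> real. (\<Sum>i\<in>UNIV. (w i)^2) = 1}"
  have Z: "compact Z"
    unfolding Z_def using compact_unit_sphere[of "UNIV :: 'd set"]
    by (intro compact_Times compact_box) simp
  have coord: "continuous_on UNIV (\<lambda>z :: ('d \<Rightarrow> real) \<times> ('d \<Rightarrow> real). snd z i)" for i
    by (rule continuous_coord) (intro continuous_intros)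
  have ev: "continuous_on UNIV (\<lambda>z :: ('d \<Rightarrow> real) \<times> ('d \<Rightarrow> real). eval_at (fst z) f)" for f
    by (rule continuous_eval_compose) (intro continuous_intros)
  have cont: "continuous_on UNIV \<phi>" "continuous_on UNIV \<psi>"
    unfolding \<phi>_def \<psi>_def v_def by (intro continuous_on_sum continuous_on_mult continuous_on_diff
        continuous_on_power coord ev)+
  \<comment> \<open>By Lagrange's identity \<open>\<psi>\<close> is the squared length of the
    component of \<open>v\<close> orthogonal to the unit vector: it is nonnegative, and 0 only if
    \<open>v\<close> is a multiple of that vector.\<close>
  have \<psi>_unit: "\<psi> z = (\<Sum>i\<in>UNIV. (v (fst z) i - (\<Sum>j\<in>UNIV. v (fst z) j * snd z j) * snd z i)^2)"
    if "z \<in> Z" for z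
    using that by (subst lagrange_identity_unit) (auto simp: Z_def \<psi>_def)
  have "\<phi> z > 0" if z: "z \<in> Z" "\<psi> z = 0" for z
  proof -
    define x w b where "x = fst z" and "w = snd z" and "b = (\<Sum>j\<in>UNIV. v x j * w j)"
    have v_eq: "v x i = b * w i" for i
    proof -
      have "(\<Sum>i\<in>UNIV. (v x i - b * w i)^2) = 0"
        using \<psi>_unit[OF z(1)] z(2) unfolding x_def w_def b_def by (rule trans[OF sym])
      then have "(v x i - b * w i)^2 = 0"
        by (subst (asm) sum_nonneg_eq_0_iff) auto
      then show ?thesis by simp
    qed
    have w1: "(\<Sum>i\<in>UNIV. (w i)^2) = 1" and xr: "\<forall>i. \<bar>x i\<bar> \<le> r"
      using z(1) by (auto simp: Z_def w_def x_def abs_box)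
    have w0: "w \<noteq> (\<lambda>_. 0)" using w1 by auto
    show ?thesis
    proof (cases "b = 0")
      case True
      then have "x \<in> P" using v_eq V_zero_iff[of x] by (simp add: v_def)
      then show ?thesis
        using representation_pd_at_zero[OF C _ gr w0] by (simp add: \<phi>_def x_def w_def)
    next
      case False
      obtain i where "w i \<noteq> 0" using w0 by auto
      then have "v x i \<noteq> 0" using False v_eq by simp
      then have "x \<notin> P" using V_zero_iff[of x] by (auto simp: v_def)
      then have "0 < eval_at x h" using pos xr by blast
      also have "eval_at x h = (\<Sum>i\<in>UNIV. \<Sum>j\<in>UNIV. eval_at x (C i j) * v x i * v x j)"
        by (subst C) (simp add: v_def)
      also have "\<dots> = b^2 * \<phi> z"
        unfolding v_eq by (simp add: \<phi>_def x_def w_def sum_distrib_left power2_eq_square mult_ac)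
      finally show ?thesis by (simp add: zero_less_mult_iff)
    qed
  qed
  moreover have "\<psi> z \<ge> 0" if "z \<in> Z" for z
    unfolding \<psi>_unit[OF that] by (intro sum_nonneg) auto
  ultimately obtain \<kappa> \<delta> where \<kappa>: "\<kappa> > 0" and \<delta>: "\<delta> > 0" "\<And>z. z \<in> Z \<Longrightarrow> \<phi> z + \<kappa> * \<psi> z \<ge> \<delta>"
    using compact_positive_multiple[OF Z cont] by blast
  define N where "N = (\<Sum>k\<in>UNIV. V k * V k)"
  define E where "E = (\<lambda>i j. C i j + Const \<kappa> * ((if i = j then N else 0) - V i * V j))"
  have "(\<Sum>i\<in>UNIV. \<Sum>j\<in>UNIV. E i j * V i * V j) = h"
    unfolding E_def finsler_sum[OF finite] C[symmetric] by (simp add: N_def power2_eq_square)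
  then have h_E: "h = (\<Sum>i\<in>UNIV. \<Sum>j\<in>UNIV. E i j * V i * V j)" ..
  have "(\<Sum>i\<in>UNIV. \<Sum>j\<in>UNIV. E i j * V i * V j) \<in> T"
  proof (rule pd_matrix_in_preordering[OF T r box \<delta>(1)])
    fix x w :: "'d \<Rightarrow> real" assume x: "\<forall>i. \<bar>x i\<bar> \<le> r"
    show "(\<Sum>i\<in>UNIV. \<Sum>j\<in>UNIV. eval_at x (E i j) * w i * w j) \<ge> \<delta> * (\<Sum>i\<in>UNIV. (w i)^2)"
    proof (rule form_bound_from_sphere[OF finite])
      fix w :: "'d \<Rightarrow> real" assume w: "(\<Sum>i\<in>UNIV. (w i)^2) = 1"
      have E_eval: "eval_at x (E i j) = eval_at x (C i j) +
          \<kappa> * ((if i = j then eval_at x N else 0) - v x i * v x j)" for i j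
        by (simp add: E_def v_def)
      have "(\<Sum>i\<in>UNIV. \<Sum>j\<in>UNIV. eval_at x (E i j) * w i * w j) = \<phi> (x, w) + \<kappa> * \<psi> (x, w)"
        unfolding E_eval finsler_sum[OF finite] by (simp add: \<phi>_def \<psi>_def N_def v_def power2_eq_square)
      moreover have "\<delta> \<le> \<phi> (x, w) + \<kappa> * \<psi> (x, w)"
        using x w by (intro \<delta>(2)) (auto simp: Z_def abs_box)
      ultimately show "\<delta> \<le> (\<Sum>i\<in>UNIV. \<Sum>j\<in>UNIV. eval_at x (E i j) * w i * w j)" by simp
    qed
  qed
  then show ?thesis using h_E by simp
qed

section \<open>Archimedean quadratic modules\<close>

lemma quadratic_module_1: "quadratic_module M \<Longrightarrow> 1 \<in> M"
  and quadratic_module_add: "quadratic_module M \<Longrightarrow> a \<in> M \<Longrightarrow> b \<in> M \<Longrightarrow> a + b \<in> M"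
  and quadratic_module_mult: "quadratic_module M \<Longrightarrow> b \<in> M \<Longrightarrow> c^2 * b \<in> M"
  by (auto simp: quadratic_module_def)

lemma quadratic_module_0: "quadratic_module M \<Longrightarrow> 0 \<in> M"
  using quadratic_module_mult[OF _ quadratic_module_1, of M 0] by simp

lemma quadratic_module_sum:
  "quadratic_module M \<Longrightarrow> (\<And>i. i \<in> S \<Longrightarrow> f i \<in> M) \<Longrightarrow> (\<Sum>i\<in>S. f i) \<in> M"
  by (induction S rule: infinite_finite_induct) (auto intro: quadratic_module_add quadratic_module_0)

text \<open>A quadratic module is not closed under products, but the elements whose multiplication
  preserves it are. They include all squares and lie in \<open>M\<close>, as 1 does.\<close>

lemma preordering_multipliers:
  "quadratic_module M \<Longrightarrow> preordering {a. \<forall>m\<in>M. a * m \<in> M}"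
  by (auto simp: preordering_def distrib_right mult.assoc intro: quadratic_module_add quadratic_module_mult)

lemma quadratic_module_qmod: "quadratic_module (qmod G)"
  unfolding hull_def quadratic_module_def by (blast intro: add_left_mono)

lemma archimedean_ball:
  fixes M :: "'d::finite mpoly set"
  assumes M: "quadratic_module M" and arch: "archimedean M"
  obtains r where "r > 0" "Const (r^2) - (\<Sum>i\<in>UNIV. Var i ^ 2) \<in> M"
proof -
  have "\<exists>k. of_nat k - Var i ^ 2 \<in> M" for i
    using arch by (auto simp: archimedean_def)
  then obtain k where k: "\<And>i. of_nat (k i) - Var i ^ 2 \<in> M" by metis
  \<comment> \<open>The summand 1 makes \<open>R\<close> positive even if all \<open>k i\<close> are
    0, so that its square root can serve as a radius.\<close>
  define R where "R = real (\<Sum>i\<in>UNIV. k i) + 1"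
  have R: "R > 0" by (auto simp: R_def intro!: add_nonneg_pos sum_nonneg)
  have "(\<Sum>i\<in>UNIV. of_nat (k i) - Var i ^ 2) + 1 \<in> M"
    by (intro quadratic_module_add quadratic_module_sum quadratic_module_1 M k)
  also have "(\<Sum>i\<in>UNIV. of_nat (k i) - Var i ^ 2) + 1 = Const R - (\<Sum>i\<in>UNIV. Var i ^ 2)"
    by (simp add: R_def Const_add Const_sum sum_subtractf)
  finally show ?thesis
    using R by (intro that[of "sqrt R"]) auto
qed

text \<open>With \<open>u\<close> the ball constraint and \<open>S\<close> the multipliers of
  \<open>M\<close>, take T = S + S u. It is closed under products because u^2 is a square, and it
  lies in \<open>M\<close> because \<open>u\<close> does. The box constraints come from 2 r (r + s
  x_i) = (r + s x_i)^2 + (sum of x_j^2 over j distinct from i) + u, where s is 1 or -1.\<close>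

lemma preordering_of_ball:
  fixes M :: "'d::finite mpoly set"
  assumes M: "quadratic_module M" and r: "r > 0" and ball: "Const (r^2) - (\<Sum>i\<in>UNIV. Var i ^ 2) \<in> M"
  obtains T where "preordering T" "T \<subseteq> M" "\<And>i. Const r + Var i \<in> T" "\<And>i. Const r - Var i \<in> T"
proof -
  define S :: "'d mpoly set" where "S = {a. \<forall>m\<in>M. a * m \<in> M}"
  have S: "preordering S" unfolding S_def by (rule preordering_multipliers[OF M])
  define u :: "'d mpoly" where "u = Const (r^2) - (\<Sum>i\<in>UNIV. Var i ^ 2)"
  define T :: "'d mpoly set" where "T = {a + b * u | a b. a \<in> S \<and> b \<in> S}"
  have TI: "a + b * u \<in> T" if "a \<in> S" "b \<in> S" for a b
    using that by (auto simp: T_def)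
  have T: "preordering T"
    unfolding preordering_def
  proof (intro conjI ballI allI)
    fix x y assume "x \<in> T" "y \<in> T"
    then obtain a b a' b' where ab: "x = a + b * u" "y = a' + b' * u" "a \<in> S" "b \<in> S" "a' \<in> S" "b' \<in> S"
      by (auto simp: T_def)
    have "x + y = (a + a') + (b + b') * u" by (simp add: ab algebra_simps)
    also have "\<dots> \<in> T" by (intro TI preordering_add S ab)
    finally show "x + y \<in> T" .
    have "x * y = (a * a' + b * b' * u^2) + (a * b' + b * a') * u"
      by (simp add: ab power2_eq_square algebra_simps)
    also have "\<dots> \<in> T"
      by (intro TI preordering_add preordering_mult preordering_square S ab)
    finally show "x * y \<in> T" .
  next
    fix x show "x^2 \<in> T"
      using TI[of "x^2" 0] S by (simp add: preordering_square preordering_0)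
  qed
  have "T \<subseteq> M"
  proof
    fix x assume "x \<in> T"
    then obtain a b where ab: "x = a + b * u" "a \<in> S" "b \<in> S" by (auto simp: T_def)
    have "a * 1 \<in> M" "b * u \<in> M"
      using ab quadratic_module_1[OF M] ball by (auto simp: S_def u_def simp del: mult_1_right)
    then show "x \<in> M" using ab M by (simp add: quadratic_module_add)
  qed
  moreover have "Const r + Const s * Var i \<in> T" if s: "s = 1 \<or> s = -1" for s i
  proof -
    have s2: "Const s * Const s = (1 :: 'd mpoly)" using s by (auto simp flip: Const_mult)
    define L :: "'d mpoly" where "L = Const (1 / (2 * r))"
    have Lr: "L * Const r = Const (1/2)" using r by (simp add: L_def flip: Const_mult)
    have split: "(\<Sum>j\<in>UNIV. Var j ^ 2) = Var i ^ 2 + (\<Sum>j\<in>-{i}. Var j ^ 2 :: 'd mpoly)"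
      by (subst sum.remove[of UNIV i]) (auto simp: Compl_eq_Diff_UNIV)
    have "L * ((Const r + Const s * Var i)^2 + (\<Sum>j\<in>-{i}. Var j ^ 2)) + L * u =
        L * (Const r * (Const r + Const r) + Const s * Var i * (Const r + Const r))"
      unfolding u_def split unfolding power2_eq_square Const_mult using s2 by (simp add: algebra_simps)
    also have "\<dots> = (L * Const r + L * Const r) * Const r + (L * Const r + L * Const r) * (Const s * Var i)"
      by (simp add: algebra_simps)
    also have "L * Const r + L * Const r = 1"
      unfolding Lr by (simp flip: Const_add)
    finally have "Const r + Const s * Var i =
        L * ((Const r + Const s * Var i)^2 + (\<Sum>j\<in>-{i}. Var j ^ 2)) + L * u"
      by simp
    moreover have "L \<in> S" using r S by (simp add: L_def preordering_Const)
    moreover have "L * ((Const r + Const s * Var i)^2 + (\<Sum>j\<in>-{i}. Var j ^ 2)) \<in> S"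
      using S \<open>L \<in> S\<close> by (intro preordering_mult preordering_add preordering_sum preordering_square)
    ultimately show ?thesis using TI by metis
  qed
  from this[of 1] this[of "-1"] have "Const r + Var i \<in> T" "Const r - Var i \<in> T" for i
    by (simp_all add: single_uminus)
  ultimately show ?thesis using that T by blast
qed

section \<open>Removing the constraints away from the zeros\<close>

lemma near_1_power:
  assumes "(\<lambda>x. eval_at x a - 1) \<in> O[nhds p](\<lambda>x. rho p x ^ 2)"
  shows "(\<lambda>x. eval_at x (a ^ n) - 1) \<in> O[nhds p](\<lambda>x. rho p x ^ 2)"
proof (induction n)
  case (Suc n)
  then show ?case
    unfolding power_Suc by (rule near_1_mult[OF assms])
qed simp

lemma near_1_prod:
  assumes "\<And>i. i \<in> S \<Longrightarrow> (\<lambda>x. eval_at x (a i) - 1) \<in> O[nhds p](\<lambda>x. rho p x ^ 2)"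
  shows "(\<lambda>x. eval_at x (\<Prod>i\<in>S. a i) - 1) \<in> O[nhds p](\<lambda>x. rho p x ^ 2)"
  using assms
proof (induction S rule: infinite_finite_induct)
  case (insert i S)
  then show ?case
    unfolding prod.insert[OF insert.hyps] by (intro near_1_mult) auto
qed auto

lemma bigo_eval_mult:
  assumes "(\<lambda>x. eval_at x f) \<in> O[nhds p](\<lambda>x. rho p x ^ n)"
  shows "(\<lambda>x. eval_at x (f * g)) \<in> O[nhds p](\<lambda>x. rho p x ^ n)"
  using bigo_mult_bounded(1)[OF assms eval_bigo_1[of g]] by simp

text \<open>The polynomial \<open>a p'\<close> is 0 at \<open>p\<close> and 1 at \<open>p'\<close>.
  Hence 1 - a^2 differs from 1 by the square of something vanishing at \<open>p\<close>, while its
  factor 1 - a is a multiple of the squared distance from \<open>p'\<close>. The product over all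
  \<open>p'\<close> is flat at every point of \<open>P\<close>.\<close>

lemma flat_cutoff_exists:
  assumes "finite P"
  obtains E where "(\<lambda>x. eval_at x E - 1) \<in> O[nhds p](\<lambda>x. rho p x ^ 2)"
    "\<And>p'. p' \<in> P \<Longrightarrow> p' \<noteq> p \<Longrightarrow> (\<lambda>x. eval_at x E) \<in> O[nhds p'](\<lambda>x. rho p' x ^ 2)"
proof -
  define a where "a = (\<lambda>p'. 1 - Const (1 / (rho p' p)^2) * sq_dist_poly p')"
  define e where "e = (\<lambda>p'. 1 - a p' ^ 2)"
  define E where "E = (\<Prod>p'\<in>P - {p}. e p')"
  have "(\<lambda>x. eval_at x E - 1) \<in> O[nhds p](\<lambda>x. rho p x ^ 2)"
    unfolding E_def
  proof (rule near_1_prod)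
    fix p' assume "p' \<in> P - {p}"
    then have "eval_at p (a p') = 0" by (auto simp: a_def)
    then have "(\<lambda>x. eval_at x (a p')) \<in> O[nhds p](\<lambda>x. rho p x ^ 1)"
      by (rule eval_zero_bigo)
    from landau_o.big_power[OF this, where m = 2]
    show "(\<lambda>x. eval_at x (e p') - 1) \<in> O[nhds p](\<lambda>x. rho p x ^ 2)"
      by (simp add: e_def)
  qed
  moreover have "(\<lambda>x. eval_at x E) \<in> O[nhds p'](\<lambda>x. rho p' x ^ 2)" if p': "p' \<in> P" "p' \<noteq> p" for p'
  proof -
    have "E = e p' * (\<Prod>p'\<in>P - {p} - {p'}. e p')"
      unfolding E_def using assms p' by (intro prod.remove) auto
    also have "e p' = sq_dist_poly p' * (Const (1 / (rho p' p)^2) * (1 + a p'))"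
      by (simp add: e_def a_def power2_eq_square algebra_simps)
    finally have E_eq: "E = sq_dist_poly p' * (Const (1 / (rho p' p)^2) * (1 + a p') * (\<Prod>p'\<in>P - {p} - {p'}. e p'))"
      by (simp only: mult.assoc)
    show ?thesis
      unfolding E_eq by (rule bigo_eval_mult) simp
  qed
  ultimately show ?thesis using that by blast
qed

lemma growth_open:
  assumes "growth p h"
  obtains U where "open U" "p \<in> U" "\<And>x. x \<in> U \<Longrightarrow> x \<noteq> p \<Longrightarrow> eval_at x h > 0"
proof -
  obtain c where c: "c > 0" "\<forall>\<^sub>F x in nhds p. eval_at x h \<ge> c * (rho p x)^2"
    using assms by (auto simp: growth_def)
  then obtain U where U: "open U" "p \<in> U" "\<And>x. x \<in> U \<Longrightarrow> eval_at x h \<ge> c * (rho p x)^2"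
    by (auto simp: eventually_nhds)
  have "eval_at x h > 0" if "x \<in> U" "x \<noteq> p" for x
  proof -
    have "0 < c * (rho p x)^2" using c that by simp
    then show ?thesis using U(3)[OF that(1)] by linarith
  qed
  then show ?thesis using that U by blast
qed

text \<open>The local correction \<open>n\<close> at \<open>p\<close> is multiplied by the square of
  \<open>E * t ^ k\<close>. At \<open>p\<close> this changes \<open>n\<close> by O(rho^3), since
  \<open>n\<close> vanishes there; at the other zeros the product is O(rho^4). On \<open>K\<close>,
  \<open>t\<close> lies in [0, 1] and is bounded away from 1 off any neighbourhood of
  \<open>p\<close>, so a large \<open>k\<close> keeps the correction below \<open>f\<close> away
  from the zeros.\<close>

lemma full_growth_step:
  fixes M :: "'d::finite mpoly set"
  assumes M: "quadratic_module M" and K: "compact K" and MK: "\<And>m x. m \<in> M \<Longrightarrow> x \<in> K \<Longrightarrow> eval_at x m \<ge> 0"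
    and P: "finite P" and pos: "\<And>x. x \<in> K \<Longrightarrow> x \<notin> P \<Longrightarrow> eval_at x f > 0"
    and loc: "\<And>p. p \<in> P \<Longrightarrow> \<exists>m\<in>M. growth p (f - m) \<and> eval_at p m = 0"
    and p: "p \<in> P"
  obtains m where "m \<in> M" "\<And>x. x \<in> K \<Longrightarrow> x \<notin> P \<Longrightarrow> eval_at x (f - m) > 0"
    "growth p (f - m)" "eval_at p m = 0"
    "\<And>p'. p' \<in> P \<Longrightarrow> p' \<noteq> p \<Longrightarrow> (\<lambda>x. eval_at x m) \<in> O[nhds p'](\<lambda>x. rho p' x ^ 3)"
proof -
  obtain n where n: "n \<in> M" "growth p (f - n)" "eval_at p n = 0"
    using loc[OF p] by auto
  obtain E where E: "(\<lambda>x. eval_at x E - 1) \<in> O[nhds p](\<lambda>x. rho p x ^ 2)"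
    "\<And>p'. p' \<in> P \<Longrightarrow> p' \<noteq> p \<Longrightarrow> (\<lambda>x. eval_at x E) \<in> O[nhds p'](\<lambda>x. rho p' x ^ 2)"
    using flat_cutoff_exists[OF P] by blast
  obtain R where R: "R > 0" "\<And>x. x \<in> K \<Longrightarrow> \<bar>eval_at x (sq_dist_poly p)\<bar> \<le> R"
    using compact_upper_bound[OF K continuous_eval] by blast
  define t where "t = 1 - Const (1 / R) * sq_dist_poly p"
  define m where "m = (\<lambda>k. (E * t ^ k)^2 * n)"
  have mM: "m k \<in> M" for k
    unfolding m_def by (intro quadratic_module_mult M n)
  have t_near: "(\<lambda>x. eval_at x t - 1) \<in> O[nhds p](\<lambda>x. rho p x ^ 2)"
    using bigo_eval_mult[of "sq_dist_poly p" p 2 "Const (- 1 / R)"] by (simp add: t_def)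
  have gr_p: "growth p (f - m k)" for k
  proof -
    have "(\<lambda>x. eval_at x ((E * t ^ k)^2) - 1) \<in> O[nhds p](\<lambda>x. rho p x ^ 2)"
      by (intro near_1_power near_1_mult E(1) t_near)
    from bigo_rho_mult[OF this eval_zero_bigo[OF n(3)]]
    have "(\<lambda>x. eval_at x (((E * t ^ k)^2 - 1) * n)) \<in> O[nhds p](\<lambda>x. rho p x ^ 3)" by simp
    from growth_diff_bigo_3[OF n(2) this] show ?thesis
      by (simp add: m_def algebra_simps)
  qed
  have m_small: "(\<lambda>x. eval_at x (m k)) \<in> O[nhds p'](\<lambda>x. rho p' x ^ 3)" if "p' \<in> P" "p' \<noteq> p" for p' k
  proof -
    have "(\<lambda>x. eval_at x (E * E)) \<in> O[nhds p'](\<lambda>x. rho p' x ^ 4)"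
      using bigo_rho_mult[OF E(2)[OF that] E(2)[OF that]] by simp
    then have "(\<lambda>x. eval_at x (E * E)) \<in> O[nhds p'](\<lambda>x. rho p' x ^ 3)"
      by (rule bigo_rho_mono) simp
    from bigo_eval_mult[OF this, of "(t ^ k)^2 * n"] show ?thesis
      by (simp add: m_def power2_eq_square mult_ac)
  qed
  \<comment> \<open>The neighbourhoods are fixed for \<open>k = 0\<close>. As the correction
    decreases with \<open>k\<close> on \<open>K\<close>, they serve for every \<open>k\<close>,
    which can then be chosen last. Near a zero other than \<open>p\<close> the local correction at
    that zero is added back; it is nonnegative on \<open>K\<close>.\<close>
  have "\<exists>U. open U \<and> p' \<in> U \<and> (\<forall>x\<in>U. x \<in> K \<longrightarrow> x \<noteq> p' \<longrightarrow> eval_at x (f - m 0) > 0)" if p': "p' \<in> P" for p'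
  proof -
    have "\<exists>n'\<in>M. growth p' (f - m 0 - n')"
    proof (cases "p' = p")
      case True
      then show ?thesis using gr_p[of 0] quadratic_module_0[OF M] by (intro bexI[of _ 0]) auto
    next
      case False
      obtain n' where "n' \<in> M" "growth p' (f - n')" using loc[OF p'] by auto
      moreover have "f - m 0 - n' = f - n' - m 0" by (simp add: algebra_simps)
      ultimately show ?thesis
        using growth_diff_bigo_3[OF _ m_small[OF p' False, of 0], of "f - n'"]
        by (intro bexI[of _ n']) (simp_all only:)
    qed
    then obtain n' where n': "n' \<in> M" "growth p' (f - m 0 - n')" by auto
    obtain U where U: "open U" "p' \<in> U" "\<And>x. x \<in> U \<Longrightarrow> x \<noteq> p' \<Longrightarrow> eval_at x (f - m 0 - n') > 0"
      using growth_open[OF n'(2)] by blast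
    have "eval_at x (f - m 0) > 0" if "x \<in> U" "x \<in> K" "x \<noteq> p'" for x
      using U(3)[of x] MK[OF n'(1), of x] that by simp
    then show ?thesis using U by blast
  qed
  then obtain U where U: "\<And>p'. p' \<in> P \<Longrightarrow> open (U p')" "\<And>p'. p' \<in> P \<Longrightarrow> p' \<in> U p'"
    "\<And>p' x. p' \<in> P \<Longrightarrow> x \<in> U p' \<Longrightarrow> x \<in> K \<Longrightarrow> x \<noteq> p' \<Longrightarrow> eval_at x (f - m 0) > 0"
    by metis
  define K' where "K' = K - (\<Union>p'\<in>P. U p')"
  have K': "compact K'"
    unfolding K'_def using U(1) by (intro compact_diff K open_UN) auto
  have K'_sub: "K' \<subseteq> K" "\<And>x. x \<in> K' \<Longrightarrow> x \<notin> P"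
    using U(2) by (auto simp: K'_def)
  obtain \<eta> where \<eta>: "\<eta> > 0" "\<And>x. x \<in> K' \<Longrightarrow> \<eta> \<le> eval_at x f"
    using compact_pos_lower_bound[OF K' continuous_eval, of f] pos K'_sub by blast
  obtain b where b: "b > 0" "\<And>x. x \<in> K \<Longrightarrow> \<bar>eval_at x (m 0)\<bar> \<le> b"
    using compact_upper_bound[OF K continuous_eval] by blast
  have "0 < eval_at x (sq_dist_poly p)" if "x \<in> K'" for x
    using K'_sub(2)[OF that] p by auto
  then obtain \<delta> where \<delta>: "\<delta> > 0" "\<And>x. x \<in> K' \<Longrightarrow> \<delta> \<le> eval_at x (sq_dist_poly p)"
    using compact_pos_lower_bound[OF K' continuous_eval, of "sq_dist_poly p"] by blast
  \<comment> \<open>An upper bound for \<open>t\<close> on \<open>K'\<close>; the maximum with 0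
    keeps its powers monotone.\<close>
  define \<theta> where "\<theta> = max 0 (1 - \<delta> / R)"
  have \<theta>: "0 \<le> \<theta>" "\<theta> < 1" using \<delta> R by (auto simp: \<theta>_def)
  obtain k where k: "\<theta> ^ k < \<eta> / b"
    using real_arch_pow_inv[of "\<eta> / b" \<theta>] \<eta> b \<theta> by auto
  have t_range: "0 \<le> eval_at x t" "eval_at x t \<le> 1" if "x \<in> K" for x
    using R(2)[OF that] R(1) by (auto simp: t_def)
  have m_eval: "eval_at x (m k) = (eval_at x t ^ k)^2 * eval_at x (m 0)" for x
    by (simp add: m_def power_mult_distrib)
  have m0: "eval_at x (m 0) \<ge> 0" if "x \<in> K" for x
    using MK[OF mM that] .
  have "eval_at x (f - m k) > 0" if x: "x \<in> K" "x \<notin> P" for x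
  proof (cases "x \<in> K'")
    case True
    have "\<delta> / R \<le> (rho p x)^2 / R"
      using \<delta>(2)[OF True] R(1) by (intro divide_right_mono) auto
    then have "eval_at x t \<le> \<theta>"
      by (simp add: t_def \<theta>_def)
    then have "eval_at x t ^ k \<le> \<theta> ^ k" using t_range[OF x(1)] by (intro power_mono)
    moreover have "(eval_at x t ^ k)^2 \<le> eval_at x t ^ k"
      using t_range[OF x(1)] by (simp add: power2_eq_square mult_left_le power_le_one)
    ultimately have "(eval_at x t ^ k)^2 \<le> \<theta> ^ k" by linarith
    then have "eval_at x (m k) \<le> \<theta> ^ k * b"
      unfolding m_eval using b(2)[OF x(1)] m0[OF x(1)] \<theta> by (intro mult_mono) auto
    also have "\<dots> < \<eta>" using k b by (simp add: field_simps)
    finally show ?thesis using \<eta>(2)[OF True] by simp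
  next
    case False
    then obtain p' where p': "p' \<in> P" "x \<in> U p'" using x by (auto simp: K'_def)
    then have "eval_at x (f - m 0) > 0" using U(3)[OF p' x(1)] x by auto
    moreover have "(eval_at x t ^ k)^2 \<le> 1"
      using t_range[OF x(1)] by (intro power_le_one) auto
    then have "eval_at x (m k) \<le> 1 * eval_at x (m 0)"
      unfolding m_eval using m0[OF x(1)] by (intro mult_right_mono)
    ultimately show ?thesis by simp
  qed
  moreover have "eval_at p (m k) = 0" using n(3) by (simp add: m_def)
  ultimately show ?thesis
    using that[of "m k"] mM gr_p m_small by blast
qed

text \<open>The zeros are treated one at a time. The induction also carries the local hypothesis for
  f - m, so that the step applies again; growth already achieved survives because later corrections
  are O(rho^3) at the earlier zeros.\<close>

lemma full_growth_all:
  fixes M :: "'d::finite mpoly set"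
  assumes M: "quadratic_module M" and K: "compact K" and MK: "\<And>m x. m \<in> M \<Longrightarrow> x \<in> K \<Longrightarrow> eval_at x m \<ge> 0"
    and P: "finite P" and pos: "\<And>x. x \<in> K \<Longrightarrow> x \<notin> P \<Longrightarrow> eval_at x f > 0"
    and loc: "\<And>p. p \<in> P \<Longrightarrow> \<exists>m\<in>M. growth p (f - m) \<and> eval_at p m = 0"
  obtains m where "m \<in> M" "\<And>x. x \<in> K \<Longrightarrow> x \<notin> P \<Longrightarrow> eval_at x (f - m) > 0"
    "\<And>p. p \<in> P \<Longrightarrow> growth p (f - m)" "\<And>p. p \<in> P \<Longrightarrow> eval_at p m = 0"
proof -
  have "\<exists>m\<in>M. (\<forall>x\<in>K - P. eval_at x (f - m) > 0) \<and> (\<forall>p\<in>Q. growth p (f - m)) \<and>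
      (\<forall>p\<in>P. eval_at p m = 0) \<and> (\<forall>p\<in>P. \<exists>m'\<in>M. growth p (f - m - m') \<and> eval_at p m' = 0)"
    if "finite Q" "Q \<subseteq> P" for Q
    using that
  proof (induction Q rule: finite_induct)
    case empty
    then show ?case
      using pos loc by (intro bexI[of _ 0] quadratic_module_0[OF M]) auto
  next
    case (insert p Q)
    then obtain m where m: "m \<in> M" "\<And>x. x \<in> K \<Longrightarrow> x \<notin> P \<Longrightarrow> eval_at x (f - m) > 0"
      "\<And>p. p \<in> Q \<Longrightarrow> growth p (f - m)" "\<And>p. p \<in> P \<Longrightarrow> eval_at p m = 0"
      "\<And>p. p \<in> P \<Longrightarrow> \<exists>m'\<in>M. growth p (f - m - m') \<and> eval_at p m' = 0"
      by auto
    have p: "p \<in> P" using insert.prems by simp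
    obtain n where n: "n \<in> M" "\<And>x. x \<in> K \<Longrightarrow> x \<notin> P \<Longrightarrow> eval_at x (f - m - n) > 0"
      "growth p (f - m - n)" "eval_at p n = 0"
      "\<And>p'. p' \<in> P \<Longrightarrow> p' \<noteq> p \<Longrightarrow> (\<lambda>x. eval_at x n) \<in> O[nhds p'](\<lambda>x. rho p' x ^ 3)"
      using full_growth_step[OF M K MK P m(2) m(5) p] by blast
    have n0: "eval_at p' n = 0" if "p' \<in> P" for p'
      using n(4) eval_at_0_of_bigo[OF n(5)[OF that]] by (cases "p' = p") auto
    have assoc: "f - (m + n) = f - m - n" by simp
    show ?case
    proof (rule bexI[OF _ quadratic_module_add[OF M m(1) n(1)]], intro conjI ballI)
      fix x assume "x \<in> K - P"
      then show "eval_at x (f - (m + n)) > 0" using n(2)[of x] unfolding assoc by blast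
    next
      fix p' assume p': "p' \<in> insert p Q"
      show "growth p' (f - (m + n))"
      proof (cases "p' = p")
        case False
        then show ?thesis
          unfolding assoc using p' insert.prems by (intro growth_diff_bigo_3 m(3) n(5)) auto
      next
        case True
        show ?thesis unfolding assoc True by (rule n(3))
      qed
    next
      fix p' assume "p' \<in> P"
      then show "eval_at p' (m + n) = 0" using m(4) n0 by simp
    next
      fix p' assume p': "p' \<in> P"
      show "\<exists>m'\<in>M. growth p' (f - (m + n) - m') \<and> eval_at p' m' = 0"
      proof (cases "p' = p")
        case True
        then show ?thesis using n(3) by (intro bexI[of _ 0] quadratic_module_0[OF M]) (auto simp: assoc)
      next
        case False
        obtain m' where m': "m' \<in> M" "growth p' (f - m - m')" "eval_at p' m' = 0"
          using m(5)[OF p'] by auto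
        have "f - (m + n) - m' = f - m - m' - n" by (simp add: algebra_simps)
        then show ?thesis
          using growth_diff_bigo_3[OF m'(2) n(5)[OF p' False]] m' by (intro bexI[of _ m']) (simp_all only:)
      qed
    qed
  qed
  from this[OF P order_refl] show ?thesis using that by blast
qed

section \<open>Penalty terms that replace the constraints by positivity on the box\<close>

lemma damped_linear_bound:
  fixes y :: real
  assumes "y \<le> 1" "n > 0" "even n"
  shows "(1 - y) ^ n * y \<le> - max 0 (- y) + 1 / n"
proof (cases "y \<ge> 0")
  case True
  \<comment> \<open>Bernoulli's inequality bounds n y by (1 + y)^n, and (1 - y)(1 + y) is at most 1.
    For negative \<open>y\<close> the power is at least 1 and only makes the product more
    negative.\<close>
  have "(1 - y) ^ n * (real n * y) \<le> (1 - y) ^ n * (1 + y) ^ n"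
    using Bernoulli_inequality[of y n] True assms by (intro mult_left_mono) auto
  also have "\<dots> = (1 - y^2) ^ n"
    by (simp add: power_mult_distrib[symmetric] power2_eq_square algebra_simps)
  also have "\<dots> \<le> 1"
    using True assms by (intro power_le_one) (auto simp: power_le_one)
  finally have "(1 - y) ^ n * y \<le> 1 / n"
    using assms by (simp add: field_simps)
  then show ?thesis using True by simp
next
  case False
  have "1 \<le> (1 - y) ^ n" using False by (intro one_le_power) auto
  then have "(1 - y) ^ n * y \<le> 1 * y" using False by (intro mult_right_mono_neg) auto
  then show ?thesis using False by (simp add: add_increasing2)
qed

text \<open>The terms (1 - g/b)^(2k) g of \<open>m\<close> lie below minus the negative part of
  \<open>g\<close>, up to O(1/k), so subtracting them lifts \<open>h\<close> where a constraint is
  violated and costs little elsewhere. The weight E^2 is O(rho^4) at the zeros, so growth there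
  survives; it also scales the O(1/k) loss, which remains comparable to \<open>h\<close> near
  \<open>P\<close>.\<close>

lemma remove_constraints:
  fixes M :: "'d::finite mpoly set"
  assumes M: "quadratic_module M" and G: "G \<subseteq> M" and B: "compact B" and P: "finite P"
    and pos: "\<And>x. x \<in> B \<Longrightarrow> x \<in> pos_set G \<Longrightarrow> x \<notin> P \<Longrightarrow> eval_at x h > 0"
    and gr: "\<And>p. p \<in> P \<Longrightarrow> growth p h"
  obtains m where "m \<in> M" "\<And>x. x \<in> B \<Longrightarrow> x \<notin> P \<Longrightarrow> eval_at x (h - m) > 0"
    "\<And>p. p \<in> P \<Longrightarrow> growth p (h - m)" "\<And>p. p \<in> P \<Longrightarrow> eval_at p m = 0"
proof -
  define E where "E = (\<Prod>p\<in>P. sq_dist_poly p)"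
  have E_zero: "eval_at x E = 0 \<longleftrightarrow> x \<in> P" for x
    using P by (auto simp: E_def)
  have E_bigo: "(\<lambda>x. eval_at x (E^2)) \<in> O[nhds p](\<lambda>x. rho p x ^ 3)" if p: "p \<in> P" for p
  proof -
    have "E = sq_dist_poly p * (\<Prod>p\<in>P - {p}. sq_dist_poly p)"
      unfolding E_def by (rule prod.remove[OF P p])
    moreover have "(\<lambda>x. eval_at x (sq_dist_poly p)) \<in> O[nhds p](\<lambda>x. rho p x ^ 2)"
      by simp
    ultimately have "(\<lambda>x. eval_at x E) \<in> O[nhds p](\<lambda>x. rho p x ^ 2)"
      by (simp only: bigo_eval_mult)
    from bigo_rho_mult[OF this this] have "(\<lambda>x. eval_at x (E^2)) \<in> O[nhds p](\<lambda>x. rho p x ^ 4)"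
      by (simp add: power2_eq_square)
    then show ?thesis by (rule bigo_rho_mono) simp
  qed
  have "\<exists>U. open U \<and> p \<in> U \<and> (\<forall>x\<in>U. eval_at x h \<ge> eval_at x (E^2))" if p: "p \<in> P" for p
  proof -
    obtain c where c: "c > 0" "\<forall>\<^sub>F x in nhds p. eval_at x h \<ge> c * (rho p x)^2"
      using gr[OF p] by (auto simp: growth_def)
    have "\<forall>\<^sub>F x in nhds p. \<bar>eval_at x (E^2)\<bar> \<le> c * (rho p x)^2"
      by (rule bigo_3_small[OF E_bigo[OF p] c(1)])
    with c(2) have "\<forall>\<^sub>F x in nhds p. eval_at x h \<ge> eval_at x (E^2)"
      by eventually_elim linarith
    then show ?thesis by (auto simp: eventually_nhds)
  qed
  then obtain U where U: "\<And>p. p \<in> P \<Longrightarrow> open (U p)" "\<And>p. p \<in> P \<Longrightarrow> p \<in> U p"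
    "\<And>p x. p \<in> P \<Longrightarrow> x \<in> U p \<Longrightarrow> eval_at x h \<ge> eval_at x (E^2)"
    by metis
  define A where "A = B - (\<Union>p\<in>P. U p)"
  have A: "compact A"
    unfolding A_def using U(1) by (intro compact_diff B open_UN) auto
  have A_sub: "A \<subseteq> B" "\<And>x. x \<in> A \<Longrightarrow> x \<notin> P"
    using U(2) by (auto simp: A_def)
  define Z where "Z = {x\<in>A. eval_at x h \<le> 0}"
  have Z: "compact Z"
    unfolding Z_def by (rule compact_Int_closed_cond[OF A continuous_eval])
  have neg_open: "open {x. eval_at x g < 0}" for g :: "'d mpoly"
    by (intro open_Collect_less continuous_eval continuous_on_const)
  have Z_cover: "Z \<subseteq> (\<Union>g\<in>G. {x. eval_at x g < 0})"
  proof
    fix x assume "x \<in> Z"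
    then have "x \<in> B" "x \<notin> P" "\<not> eval_at x h > 0"
      using A_sub by (auto simp: Z_def)
    then have "x \<notin> pos_set G" using pos by blast
    then show "x \<in> (\<Union>g\<in>G. {x. eval_at x g < 0})" by (auto simp: pos_set_def not_le)
  qed
  \<comment> \<open>Where \<open>h\<close> is not positive away from \<open>P\<close>, some
    constraint is strictly violated; compactness leaves finitely many constraints to
    penalize.\<close>
  obtain G0 where G0: "G0 \<subseteq> G" "finite G0" "Z \<subseteq> (\<Union>g\<in>G0. {x. eval_at x g < 0})"
    by (rule compactE_image[OF Z neg_open Z_cover])
  define \<psi> where "\<psi> = (\<lambda>x. \<Sum>g\<in>G0. max 0 (- eval_at x g))"
  have \<psi>_nonneg: "\<psi> x \<ge> 0" for x
    by (auto simp: \<psi>_def intro: sum_nonneg)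
  have "continuous_on UNIV (\<lambda>x. eval_at x (E^2) * \<psi> x)"
    unfolding \<psi>_def by (intro continuous_intros)
  moreover have "eval_at x (E^2) * \<psi> x \<ge> 0" if "x \<in> A" for x
    using \<psi>_nonneg by simp
  moreover have "eval_at x h > 0" if x: "x \<in> A" "eval_at x (E^2) * \<psi> x = 0" for x
  proof (rule ccontr)
    assume "\<not> eval_at x h > 0"
    then have "x \<in> Z" using x by (auto simp: Z_def)
    then obtain g where g: "g \<in> G0" "eval_at x g < 0" using G0 by auto
    then have "0 < \<psi> x"
      unfolding \<psi>_def using G0(2) by (intro sum_pos2[OF _ g(1)]) auto
    moreover have "eval_at x E \<noteq> 0" using E_zero A_sub(2)[OF x(1)] by simp
    ultimately show False using x(2) by simp
  qed
  ultimately obtain \<kappa> \<delta> where \<kappa>: "\<kappa> > 0" and \<delta>: "\<delta> > 0"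
    "\<And>x. x \<in> A \<Longrightarrow> eval_at x h + \<kappa> * (eval_at x (E^2) * \<psi> x) \<ge> \<delta>"
    using compact_positive_multiple[OF A continuous_eval, of "\<lambda>x. eval_at x (E^2) * \<psi> x" h] by blast
  obtain b where b: "b > 0" "\<And>x. x \<in> B \<Longrightarrow> \<bar>eval_at x (E^2)\<bar> \<le> b"
    using compact_upper_bound[OF B continuous_eval] by blast
  \<comment> \<open>Near \<open>P\<close> the polynomial \<open>h\<close> dominates E^2, which
    accounts for the 1; on \<open>A\<close> the lower bound \<open>\<delta>\<close> is compared with
    the maximum \<open>b\<close> of E^2.\<close>
  define \<epsilon> where "\<epsilon> = min 1 (\<delta> / b)"
  have \<epsilon>: "\<epsilon> > 0" using \<delta> b by (simp add: \<epsilon>_def)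
  have lower: "eval_at x h + \<kappa> * (eval_at x (E^2) * \<psi> x) \<ge> \<epsilon> * eval_at x (E^2)" if x: "x \<in> B" for x
  proof (cases "x \<in> A")
    case True
    have "\<epsilon> * eval_at x (E^2) \<le> (\<delta> / b) * b"
      using b(2)[OF x] b(1) \<delta>(1) by (intro mult_mono) (auto simp: \<epsilon>_def)
    then show ?thesis using \<delta>(2)[OF True] b(1) by simp
  next
    case False
    then obtain p where "p \<in> P" "x \<in> U p" using x by (auto simp: A_def)
    then have "eval_at x h \<ge> eval_at x (E^2)" by (rule U(3))
    moreover have "\<epsilon> * eval_at x (E^2) \<le> 1 * eval_at x (E^2)"
      by (intro mult_right_mono) (auto simp: \<epsilon>_def)
    moreover have "\<kappa> * (eval_at x (E^2) * \<psi> x) \<ge> 0"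
      using \<kappa> \<psi>_nonneg by simp
    ultimately show ?thesis by linarith
  qed
  have "\<exists>\<beta>>0. \<forall>x\<in>B. \<bar>eval_at x g\<bar> \<le> \<beta>" for g
    using compact_upper_bound[OF B continuous_eval, of g] by metis
  then obtain \<beta> where \<beta>: "\<And>g. \<beta> g > 0" "\<And>g x. x \<in> B \<Longrightarrow> \<bar>eval_at x g\<bar> \<le> \<beta> g"
    by metis
  define S where "S = (\<Sum>g\<in>G0. \<beta> g)"
  have S: "S \<ge> 0" unfolding S_def by (intro sum_nonneg) (use \<beta>(1) in \<open>auto intro: less_imp_le\<close>)
  \<comment> \<open>The total loss is E^2 times \<open>\<kappa> * S / k\<close>; this choice puts it
    strictly below the margin E^2 times \<open>\<epsilon>\<close>.\<close>
  obtain k :: nat where k: "real k > \<kappa> * S / \<epsilon>" using reals_Archimedean2 by blast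
  have k0: "k > 0"
  proof -
    have "\<kappa> * S / \<epsilon> \<ge> 0" using \<kappa> S \<epsilon> by simp
    then have "real k > 0" using k by linarith
    then show ?thesis by simp
  qed
  define m where "m = (\<Sum>g\<in>G0. (Const (sqrt \<kappa>) * E * (1 - Const (1 / \<beta> g) * g) ^ k)^2 * g)"
  have mM: "m \<in> M"
    unfolding m_def using G0 G by (intro quadratic_module_sum quadratic_module_mult M) auto
  have m_eval: "eval_at x m = \<kappa> * eval_at x (E^2) *
      (\<Sum>g\<in>G0. (1 - eval_at x g / \<beta> g) ^ (2 * k) * eval_at x g)" for x
    using \<kappa> by (simp add: m_def power_mult_distrib sum_distrib_left power_mult[symmetric] mult_ac)
  have "eval_at x (h - m) > 0" if x: "x \<in> B" "x \<notin> P" for x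
  proof -
    have E_pos: "eval_at x (E^2) > 0" using E_zero[of x] x by simp
    have "(\<Sum>g\<in>G0. (1 - eval_at x g / \<beta> g) ^ (2 * k) * eval_at x g) \<le>
        (\<Sum>g\<in>G0. - max 0 (- eval_at x g) + \<beta> g / k)"
    proof (rule sum_mono)
      fix g
      define y where "y = eval_at x g / \<beta> g"
      have g_eq: "eval_at x g = \<beta> g * y" using \<beta>(1)[of g] by (simp add: y_def)
      have "y \<le> 1" using \<beta>(1)[of g] \<beta>(2)[OF x(1), of g] by (simp add: y_def)
      then have "(1 - y) ^ (2 * k) * y \<le> - max 0 (- y) + 1 / (2 * k)"
        using damped_linear_bound[of y "2 * k"] k0 by simp
      also have "\<dots> \<le> - max 0 (- y) + 1 / k"
        using k0 by (simp add: field_simps)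
      finally have "\<beta> g * ((1 - y) ^ (2 * k) * y) \<le> \<beta> g * (- max 0 (- y) + 1 / k)"
        using \<beta>(1)[of g] by (intro mult_left_mono) auto
      also have "\<dots> = - max 0 (- eval_at x g) + \<beta> g / k"
        using \<beta>(1)[of g] unfolding g_eq by (auto simp: max_def algebra_simps mult_le_0_iff zero_le_mult_iff)
      finally show "(1 - eval_at x g / \<beta> g) ^ (2 * k) * eval_at x g \<le> - max 0 (- eval_at x g) + \<beta> g / k"
        using \<beta>(1)[of g] by (simp add: g_eq mult_ac)
    qed
    also have "\<dots> = - \<psi> x + S / k"
      by (simp add: sum_subtractf \<psi>_def S_def sum_divide_distrib)
    finally have "eval_at x m \<le> \<kappa> * eval_at x (E^2) * (- \<psi> x + S / k)"
      unfolding m_eval using \<kappa> E_pos by (intro mult_left_mono) auto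
    also have "\<dots> = eval_at x (E^2) * (\<kappa> * S / k) - \<kappa> * (eval_at x (E^2) * \<psi> x)"
      by (simp add: algebra_simps)
    finally have 1: "eval_at x m \<le> eval_at x (E^2) * (\<kappa> * S / k) - \<kappa> * (eval_at x (E^2) * \<psi> x)" .
    have "\<kappa> * S / k < \<epsilon>" using k k0 \<epsilon> by (simp add: field_simps)
    then have "eval_at x (E^2) * (\<kappa> * S / k) < eval_at x (E^2) * \<epsilon>"
      using E_pos by (rule mult_strict_left_mono)
    moreover have "eval_at x (E^2) * \<epsilon> = \<epsilon> * eval_at x (E^2)" by (rule mult.commute)
    ultimately have "eval_at x m < eval_at x h"
      using 1 lower[OF x(1)] by linarith
    then show ?thesis by simp
  qed
  moreover have m_bigo: "(\<lambda>x. eval_at x m) \<in> O[nhds p](\<lambda>x. rho p x ^ 3)" if "p \<in> P" for p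
  proof -
    have "m = E^2 * (\<Sum>g\<in>G0. (Const (sqrt \<kappa>) * (1 - Const (1 / \<beta> g) * g) ^ k)^2 * g)"
      by (simp add: m_def power_mult_distrib sum_distrib_left mult_ac)
    then show ?thesis by (simp only: bigo_eval_mult[OF E_bigo[OF that]])
  qed
  moreover have "growth p (h - m)" if "p \<in> P" for p
    by (rule growth_diff_bigo_3[OF gr[OF that] m_bigo[OF that]])
  moreover have "eval_at p m = 0" if "p \<in> P" for p
    using eval_at_0_of_bigo[OF m_bigo[OF that]] by simp
  ultimately show ?thesis using that mM by blast
qed

section \<open>A local-global criterion for membership\<close>

lemma qmod_nonneg:
  assumes "m \<in> qmod G" "x \<in> pos_set G"
  shows "eval_at x m \<ge> 0"
proof -
  have "quadratic_module {m. eval_at x m \<ge> 0}"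
    by (auto simp: quadratic_module_def)
  moreover have "G \<subseteq> {m. eval_at x m \<ge> 0}"
    using assms(2) by (auto simp: pos_set_def)
  ultimately have "qmod G \<subseteq> {m. eval_at x m \<ge> 0}"
    by (intro hull_minimal)
  then show ?thesis using assms(1) by blast
qed

theorem nonneg_in_archimedean_quadratic_module:
  fixes G :: "'d::finite mpoly set"
  assumes arch: "archimedean (qmod G)"
    and nonneg: "\<And>x. x \<in> pos_set G \<Longrightarrow> eval_at x f \<ge> 0"
    and loc: "\<And>p. p \<in> pos_set G \<Longrightarrow> eval_at p f = 0 \<Longrightarrow>
      \<exists>m\<in>qmod G. growth p (f - m) \<and> eval_at p m = 0"
  shows "f \<in> qmod G"
proof -
  let ?M = "qmod G" and ?K = "pos_set G"
  have M: "quadratic_module ?M" by (rule quadratic_module_qmod)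
  obtain r where r: "r > 0" and ball: "Const (r^2) - (\<Sum>i\<in>UNIV. Var i ^ 2) \<in> ?M"
    using archimedean_ball[OF M arch] by blast
  obtain T where T: "preordering T" "T \<subseteq> ?M" "\<And>i. Const r + Var i \<in> T" "\<And>i. Const r - Var i \<in> T"
    using preordering_of_ball[OF M r ball] by blast
  define B where "B = {x :: 'd \<Rightarrow> real. \<forall>i. - r \<le> x i \<and> x i \<le> r}"
  have B: "compact B" unfolding B_def by (rule compact_box)
  have KB: "?K \<subseteq> B"
  proof
    fix x assume x: "x \<in> ?K"
    have "- r \<le> x i \<and> x i \<le> r" for i
      using qmod_nonneg[OF subsetD[OF T(2) T(3)] x, of i] qmod_nonneg[OF subsetD[OF T(2) T(4)] x, of i]
      by simp
    then show "x \<in> B" by (simp add: B_def)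
  qed
  have "closed ?K"
  proof -
    have "?K = (\<Inter>g\<in>G. {x. 0 \<le> eval_at x g})" by (auto simp: pos_set_def)
    then show ?thesis by (auto intro!: closed_INT closed_Collect_le continuous_intros)
  qed
  then have K: "compact ?K"
    using compact_Int_closed[OF B, of ?K] unfolding Int_absorb1[OF KB] by blast
  define P where "P = {p\<in>?K. eval_at p f = 0}"
  have "compact {x\<in>?K. eval_at x f \<le> 0}"
    by (rule compact_Int_closed_cond[OF K continuous_eval])
  moreover have "{x\<in>?K. eval_at x f \<le> 0} = P"
    using nonneg by (force simp: P_def)
  ultimately have P_compact: "compact P" by simp
  \<comment> \<open>Near \<open>p\<close> the difference f - m is positive except at
    \<open>p\<close>, and \<open>m\<close> is nonnegative on \<open>K\<close>; so \<open>f\<close>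
    has no other zero in \<open>K\<close> there. A compact set of isolated points is finite.\<close>
  have "\<exists>U. open U \<and> p \<in> U \<and> U \<inter> P \<subseteq> {p}" if p: "p \<in> P" for p
  proof -
    obtain m where m: "m \<in> ?M" "growth p (f - m)" using loc[of p] p by (auto simp: P_def)
    obtain U where U: "open U" "p \<in> U" "\<And>x. x \<in> U \<Longrightarrow> x \<noteq> p \<Longrightarrow> eval_at x (f - m) > 0"
      using growth_open[OF m(2)] by blast
    have "x = p" if x: "x \<in> U" "x \<in> P" for x
    proof (rule ccontr)
      assume "x \<noteq> p"
      then show False using U(3)[OF x(1)] qmod_nonneg[OF m(1), of x] x(2) by (auto simp: P_def)
    qed
    then show ?thesis using U by blast
  qed
  then obtain U where U: "\<And>p. p \<in> P \<Longrightarrow> open (U p)" "\<And>p. p \<in> P \<Longrightarrow> p \<in> U p"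
    "\<And>p. p \<in> P \<Longrightarrow> U p \<inter> P \<subseteq> {p}" by metis
  have "P \<subseteq> (\<Union>p\<in>P. U p)" using U(2) by auto
  then obtain P0 where P0: "P0 \<subseteq> P" "finite P0" "P \<subseteq> (\<Union>p\<in>P0. U p)"
    using compactE_image[OF P_compact, of P U] U(1) by blast
  have "P \<subseteq> P0"
  proof
    fix x assume x: "x \<in> P"
    then obtain p where "p \<in> P0" "x \<in> U p" using P0 by auto
    then show "x \<in> P0" using U(3)[of p] P0(1) x by blast
  qed
  then have P: "finite P" using P0 finite_subset by blast
  have m_nonneg: "eval_at x m \<ge> 0" if "m \<in> ?M" "x \<in> ?K" for m x
    by (rule qmod_nonneg[OF that])
  have f_pos: "eval_at x f > 0" if "x \<in> ?K" "x \<notin> P" for x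
    using nonneg[of x] that by (force simp: P_def)
  have f_loc: "\<exists>m\<in>?M. growth p (f - m) \<and> eval_at p m = 0" if "p \<in> P" for p
    using loc that by (auto simp: P_def)
  obtain m1 where m1: "m1 \<in> ?M" "\<And>x. x \<in> ?K \<Longrightarrow> x \<notin> P \<Longrightarrow> eval_at x (f - m1) > 0"
    "\<And>p. p \<in> P \<Longrightarrow> growth p (f - m1)" "\<And>p. p \<in> P \<Longrightarrow> eval_at p m1 = 0"
    using full_growth_all[OF M K m_nonneg P f_pos f_loc] by blast
  have "G \<subseteq> ?M" by (rule hull_subset)
  then obtain m2 where m2: "m2 \<in> ?M" "\<And>x. x \<in> B \<Longrightarrow> x \<notin> P \<Longrightarrow> eval_at x (f - m1 - m2) > 0"
    "\<And>p. p \<in> P \<Longrightarrow> growth p (f - m1 - m2)" "\<And>p. p \<in> P \<Longrightarrow> eval_at p m2 = 0"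
    using remove_constraints[OF M _ B P m1(2) m1(3)] by blast
  have "f - m1 - m2 \<in> T"
  proof (rule positive_with_zeros_in_preordering[OF T(1) r T(3,4) P])
    fix p assume p: "p \<in> P"
    then show "eval_at p (f - m1 - m2) = 0"
      using m1(4)[OF p] m2(4)[OF p] by (simp add: P_def)
    show "growth p (f - m1 - m2)" by (rule m2(3)[OF p])
  next
    fix x :: "'d \<Rightarrow> real" assume x: "\<forall>i. \<bar>x i\<bar> \<le> r" "x \<notin> P"
    have "- r \<le> x i \<and> x i \<le> r" for i
      using x(1)[rule_format, of i] by linarith
    then have "x \<in> B" by (simp add: B_def)
    then show "eval_at x (f - m1 - m2) > 0" using m2(2) x by blast
  qed
  then have "(f - m1 - m2) + m1 + m2 \<in> ?M"
    using T(2) by (intro quadratic_module_add M m1(1) m2(1)) auto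
  then show ?thesis by simp
qed

section \<open>Expansions in the completed local ring\<close>

text \<open>The rational functions regular at \<open>p\<close> that are \<open>O(\<omega>)\<close> near \<open>p\<close>; for \<open>\<omega> = \<rho>\<^sup>N\<close> this ideal
  contains the \<open>N\<close>-th power of the maximal ideal.\<close>

definition bigo_ideal ::
    "('d::{finite,linorder} \<Rightarrow> real) \<Rightarrow> (('d \<Rightarrow> real) \<Rightarrow> real) \<Rightarrow> 'd mpoly fract set" where
  "bigo_ideal p \<omega> = {Fract a b | a b. eval_at p b \<noteq> 0 \<and> (\<lambda>x. eval_at x a) \<in> O[nhds p](\<omega>)}"

abbreviation vanish_order :: "('d::{finite,linorder} \<Rightarrow> real) \<Rightarrow> nat \<Rightarrow> 'd mpoly fract set" where
  "vanish_order p N \<equiv> bigo_ideal p (\<lambda>x. rho p x ^ N)"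

lemma bigo_idealI:
  "eval_at p b \<noteq> 0 \<Longrightarrow> (\<lambda>x. eval_at x a) \<in> O[nhds p](\<omega>) \<Longrightarrow> Fract a b \<in> bigo_ideal p \<omega>"
  by (auto simp: bigo_ideal_def)

lemma bigo_idealE:
  assumes "z \<in> bigo_ideal p \<omega>"
  obtains a b where "z = Fract a b" "eval_at p b \<noteq> 0" "(\<lambda>x. eval_at x a) \<in> O[nhds p](\<omega>)"
  using assms by (auto simp: bigo_ideal_def)

lemma eval_nonzero_imp: "eval_at p b \<noteq> 0 \<Longrightarrow> b \<noteq> 0"
  by auto

text \<open>The order does not depend on the chosen fraction: numerators of two representations
  differ by factors that are bounded near \<open>p\<close>, because the denominators do not vanish
  at \<open>p\<close>.\<close>

lemma bigo_ideal_numerator: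
  fixes p :: "'d::{finite,linorder} \<Rightarrow> real"
  assumes "Fract a b \<in> bigo_ideal p \<omega>" "eval_at p b \<noteq> 0"
  shows "(\<lambda>x. eval_at x a) \<in> O[nhds p](\<omega>)"
proof -
  obtain a' b' where ab: "Fract a b = Fract a' b'" "eval_at p b' \<noteq> 0" "(\<lambda>x. eval_at x a') \<in> O[nhds p](\<omega>)"
    using assms(1) by (rule bigo_idealE)
  have eq: "a * b' = a' * b"
    using ab(1) eq_fract(1)[OF eval_nonzero_imp[OF assms(2)] eval_nonzero_imp[OF ab(2)]] by blast
  have "(\<lambda>x. inverse (eval_at x b')) \<in> O[nhds p](\<lambda>_. 1)"
    by (rule tendsto_bigo_1[OF tendsto_inverse[OF eval_tendsto ab(2)]])
  then have "(\<lambda>x. (eval_at x a' * eval_at x b) * inverse (eval_at x b')) \<in> O[nhds p](\<omega>)"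
    by (intro bigo_mult_bounded eval_bigo_1 ab(3))
  moreover have "\<forall>\<^sub>F x in nhds p. eval_at x b' \<noteq> 0"
    by (rule tendsto_imp_eventually_ne[OF eval_tendsto ab(2)])
  then have "\<forall>\<^sub>F x in nhds p. (eval_at x a' * eval_at x b) * inverse (eval_at x b') = eval_at x a"
  proof eventually_elim
    case (elim x)
    have "eval_at x a * eval_at x b' = eval_at x a' * eval_at x b"
      using eq by (metis eval_mult)
    then show ?case using elim by (simp add: field_simps)
  qed
  ultimately show ?thesis
    by (rule iffD1[OF landau_o.big.in_cong, rotated])
qed

lemma to_fract_bigo_ideal_iff:
  "to_fract a \<in> bigo_ideal p \<omega> \<longleftrightarrow> (\<lambda>x. eval_at x a) \<in> O[nhds p](\<omega>)"
  using bigo_ideal_numerator[of a 1 p \<omega>] bigo_idealI[of p 1 a \<omega>] by (auto simp: to_fract_def)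

lemma bigo_ideal_add:
  assumes "z \<in> bigo_ideal p \<omega>" "w \<in> bigo_ideal p \<omega>"
  shows "z + w \<in> bigo_ideal p \<omega>"
proof -
  obtain a b where ab: "z = Fract a b" "eval_at p b \<noteq> 0" "(\<lambda>x. eval_at x a) \<in> O[nhds p](\<omega>)"
    using assms(1) by (rule bigo_idealE)
  obtain c d where cd: "w = Fract c d" "eval_at p d \<noteq> 0" "(\<lambda>x. eval_at x c) \<in> O[nhds p](\<omega>)"
    using assms(2) by (rule bigo_idealE)
  have "(\<lambda>x. eval_at x (a * d + c * b)) \<in> O[nhds p](\<omega>)"
    unfolding eval_add eval_mult by (intro sum_in_bigo bigo_mult_bounded eval_bigo_1 ab cd)
  then have "Fract (a * d + c * b) (b * d) \<in> bigo_ideal p \<omega>"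
    using ab cd by (intro bigo_idealI) auto
  then show ?thesis
    unfolding ab(1) cd(1) add_fract[OF eval_nonzero_imp[OF ab(2)] eval_nonzero_imp[OF cd(2)]] .
qed

lemma bigo_ideal_uminus:
  assumes "z \<in> bigo_ideal p \<omega>"
  shows "- z \<in> bigo_ideal p \<omega>"
proof -
  obtain a b where ab: "z = Fract a b" "eval_at p b \<noteq> 0" "(\<lambda>x. eval_at x a) \<in> O[nhds p](\<omega>)"
    using assms(1) by (rule bigo_idealE)
  then show ?thesis by (auto intro!: bigo_idealI)
qed

lemma bigo_ideal_0: "0 \<in> bigo_ideal p \<omega>"
  using bigo_idealI[of p 1 0 \<omega>] by (simp add: Zero_fract_def)

lemma bigo_ideal_diff:
  "z \<in> bigo_ideal p \<omega> \<Longrightarrow> w \<in> bigo_ideal p \<omega> \<Longrightarrow> z - w \<in> bigo_ideal p \<omega>"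
  using bigo_ideal_add[OF _ bigo_ideal_uminus, of z p \<omega> w] by simp

lemma bigo_ideal_sum:
  "(\<And>i. i \<in> S \<Longrightarrow> f i \<in> bigo_ideal p \<omega>) \<Longrightarrow> (\<Sum>i\<in>S. f i) \<in> bigo_ideal p \<omega>"
  by (induction S rule: infinite_finite_induct) (auto intro: bigo_ideal_add bigo_ideal_0)

lemma bigo_ideal_mult:
  assumes "z \<in> bigo_ideal p \<omega>" "w \<in> bigo_ideal p \<omega>'"
  shows "z * w \<in> bigo_ideal p (\<lambda>x. \<omega> x * \<omega>' x)"
proof -
  obtain a b where ab: "z = Fract a b" "eval_at p b \<noteq> 0" "(\<lambda>x. eval_at x a) \<in> O[nhds p](\<omega>)"
    using assms(1) by (rule bigo_idealE)
  obtain c d where cd: "w = Fract c d" "eval_at p d \<noteq> 0" "(\<lambda>x. eval_at x c) \<in> O[nhds p](\<omega>')"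
    using assms(2) by (rule bigo_idealE)
  have "(\<lambda>x. eval_at x (a * c)) \<in> O[nhds p](\<lambda>x. \<omega> x * \<omega>' x)"
    unfolding eval_mult by (intro landau_o.big.mult ab cd)
  then show ?thesis using ab cd by (auto intro!: bigo_idealI)
qed

lemma vanish_order_mult:
  "z \<in> vanish_order p m \<Longrightarrow> w \<in> vanish_order p n \<Longrightarrow> z * w \<in> vanish_order p (m + n)"
  using bigo_ideal_mult[of z p "\<lambda>x. rho p x ^ m" w "\<lambda>x. rho p x ^ n"] by (simp add: power_add)

lemma vanish_order_mono:
  assumes "z \<in> vanish_order p n" "m \<le> n"
  shows "z \<in> vanish_order p m"
proof -
  obtain a b where "z = Fract a b" "eval_at p b \<noteq> 0" "(\<lambda>x. eval_at x a) \<in> O[nhds p](\<lambda>x. rho p x ^ n)"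
    using assms(1) by (rule bigo_idealE)
  then show ?thesis using bigo_rho_mono[OF _ assms(2)] by (auto intro!: bigo_idealI)
qed

lemma local_ring_carrier: "carrier (local_ring_at p) = vanish_order p 0"
  using eval_bigo_1[of _ p] by (auto simp: local_ring_at_def bigo_ideal_def)

lemma local_ring_simps [simp]:
  "add (local_ring_at p) = (+)" "monoid.mult (local_ring_at p) = (*)"
  "zero (local_ring_at p) = 0" "one (local_ring_at p) = 1"
  by (auto simp: local_ring_at_def)

lemma local_ring_one: "1 \<in> vanish_order p 0"
  using to_fract_bigo_ideal_iff[of 1 p] eval_bigo_1[of 1 p] by simp

lemma ring_local_ring: "ring (local_ring_at p)"
proof (rule ringI)
  show "abelian_group (local_ring_at p)"
  proof (rule abelian_groupI)
    fix x assume "x \<in> carrier (local_ring_at p)"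
    then show "\<exists>y\<in>carrier (local_ring_at p). y \<oplus>\<^bsub>local_ring_at p\<^esub> x = \<zero>\<^bsub>local_ring_at p\<^esub>"
      by (intro bexI[of _ "- x"]) (simp_all add: local_ring_carrier bigo_ideal_uminus)
  qed (simp_all add: local_ring_carrier bigo_ideal_add bigo_ideal_0 add_ac)
  show "monoid (local_ring_at p)"
  proof (rule monoidI)
    fix x y assume "x \<in> carrier (local_ring_at p)" "y \<in> carrier (local_ring_at p)"
    then show "x \<otimes>\<^bsub>local_ring_at p\<^esub> y \<in> carrier (local_ring_at p)"
      using vanish_order_mult[of x p 0 y 0] by (simp add: local_ring_carrier)
  qed (simp_all only: local_ring_carrier local_ring_simps local_ring_one mult.assoc mult_1_left mult_1_right)
qed (simp_all add: algebra_simps)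

text \<open>The weight is arbitrary for a reason: powers of \<open>rho\<close> receive the powers of
  the maximal ideal, and the sum of absolute values of parameters receives the ideal which these
  parameters generate.\<close>

lemma ideal_bigo_ideal: "ideal (bigo_ideal p \<omega>) (local_ring_at p)"
proof (rule idealI[OF ring_local_ring])
  have sub: "bigo_ideal p \<omega> \<subseteq> vanish_order p 0"
    by (auto simp: bigo_ideal_def intro: eval_bigo_1)
  interpret ring "local_ring_at p" by (rule ring_local_ring)
  have inv: "inv\<^bsub>add_monoid (local_ring_at p)\<^esub> z = - z" if "z \<in> vanish_order p 0" for z
    using minus_equality[of "- z" z] that bigo_ideal_uminus[OF that] by (simp add: local_ring_carrier a_inv_def)
  show "subgroup (bigo_ideal p \<omega>) (add_monoid (local_ring_at p))"
  proof (rule subgroup.intro)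
    fix z assume z: "z \<in> bigo_ideal p \<omega>"
    show "inv\<^bsub>add_monoid (local_ring_at p)\<^esub> z \<in> bigo_ideal p \<omega>"
      unfolding inv[OF subsetD[OF sub z]] by (rule bigo_ideal_uminus[OF z])
  qed (use sub in \<open>simp_all add: local_ring_carrier bigo_ideal_0 bigo_ideal_add\<close>)
  fix a x assume "a \<in> bigo_ideal p \<omega>" "x \<in> carrier (local_ring_at p)"
  then show "x \<otimes>\<^bsub>local_ring_at p\<^esub> a \<in> bigo_ideal p \<omega>" "a \<otimes>\<^bsub>local_ring_at p\<^esub> x \<in> bigo_ideal p \<omega>"
    using bigo_ideal_mult[of a p \<omega> x "\<lambda>x. rho p x ^ 0"] by (simp_all add: local_ring_carrier mult.commute)
qed

lemma max_ideal_vanish: "max_ideal_at p \<subseteq> vanish_order p 1"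
  by (auto simp: max_ideal_at_def intro!: bigo_idealI dest: eval_zero_bigo)

abbreviation max_pow :: "('d::{finite,linorder} \<Rightarrow> real) \<Rightarrow> nat \<Rightarrow> 'd mpoly fract set" where
  "max_pow p \<equiv> ideal_pow (local_ring_at p) (max_ideal_at p)"

abbreviation completed :: "('d::{finite,linorder} \<Rightarrow> real) \<Rightarrow> 'd mpoly fract \<Rightarrow> nat \<Rightarrow> 'd mpoly fract set" where
  "completed p \<equiv> to_completion (local_ring_at p) (max_ideal_at p)"

lemma zero_in_ideal_pow: "0 \<in> max_pow p N"
proof (induction N)
  case 0
  show ?case by (simp add: ideal_pow_def nat_pow_def ideals_set_def local_ring_carrier bigo_ideal_0)
next
  case (Suc N)
  have "0 \<in> max_ideal_at p"
    unfolding max_ideal_at_def Zero_fract_def by force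
  then have "0 \<otimes>\<^bsub>local_ring_at p\<^esub> 0 \<in> ideal_prod (local_ring_at p) (max_pow p N) (max_ideal_at p)"
    by (intro ideal_prod.prod Suc)
  then show ?case by (simp add: ideal_pow_def nat_pow_def ideals_set_def)
qed

text \<open>The link from algebra to analysis: a product of \<open>N\<close> elements of the maximal
  ideal is O(rho^N), and such bounds pass to sums. Congruences in the completion become estimates
  near \<open>p\<close>.\<close>

lemma ideal_pow_vanish: "max_pow p N \<subseteq> vanish_order p N"
proof (induction N)
  case 0
  show ?case by (simp add: ideal_pow_def nat_pow_def ideals_set_def local_ring_carrier)
next
  case (Suc N)
  have "z \<in> vanish_order p (Suc N)"
    if "z \<in> ideal_prod (local_ring_at p) (max_pow p N) (max_ideal_at p)" for z
    using that
  proof (induction z rule: ideal_prod.induct)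
    case (prod i j)
    then show ?case
      using vanish_order_mult[of i p N j 1] Suc.IH max_ideal_vanish by auto
  next
    case (sum z w)
    then show ?case by (auto intro: bigo_ideal_add)
  qed
  then show ?case by (auto simp: ideal_pow_def nat_pow_def ideals_set_def)
qed

lemma to_completion_eqD:
  assumes "completed p z N = completed p w N"
  shows "z - w \<in> vanish_order p N"
proof -
  let ?I = "max_pow p N"
  have "z \<in> completed p z N"
    using zero_in_ideal_pow[of p N] unfolding to_completion_def a_r_coset_def' by force
  then obtain i where "i \<in> ?I" "z = i + w"
    unfolding assms unfolding to_completion_def a_r_coset_def' by auto
  then show ?thesis using ideal_pow_vanish by auto
qed

section \<open>Homogeneous forms in uniformizing parameters\<close>

lemma real_hom_to_fract: "real_hom (\<lambda>c. to_fract (Const c :: 'd::linorder mpoly))"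
  by (simp add: real_hom_def Const_add Const_mult)

lemma to_fract_carrier: "to_fract a \<in> vanish_order p 0"
  using eval_bigo_1 by (simp add: to_fract_bigo_ideal_iff)

lemma vanish_order_carrier_mult:
  "c \<in> vanish_order p 0 \<Longrightarrow> z \<in> vanish_order p n \<Longrightarrow> c * z \<in> vanish_order p n"
  using vanish_order_mult[of c p 0 z n] by simp

lemma homogeneous_vanish:
  fixes p :: "'d::{finite,linorder} \<Rightarrow> real"
  assumes F: "homogeneous_form D j F" and t: "\<And>i. i < D \<Longrightarrow> t i \<in> vanish_order p 1"
  shows "mpoly_eval (\<lambda>c. to_fract (Const c)) t F \<in> vanish_order p j"
  unfolding mpoly_eval_alt
proof (rule bigo_ideal_sum)
  fix \<alpha> assume \<alpha>: "\<alpha> \<in> Poly_Mapping.keys F"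
  have pow: "t i ^ n \<in> vanish_order p n" if "i < D" for i n
  proof (induction n)
    case (Suc n)
    then show ?case using vanish_order_mult[OF t[OF that] Suc] by simp
  qed (use local_ring_one[of p] in simp)
  have prod: "(\<Prod>i\<in>S. t i ^ e i) \<in> vanish_order p (\<Sum>i\<in>S. e i)" if "finite S" "S \<subseteq> {..<D}" for S e
    using that
  proof (induction S rule: finite_induct)
    case (insert i S)
    then show ?case using vanish_order_mult[OF pow[of i "e i"]] by simp
  qed (use local_ring_one[of p] in simp)
  have "monom_eval t \<alpha> \<in> vanish_order p j"
    using prod[of "Poly_Mapping.keys \<alpha>" "Poly_Mapping.lookup \<alpha>"] F \<alpha>
    by (auto simp: homogeneous_form_def monom_eval_def)
  then show "to_fract (Const (Poly_Mapping.lookup F \<alpha>)) * monom_eval t \<alpha> \<in> vanish_order p j"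
    by (rule vanish_order_carrier_mult[OF to_fract_carrier])
qed

lemma homogeneous_0:
  assumes "homogeneous_form D 0 F"
  shows "F = Const (Poly_Mapping.lookup F 0)"
proof -
  have "Poly_Mapping.keys F \<subseteq> {0}"
  proof
    fix \<alpha> assume "\<alpha> \<in> Poly_Mapping.keys F"
    then have "(\<Sum>i\<in>Poly_Mapping.keys \<alpha>. Poly_Mapping.lookup \<alpha> i) = 0"
      using assms by (auto simp: homogeneous_form_def)
    then have "\<alpha> = 0"
      by (intro poly_mapping_eqI) (auto simp: in_keys_iff)
    then show "\<alpha> \<in> {0}" by simp
  qed
  then show ?thesis
    by (intro poly_mapping_eqI) (auto simp: lookup_single when_def in_keys_iff)
qed

text \<open>Splits one variable off a monomial; two applications write a monomial of degree 2 as a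
  product of two variables.\<close>

lemma degree_split:
  fixes \<alpha> :: "nat \<Rightarrow>\<^sub>0 nat"
  assumes "finite S" "Poly_Mapping.keys \<alpha> \<subseteq> S" "(\<Sum>i\<in>S. Poly_Mapping.lookup \<alpha> i) = Suc n"
  obtains i \<beta> where "i \<in> S" "\<alpha> = Poly_Mapping.single i 1 + \<beta>" "Poly_Mapping.keys \<beta> \<subseteq> S"
    "(\<Sum>i\<in>S. Poly_Mapping.lookup \<beta> i) = n"
proof -
  obtain i where i: "i \<in> S" "Poly_Mapping.lookup \<alpha> i \<noteq> 0"
    using assms(3) by (metis nat.distinct(1) sum.neutral)
  define \<beta> where "\<beta> = \<alpha> - Poly_Mapping.single i 1"
  have eq: "\<alpha> = Poly_Mapping.single i 1 + \<beta>"
    using i by (intro poly_mapping_eqI) (auto simp: \<beta>_def lookup_add lookup_minus lookup_single when_def)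
  moreover have "Poly_Mapping.keys \<beta> \<subseteq> S"
    using assms(2) by (auto simp: \<beta>_def in_keys_iff lookup_minus)
  moreover have "(\<Sum>i\<in>S. Poly_Mapping.lookup \<beta> i) = n"
  proof -
    have "Suc n = (\<Sum>j\<in>S. Poly_Mapping.lookup (Poly_Mapping.single i 1) j) + (\<Sum>i\<in>S. Poly_Mapping.lookup \<beta> i)"
      unfolding assms(3)[symmetric] by (subst eq) (simp add: lookup_add sum.distrib)
    also have "(\<Sum>j\<in>S. Poly_Mapping.lookup (Poly_Mapping.single i (1::nat)) j) = (1::nat)"
      using i assms(1) by (simp add: lookup_single when_def)
    finally show ?thesis by simp
  qed
  ultimately show ?thesis using that i by blast
qed

lemma homogeneous_2:
  assumes F: "homogeneous_form D 2 F"
  obtains q where "F = (\<Sum>i<D. \<Sum>j<D. Const (q i j) * Var i * Var j)"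
proof -
  define Q where "Q = {F :: nat mpoly. \<exists>q. F = (\<Sum>i<D. \<Sum>j<D. Const (q i j) * Var i * Var j)}"
  have Q_0: "0 \<in> Q"
    unfolding Q_def by (auto intro!: exI[of _ "\<lambda>_ _. 0"])
  have Q_add: "f + g \<in> Q" if fg: "f \<in> Q" "g \<in> Q" for f g
  proof -
    obtain q q' where "f = (\<Sum>i<D. \<Sum>j<D. Const (q i j) * Var i * Var j)"
      "g = (\<Sum>i<D. \<Sum>j<D. Const (q' i j) * Var i * Var j)"
      using fg by (auto simp: Q_def)
    then have "f + g = (\<Sum>i<D. \<Sum>j<D. Const (q i j + q' i j) * Var i * Var j)"
      by (simp add: Const_add distrib_right sum.distrib)
    then show ?thesis unfolding Q_def by (auto intro!: exI[of _ "\<lambda>i j. q i j + q' i j"])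
  qed
  have Q_single: "Poly_Mapping.single \<alpha> c \<in> Q" if \<alpha>: "\<alpha> \<in> Poly_Mapping.keys F" for \<alpha> c
  proof -
    have keys: "Poly_Mapping.keys \<alpha> \<subseteq> {..<D}" and "(\<Sum>i\<in>Poly_Mapping.keys \<alpha>. Poly_Mapping.lookup \<alpha> i) = 2"
      using F \<alpha> by (auto simp: homogeneous_form_def)
    moreover have "(\<Sum>i\<in>Poly_Mapping.keys \<alpha>. Poly_Mapping.lookup \<alpha> i) = (\<Sum>i<D. Poly_Mapping.lookup \<alpha> i)"
      using keys by (intro sum.mono_neutral_left) (auto simp: in_keys_iff)
    ultimately have "(\<Sum>i<D. Poly_Mapping.lookup \<alpha> i) = Suc 1" by simp
    from degree_split[OF _ keys this] obtain k \<beta> where k: "k < D" "\<alpha> = Poly_Mapping.single k 1 + \<beta>"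
      "Poly_Mapping.keys \<beta> \<subseteq> {..<D}" "(\<Sum>i<D. Poly_Mapping.lookup \<beta> i) = Suc 0"
      by auto
    from degree_split[OF _ k(3,4)] obtain l \<gamma> where l: "l < D" "\<beta> = Poly_Mapping.single l 1 + \<gamma>"
      "Poly_Mapping.keys \<gamma> \<subseteq> {..<D}" "(\<Sum>i<D. Poly_Mapping.lookup \<gamma> i) = 0"
      by auto
    have "\<gamma> = 0"
    proof (rule poly_mapping_eqI)
      fix i show "Poly_Mapping.lookup \<gamma> i = Poly_Mapping.lookup 0 i"
        using l(3,4) by (cases "i < D") (auto simp: in_keys_iff subset_iff)
    qed
    then have "\<alpha> = Poly_Mapping.single k 1 + Poly_Mapping.single l 1"
      using k l by simp
    then have "Poly_Mapping.single \<alpha> c = Const c * Var k * Var l"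
      by (simp add: Var_def mult_single)
    also have "\<dots> = (\<Sum>i<D. \<Sum>j<D. Const (if i = k \<and> j = l then c else 0) * Var i * Var j)"
    proof -
      have "(\<Sum>i<D. \<Sum>j<D. Const (if i = k \<and> j = l then c else 0) * Var i * Var j) =
          (\<Sum>i<D. \<Sum>j<D. if j = l then (if i = k then Const c * Var k * Var l else 0) else 0)"
        by (intro sum.cong) auto
      then show ?thesis using k l by simp
    qed
    finally show ?thesis
      unfolding Q_def by (intro CollectI exI[of _ "\<lambda>i j. if i = k \<and> j = l then c else 0"])
  qed
  have "(\<Sum>\<alpha>\<in>S. Poly_Mapping.single \<alpha> (Poly_Mapping.lookup F \<alpha>)) \<in> Q"
    if "finite S" "S \<subseteq> Poly_Mapping.keys F" for S
    using that by (induction S rule: finite_induct) (auto intro: Q_0 Q_add Q_single)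
  from this[of "Poly_Mapping.keys F"] mpoly_sum_single[of F] have "F \<in> Q" by simp
  then show ?thesis using that by (auto simp: Q_def)
qed

section \<open>Polynomial parameters and the expansion modulo cubes\<close>

lemma uniformizing_vanish:
  assumes "uniformizing_system p t" "i < CARD('d)"
  shows "t i \<in> vanish_order (p :: 'd::{finite,linorder} \<Rightarrow> real) 1"
proof -
  have "t i \<in> Idl\<^bsub>local_ring_at p\<^esub> (t ` {..<CARD('d)})"
    using assms(2) by (auto simp: genideal_def)
  then show ?thesis
    using assms(1) max_ideal_vanish by (auto simp: uniformizing_system_def)
qed

lemma rho_le_sum_abs: "rho p x \<le> (\<Sum>i\<in>UNIV. \<bar>x i - p i\<bar>)"
  using L2_set_le_sum_abs[of "\<lambda>i. x i - p i" UNIV] by (simp add: rho_def L2_set_def)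

text \<open>This takes the place of the inverse function theorem. The rational functions that are
  O(sum of |tau_i|) form an ideal; it contains the generators \<open>t i\<close>, hence the maximal
  ideal, hence every coordinate difference x_v - p_v.\<close>

lemma rho_bigo_of_generators:
  fixes p :: "'d::{finite,linorder} \<Rightarrow> real"
  assumes t: "uniformizing_system p t"
    and rep: "\<And>i. i < CARD('d) \<Longrightarrow> \<exists>b. eval_at p b \<noteq> 0 \<and> t i = Fract (Const (eval_at p b) * \<tau> i) b"
  shows "(\<lambda>x. rho p x) \<in> O[nhds p](\<lambda>x. \<Sum>i<CARD('d). \<bar>eval_at x (\<tau> i)\<bar>)"
proof -
  let ?\<omega> = "\<lambda>x. \<Sum>i<CARD('d). \<bar>eval_at x (\<tau> i)\<bar>"
  have "t i \<in> bigo_ideal p ?\<omega>" if i: "i < CARD('d)" for i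
  proof -
    obtain b where b: "eval_at p b \<noteq> 0" "t i = Fract (Const (eval_at p b) * \<tau> i) b"
      using rep[OF i] by auto
    have le: "\<bar>eval_at x (\<tau> i)\<bar> \<le> ?\<omega> x" for x
      using i by (intro member_le_sum) auto
    have "(\<lambda>x. eval_at x (\<tau> i)) \<in> O[nhds p](?\<omega>)"
    proof (intro bigoI[where c = 1] always_eventually allI)
      fix x
      have "?\<omega> x \<ge> 0" by (intro sum_nonneg) auto
      then show "norm (eval_at x (\<tau> i)) \<le> 1 * norm (?\<omega> x)" using le[of x] by simp
    qed
    then have "(\<lambda>x. eval_at x (Const (eval_at p b) * \<tau> i)) \<in> O[nhds p](?\<omega>)"
      unfolding eval_mult by (intro bigo_mult_bounded eval_bigo_1)
    then show ?thesis unfolding b(2) by (rule bigo_idealI[OF b(1)])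
  qed
  then have "Idl\<^bsub>local_ring_at p\<^esub> (t ` {..<CARD('d)}) \<subseteq> bigo_ideal p ?\<omega>"
    using ideal_bigo_ideal[of p ?\<omega>] by (auto simp: genideal_def)
  then have max_sub: "max_ideal_at p \<subseteq> bigo_ideal p ?\<omega>"
    using t by (simp add: uniformizing_system_def)
  have coord: "(\<lambda>x. \<bar>x v - p v\<bar>) \<in> O[nhds p](?\<omega>)" for v
  proof -
    have "Fract (Var v - Const (p v)) 1 \<in> max_ideal_at p"
      unfolding max_ideal_at_def by (intro CollectI exI[of _ "Var v - Const (p v)"] exI[of _ 1]) auto
    then have "to_fract (Var v - Const (p v)) \<in> bigo_ideal p ?\<omega>"
      using max_sub by (auto simp: to_fract_def)
    then have "(\<lambda>x. eval_at x (Var v - Const (p v))) \<in> O[nhds p](?\<omega>)"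
      unfolding to_fract_bigo_ideal_iff .
    then show ?thesis by simp
  qed
  have "(\<lambda>x. \<Sum>v\<in>UNIV. \<bar>x v - p v\<bar>) \<in> O[nhds p](?\<omega>)"
    by (intro big_sum_in_bigo coord)
  moreover have "(\<lambda>x. rho p x) \<in> O[nhds p](\<lambda>x. \<Sum>v\<in>UNIV. \<bar>x v - p v\<bar>)"
  proof (intro bigoI[where c = 1] always_eventually allI)
    fix x
    show "norm (rho p x) \<le> 1 * norm (\<Sum>v\<in>UNIV. \<bar>x v - p v\<bar>)"
      using rho_le_sum_abs[of p x] by simp
  qed
  ultimately show ?thesis using landau_o.big_trans by blast
qed

text \<open>For t_i = a/b take tau_i = a/b(p). The difference is tau_i (b(p) - b)/b, a product of
  two functions vanishing at \<open>p\<close>, up to the unit \<open>b\<close>. For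
  \<open>i < k\<close> the parameter \<open>g i\<close> is a polynomial and is kept
  unchanged.\<close>

lemma polynomial_parameters:
  fixes p :: "'d::{finite,linorder} \<Rightarrow> real"
  assumes t: "uniformizing_system p t" and g: "extends_params k g t" and k: "k \<le> CARD('d)"
  obtains \<tau> where "\<And>i. i < k \<Longrightarrow> \<tau> i = g i"
    "\<And>i. i < CARD('d) \<Longrightarrow> (\<lambda>x. eval_at x (\<tau> i)) \<in> O[nhds p](\<lambda>x. rho p x ^ 1)"
    "\<And>i. i < CARD('d) \<Longrightarrow> t i - to_fract (\<tau> i) \<in> vanish_order p 2"
    "(\<lambda>x. rho p x) \<in> O[nhds p](\<lambda>x. \<Sum>i<CARD('d). \<bar>eval_at x (\<tau> i)\<bar>)"
proof -
  have "\<exists>\<tau>. (i < k \<longrightarrow> \<tau> = g i) \<and> (\<exists>b. eval_at p b \<noteq> 0 \<and> t i = Fract (Const (eval_at p b) * \<tau>) b)"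
    if i: "i < CARD('d)" for i
  proof (cases "i < k")
    case True
    then have "t i = Fract (Const (eval_at p 1) * g i) 1"
      using g by (simp add: extends_params_def to_fract_def)
    then show ?thesis using True by (intro exI[of _ "g i"] conjI impI refl exI[of _ 1]) auto
  next
    case False
    obtain a b where ab: "t i = Fract a b" "eval_at p b \<noteq> 0"
      using uniformizing_vanish[OF t i] by (auto simp: bigo_ideal_def)
    have "Const (eval_at p b) * (Const (1 / eval_at p b) * a) = Const (eval_at p b * (1 / eval_at p b)) * a"
      by (simp only: Const_mult mult.assoc)
    then have "Const (eval_at p b) * (Const (1 / eval_at p b) * a) = a"
      using ab(2) by simp
    then have "t i = Fract (Const (eval_at p b) * (Const (1 / eval_at p b) * a)) b"
      by (simp only: ab(1))
    then show ?thesis using ab(2) False by blast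
  qed
  then obtain \<tau> where \<tau>: "\<And>i. i < CARD('d) \<Longrightarrow> i < k \<Longrightarrow> \<tau> i = g i"
    "\<And>i. i < CARD('d) \<Longrightarrow> \<exists>b. eval_at p b \<noteq> 0 \<and> t i = Fract (Const (eval_at p b) * \<tau> i) b"
    by metis
  have num: "(\<lambda>x. eval_at x (\<tau> i)) \<in> O[nhds p](\<lambda>x. rho p x ^ 1) \<and> t i - to_fract (\<tau> i) \<in> vanish_order p 2"
    if i: "i < CARD('d)" for i
  proof -
    obtain b where b: "eval_at p b \<noteq> 0" "t i = Fract (Const (eval_at p b) * \<tau> i) b"
      using \<tau>(2)[OF i] by auto
    let ?b = "Const (eval_at p b)"
    have "(\<lambda>x. eval_at x (?b * \<tau> i)) \<in> O[nhds p](\<lambda>x. rho p x ^ 1)"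
      using uniformizing_vanish[OF t i] b by (intro bigo_ideal_numerator[OF _ b(1)]) simp
    then have 1: "(\<lambda>x. eval_at x (\<tau> i)) \<in> O[nhds p](\<lambda>x. rho p x ^ 1)"
      using b(1) by simp
    have "eval_at p (?b - b) = 0" by simp
    from bigo_rho_mult[OF 1 eval_zero_bigo[OF this]]
    have "(\<lambda>x. eval_at x (\<tau> i * (?b - b))) \<in> O[nhds p](\<lambda>x. rho p x ^ 2)"
      by (simp add: numeral_2_eq_2)
    then have "Fract (\<tau> i * (?b - b)) b \<in> vanish_order p 2"
      by (rule bigo_idealI[OF b(1)])
    moreover have "t i - to_fract (\<tau> i) = Fract (\<tau> i * (?b - b)) b"
      using eval_nonzero_imp[OF b(1)] by (simp add: b(2) to_fract_def algebra_simps)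
    ultimately show ?thesis using 1 by simp
  qed
  show ?thesis
    using that[of \<tau>] \<tau>(1) num rho_bigo_of_generators[OF t \<tau>(2)] k by auto
qed

text \<open>Modulo cubes only the forms of degree at most 2 remain. The constant term is 0 since
  f(p) = 0. The linear form involves only the t_i with \<open>i < k\<close>, which are polynomials
  already. In the quadratic form each t_i is replaced by tau_i at the cost of O(rho^3).\<close>

lemma BHC_expansion:
  fixes p :: "'d::{finite,linorder} \<Rightarrow> real"
  assumes BHC: "BHC p k g f" and zero: "eval_at p f = 0"
  obtains \<tau> a q where "k \<le> CARD('d)" "\<And>i. i < k \<Longrightarrow> \<tau> i = g i" "\<And>i. i < k \<Longrightarrow> a i > (0::real)"
    "\<And>i. i < CARD('d) \<Longrightarrow> (\<lambda>x. eval_at x (\<tau> i)) \<in> O[nhds p](\<lambda>x. rho p x ^ 1)"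
    "(\<lambda>x. rho p x) \<in> O[nhds p](\<lambda>x. \<Sum>i<CARD('d). \<bar>eval_at x (\<tau> i)\<bar>)"
    "(\<lambda>x. eval_at x (f - ((\<Sum>i<k. Const (a i) * \<tau> i) +
        (\<Sum>i<CARD('d). \<Sum>j<CARD('d). Const (q i j) * \<tau> i * \<tau> j)))) \<in> O[nhds p](\<lambda>x. rho p x ^ 3)"
    "\<And>y. (\<forall>i<k. y i = 0) \<Longrightarrow> \<exists>i\<in>{k..<CARD('d)}. y i \<noteq> 0 \<Longrightarrow>
        (\<Sum>i<CARD('d). \<Sum>j<CARD('d). q i j * y i * y j) > 0"
proof -
  let ?D = "CARD('d)"
  obtain t F a where k: "k \<le> ?D" and t: "uniformizing_system p t" and g: "extends_params k g t"
    and ex: "expands_as p t f F" and a: "\<forall>i<k. a i > 0"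
    and F1: "F 1 = (\<Sum>i<k. Poly_Mapping.single (Poly_Mapping.single i 1) (a i))"
    and F2: "\<And>y. (\<forall>i<k. y i = 0) \<and> (\<exists>i\<in>{k..<?D}. y i \<noteq> 0) \<Longrightarrow> eval_at y (F 2) > 0"
    using BHC unfolding BHC_def by blast
  obtain \<tau> where \<tau>: "\<And>i. i < k \<Longrightarrow> \<tau> i = g i"
    "\<And>i. i < ?D \<Longrightarrow> (\<lambda>x. eval_at x (\<tau> i)) \<in> O[nhds p](\<lambda>x. rho p x ^ 1)"
    "\<And>i. i < ?D \<Longrightarrow> t i - to_fract (\<tau> i) \<in> vanish_order p 2"
    "(\<lambda>x. rho p x) \<in> O[nhds p](\<lambda>x. \<Sum>i<?D. \<bar>eval_at x (\<tau> i)\<bar>)"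
    using polynomial_parameters[OF t g k] by blast
  have F: "homogeneous_form ?D j (F j)" for j
    using ex by (simp add: expands_as_def)
  define ev :: "nat mpoly \<Rightarrow> 'd mpoly fract" where "ev = mpoly_eval (\<lambda>c. to_fract (Const c)) t"
  have t_van: "t i \<in> vanish_order p 1" if "i < ?D" for i
    by (rule uniformizing_vanish[OF t that])
  have ev_van: "ev (F j) \<in> vanish_order p j" for j
    unfolding ev_def by (rule homogeneous_vanish[OF F t_van])
  have "\<forall>\<^sub>F J in sequentially.
      completed p (\<Sum>j<J. ev (F j)) 3 =
      completed p (to_fract f) 3"
    using ex by (simp add: expands_as_def adic_limit_def Let_def ev_def)
  then obtain J0 where J0: "\<And>J. J \<ge> J0 \<Longrightarrow>
      completed p (\<Sum>j<J. ev (F j)) 3 =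
      completed p (to_fract f) 3"
    by (auto simp: eventually_sequentially)
  \<comment> \<open>At least 3, so that the partial sum contains the degrees 0, 1 and 2 and
    everything beyond them is O(rho^3).\<close>
  define J where "J = max J0 3"
  have "(\<Sum>j<J. ev (F j)) - to_fract f \<in> vanish_order p 3"
    by (rule to_completion_eqD, rule J0) (simp add: J_def)
  moreover have "(\<Sum>j<J. ev (F j)) = (\<Sum>j<3. ev (F j)) + (\<Sum>j\<in>{3..<J}. ev (F j))"
    using sum.atLeastLessThan_concat[of 0 3 J "\<lambda>j. ev (F j)"] by (simp add: J_def atLeast0LessThan)
  moreover have "(\<Sum>j\<in>{3..<J}. ev (F j)) \<in> vanish_order p 3"
    by (intro bigo_ideal_sum vanish_order_mono[OF ev_van]) auto
  ultimately have "(\<Sum>j<3. ev (F j)) - to_fract f \<in> vanish_order p 3"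
    using bigo_ideal_diff[of "(\<Sum>j<J. ev (F j)) - to_fract f" p _ "\<Sum>j\<in>{3..<J}. ev (F j)"] by simp
  from bigo_ideal_uminus[OF this]
  have main: "to_fract f - (ev (F 0) + ev (F 1) + ev (F 2)) \<in> vanish_order p 3"
    by (simp add: numeral_3_eq_3 numeral_2_eq_2 algebra_simps)
  have F0: "ev (F 0) = 0"
  proof -
    define c where "c = Poly_Mapping.lookup (F 0) 0"
    have ev0: "ev (F 0) = to_fract (Const c)"
      unfolding ev_def c_def
      by (subst homogeneous_0[OF F]) (simp add: mpoly_eval_single[OF real_hom_to_fract])
    have "to_fract f \<in> vanish_order p 1"
      unfolding to_fract_bigo_ideal_iff by (rule eval_zero_bigo[OF zero])
    then have "to_fract f - (ev (F 1) + ev (F 2)) - (to_fract f - (ev (F 0) + ev (F 1) + ev (F 2))) \<in> vanish_order p 1"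
      by (rule bigo_ideal_diff[OF bigo_ideal_diff[OF _ bigo_ideal_add[OF ev_van vanish_order_mono[OF ev_van]]]
            vanish_order_mono[OF main]]) auto
    also have "to_fract f - (ev (F 1) + ev (F 2)) - (to_fract f - (ev (F 0) + ev (F 1) + ev (F 2))) = ev (F 0)"
      by (simp only: algebra_simps)
    finally have "to_fract (Const c) \<in> vanish_order p 1"
      by (simp only: ev0)
    then have "eval_at p (Const c) = 0"
      unfolding to_fract_bigo_ideal_iff by (rule eval_at_0_of_bigo) simp
    then show ?thesis by (simp add: ev0)
  qed
  have F1': "ev (F 1) = to_fract (\<Sum>i<k. Const (a i) * \<tau> i)"
  proof -
    have "ev (F 1) = (\<Sum>i<k. to_fract (Const (a i)) * t i)"
      unfolding ev_def F1 mpoly_eval_sum[OF real_hom_to_fract] mpoly_eval_single[OF real_hom_to_fract] by simp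
    also have "\<dots> = (\<Sum>i<k. to_fract (Const (a i) * \<tau> i))"
      using g \<tau>(1) by (intro sum.cong) (auto simp: extends_params_def)
    finally show ?thesis by simp
  qed
  obtain q where q: "F 2 = (\<Sum>i<?D. \<Sum>j<?D. Const (q i j) * Var i * Var j)"
    using homogeneous_2[OF F] by blast
  have F2': "ev (F 2) = (\<Sum>i<?D. \<Sum>j<?D. to_fract (Const (q i j)) * t i * t j)"
    unfolding ev_def q mpoly_eval_sum[OF real_hom_to_fract] mpoly_eval_mult[OF real_hom_to_fract] Var_def
      mpoly_eval_single[OF real_hom_to_fract] by simp
  have "ev (F 2) - to_fract (\<Sum>i<?D. \<Sum>j<?D. Const (q i j) * \<tau> i * \<tau> j) =
      (\<Sum>i<?D. \<Sum>j<?D. to_fract (Const (q i j)) * (t i * (t j - to_fract (\<tau> j)) + to_fract (\<tau> j) * (t i - to_fract (\<tau> i))))"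
    unfolding F2' by (simp add: sum_subtractf[symmetric] algebra_simps)
  also have "\<dots> \<in> vanish_order p 3"
  proof (intro bigo_ideal_sum)
    fix i j assume ij: "i \<in> {..<?D}" "j \<in> {..<?D}"
    have three: "(1::nat) + 2 = 3" by simp
    note mult = vanish_order_mult[where m = 1 and n = 2, unfolded three]
    have 1: "t i * (t j - to_fract (\<tau> j)) \<in> vanish_order p 3"
      using ij by (intro mult t_van \<tau>(3)) auto
    have "to_fract (\<tau> j) \<in> vanish_order p 1"
      unfolding to_fract_bigo_ideal_iff using \<tau>(2)[of j] ij by blast
    then have 2: "to_fract (\<tau> j) * (t i - to_fract (\<tau> i)) \<in> vanish_order p 3"
      using ij by (intro mult \<tau>(3)) auto
    show "to_fract (Const (q i j)) * (t i * (t j - to_fract (\<tau> j)) + to_fract (\<tau> j) * (t i - to_fract (\<tau> i)))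
        \<in> vanish_order p 3"
      by (rule vanish_order_carrier_mult[OF to_fract_carrier bigo_ideal_add[OF 1 2]])
  qed
  finally have "ev (F 2) - to_fract (\<Sum>i<?D. \<Sum>j<?D. Const (q i j) * \<tau> i * \<tau> j) \<in> vanish_order p 3" .
  note van = bigo_ideal_add[OF main this, unfolded F0 F1']
  have "u - (0 + v + w) + (w - z) = u - (v + z)" for u v w z :: "'d mpoly fract"
    by simp
  from van[unfolded this]
  have "to_fract (f - ((\<Sum>i<k. Const (a i) * \<tau> i) + (\<Sum>i<?D. \<Sum>j<?D. Const (q i j) * \<tau> i * \<tau> j))) \<in> vanish_order p 3"
    by (simp only: to_fract_diff to_fract_add)
  then have "(\<lambda>x. eval_at x (f - ((\<Sum>i<k. Const (a i) * \<tau> i) +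
        (\<Sum>i<?D. \<Sum>j<?D. Const (q i j) * \<tau> i * \<tau> j)))) \<in> O[nhds p](\<lambda>x. rho p x ^ 3)"
    unfolding to_fract_bigo_ideal_iff .
  moreover have "(\<Sum>i<?D. \<Sum>j<?D. q i j * y i * y j) > 0"
    if "\<forall>i<k. y i = 0" "\<exists>i\<in>{k..<?D}. y i \<noteq> 0" for y
    using F2[of y] that by (simp add: q)
  ultimately show ?thesis
    using that[OF k \<tau>(1) _ \<tau>(2) \<tau>(4)] a by blast
qed

section \<open>From the boundary Hessian conditions to quadratic growth\<close>

lemma pd_form_bound:
  fixes Q :: "'i \<Rightarrow> 'i \<Rightarrow> real"
  assumes I: "finite I"
    and pos: "\<And>w. \<exists>i\<in>I. w i \<noteq> 0 \<Longrightarrow> (\<Sum>i\<in>I. \<Sum>j\<in>I. Q i j * w i * w j) > 0"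
  obtains c where "c > 0" "\<And>w. (\<Sum>i\<in>I. \<Sum>j\<in>I. Q i j * w i * w j) \<ge> c * (\<Sum>i\<in>I. (w i)^2)"
proof -
  let ?Z = "{w :: 'i \<Rightarrow> real. (\<forall>i. i \<notin> I \<longrightarrow> w i = 0) \<and> (\<Sum>i\<in>I. (w i)^2) = 1}"
  have cont: "continuous_on ?Z (\<lambda>w. \<Sum>i\<in>I. \<Sum>j\<in>I. Q i j * w i * w j)"
    by (intro continuous_on_sum continuous_on_mult continuous_on_const
        continuous_on_subset[OF continuous_on_product_coordinates]) auto
  have "(\<Sum>i\<in>I. \<Sum>j\<in>I. Q i j * w i * w j) > 0" if w: "w \<in> ?Z" for w
  proof (rule pos, rule ccontr)
    assume "\<not> (\<exists>i\<in>I. w i \<noteq> 0)"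
    then have "(\<Sum>i\<in>I. (w i)^2) = 0" by simp
    then show False using w by simp
  qed
  then obtain c where c: "c > 0" "\<And>w. w \<in> ?Z \<Longrightarrow> c \<le> (\<Sum>i\<in>I. \<Sum>j\<in>I. Q i j * w i * w j)"
    using compact_pos_lower_bound[OF compact_unit_sphere[OF I] cont] by blast
  have "(\<Sum>i\<in>I. \<Sum>j\<in>I. Q i j * w i * w j) \<ge> c * (\<Sum>i\<in>I. (w i)^2)" for w
    by (rule form_bound_from_sphere[OF I]) (rule c(2), simp)
  then show ?thesis using that c(1) by blast
qed

text \<open>The block with row index at least \<open>k\<close> and column index below
  \<open>k\<close> is transposed, so that each term involving an index below \<open>k\<close> is
  attached to an outer index below \<open>k\<close>.\<close>

lemma sum_split_block:
  fixes F :: "nat \<Rightarrow> nat \<Rightarrow> 'a::comm_ring_1"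
  assumes "k \<le> D"
  shows "(\<Sum>i<D. \<Sum>j<D. F i j) =
    (\<Sum>i<k. \<Sum>j<D. F i j) + (\<Sum>i<k. \<Sum>j\<in>{k..<D}. F j i) + (\<Sum>i\<in>{k..<D}. \<Sum>j\<in>{k..<D}. F i j)"
proof -
  have split: "(\<Sum>i<D. f i) = (\<Sum>i<k. f i) + (\<Sum>i\<in>{k..<D}. f i)" for f :: "nat \<Rightarrow> 'a"
    using sum.atLeastLessThan_concat[of 0 k D f] assms by (simp add: atLeast0LessThan)
  have "(\<Sum>i\<in>{k..<D}. \<Sum>j<D. F i j) = (\<Sum>i\<in>{k..<D}. \<Sum>j<k. F i j) + (\<Sum>i\<in>{k..<D}. \<Sum>j\<in>{k..<D}. F i j)"
    by (simp add: split sum.distrib)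
  also have "(\<Sum>i\<in>{k..<D}. \<Sum>j<k. F i j) = (\<Sum>i<k. \<Sum>j\<in>{k..<D}. F j i)"
    by (rule sum.swap)
  finally show ?thesis
    using split[of "\<lambda>i. \<Sum>j<D. F i j"] by (simp add: add.assoc)
qed

text \<open>The linear part of \<open>f\<close> and all quadratic terms with some factor tau_i,
  \<open>i < k\<close>, are collected as multiples of these tau_i. Their coefficients a_i + L_i are
  squares up to order 2, so the subtracted \<open>m\<close> lies in \<open>M\<close>. What remains
  is \<open>H\<close>: the sum of tau_i^2 over \<open>i < k\<close> plus a positive definite form in
  the other parameters.\<close>

lemma BHC_local_growth:
  fixes p :: "'d::{finite,linorder} \<Rightarrow> real"
  assumes M: "quadratic_module M" and gM: "\<And>j. j < k \<Longrightarrow> g j \<in> M"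
    and BHC: "BHC p k g f" and zero: "eval_at p f = 0"
  shows "\<exists>m\<in>M. growth p (f - m) \<and> eval_at p m = 0"
proof -
  let ?D = "CARD('d)"
  obtain \<tau> a q where k: "k \<le> ?D" and \<tau>g: "\<And>i. i < k \<Longrightarrow> \<tau> i = g i" and a: "\<And>i. i < k \<Longrightarrow> a i > (0::real)"
    and \<tau>: "\<And>i. i < ?D \<Longrightarrow> (\<lambda>x. eval_at x (\<tau> i)) \<in> O[nhds p](\<lambda>x. rho p x ^ 1)"
    and rho: "(\<lambda>x. rho p x) \<in> O[nhds p](\<lambda>x. \<Sum>i<?D. \<bar>eval_at x (\<tau> i)\<bar>)"
    and rest: "(\<lambda>x. eval_at x (f - ((\<Sum>i<k. Const (a i) * \<tau> i) +
        (\<Sum>i<?D. \<Sum>j<?D. Const (q i j) * \<tau> i * \<tau> j)))) \<in> O[nhds p](\<lambda>x. rho p x ^ 3)"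
    and q: "\<And>y. (\<forall>i<k. y i = 0) \<Longrightarrow> \<exists>i\<in>{k..<?D}. y i \<noteq> 0 \<Longrightarrow>
        (\<Sum>i<?D. \<Sum>j<?D. q i j * y i * y j) > 0"
  proof (rule BHC_expansion[OF BHC zero], goal_cases)
    case (1 \<tau> a q)
    show ?case by (rule 1(1)[of \<tau> a q]) (fact 1(2-8))+
  qed
  \<comment> \<open>The two sums gather the coefficients of tau_i in the quadratic form; the last
    term - tau_i leaves + tau_i^2 behind in f - m.\<close>
  define L where "L = (\<lambda>i. (\<Sum>j<?D. Const (q i j) * \<tau> j) + (\<Sum>j\<in>{k..<?D}. Const (q j i) * \<tau> j) - \<tau> i)"
  \<comment> \<open>Chosen so that 2 sqrt(a_i) b_i = 1, which makes L_i the middle term of the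
    square; the last term (b_i L_i)^2 contributes only O(rho^3).\<close>
  define b where "b = (\<lambda>i. 1 / (2 * sqrt (a i)))"
  define m where "m = (\<Sum>i<k. (Const (sqrt (a i)) + Const (b i) * L i)^2 * \<tau> i)"
  have mM: "m \<in> M"
    unfolding m_def using \<tau>g gM by (intro quadratic_module_sum quadratic_module_mult M) auto
  have \<tau>_bigo: "(\<lambda>x. eval_at x (\<tau> i)) \<in> O[nhds p](\<lambda>x. rho p x)" if "i < ?D" for i
    using \<tau>[OF that] by simp
  have \<tau>_zero: "eval_at p (\<tau> i) = 0" if "i < ?D" for i
    using eval_at_0_of_bigo[OF \<tau>[OF that]] by simp
  define H where "H = (\<Sum>i\<in>{k..<?D}. \<Sum>j\<in>{k..<?D}. Const (q i j) * \<tau> i * \<tau> j) + (\<Sum>i<k. \<tau> i ^ 2)"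
  define E where "E = (\<Sum>i<k. (Const (b i) * L i)^2 * \<tau> i)"
  have sq: "(Const (sqrt (a i)) + Const (b i) * L i)^2 = Const (a i) + L i + (Const (b i) * L i)^2"
    if "i < k" for i
  proof -
    have 1: "Const (sqrt (a i)) * Const (sqrt (a i)) = (Const (a i) :: 'd mpoly)"
      using a[OF that] by (simp flip: Const_mult)
    have 2: "Const (sqrt (a i)) * Const (b i) + Const (sqrt (a i)) * Const (b i) = (1 :: 'd mpoly)"
      using a[OF that] by (simp add: b_def flip: Const_mult Const_add)
    have "(Const (sqrt (a i)) + Const (b i) * L i)^2 = Const (sqrt (a i)) * Const (sqrt (a i)) +
        (Const (sqrt (a i)) * Const (b i) + Const (sqrt (a i)) * Const (b i)) * L i + (Const (b i) * L i)^2"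
      by (simp add: power2_eq_square algebra_simps)
    then show ?thesis by (simp only: 1 2 mult_1_left)
  qed
  have m_eq: "m = (\<Sum>i<k. Const (a i) * \<tau> i) + (\<Sum>i<k. L i * \<tau> i) + E"
    unfolding m_def E_def by (simp add: sq distrib_right sum.distrib)
  have L_eq: "(\<Sum>i<k. L i * \<tau> i) = (\<Sum>i<k. \<Sum>j<?D. Const (q i j) * \<tau> i * \<tau> j) +
      (\<Sum>i<k. \<Sum>j\<in>{k..<?D}. Const (q j i) * \<tau> j * \<tau> i) - (\<Sum>i<k. \<tau> i ^ 2)"
    unfolding sum.distrib[symmetric] sum_subtractf[symmetric]
    by (intro sum.cong refl)
      (simp add: L_def algebra_simps sum_distrib_left sum_distrib_right power2_eq_square)
  have decomp: "f - m = H + (f - ((\<Sum>i<k. Const (a i) * \<tau> i) + (\<Sum>i<?D. \<Sum>j<?D. Const (q i j) * \<tau> i * \<tau> j))) - E"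
    unfolding m_eq L_eq H_def sum_split_block[OF k] by (simp add: algebra_simps)
  have E_bigo: "(\<lambda>x. eval_at x E) \<in> O[nhds p](\<lambda>x. rho p x ^ 3)"
  proof -
    have L_zero: "eval_at p (L i) = 0" if "i < k" for i
      using that k by (simp add: L_def \<tau>_zero)
    have "(\<lambda>x. eval_at x ((Const (b i) * L i)^2 * \<tau> i)) \<in> O[nhds p](\<lambda>x. rho p x ^ 3)" if i: "i < k" for i
    proof -
      have "(\<lambda>x. eval_at x (Const (b i) * L i)) \<in> O[nhds p](\<lambda>x. rho p x ^ 1)"
        by (rule eval_zero_bigo) (simp add: L_zero[OF i])
      from bigo_rho_mult[OF bigo_rho_mult[OF this this] \<tau>[of i]] i k show ?thesis
        by (simp add: power2_eq_square numeral_3_eq_3)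
    qed
    then show ?thesis unfolding E_def eval_sum by (intro big_sum_in_bigo) auto
  qed
  \<comment> \<open>Block diagonal: the identity on the indices below \<open>k\<close> and
    \<open>q\<close> on the rest. Its value at the parameters is \<open>H\<close>.\<close>
  define Q where "Q = (\<lambda>i j. if i < k \<or> j < k then (if i = j then 1 else 0) else q i j)"
  have Q_sum: "(\<Sum>i<?D. \<Sum>j<?D. Q i j * y i * y j) =
      (\<Sum>i\<in>{k..<?D}. \<Sum>j\<in>{k..<?D}. q i j * y i * y j) + (\<Sum>i<k. (y i)^2)" for y :: "nat \<Rightarrow> real"
  proof -
    have "(\<Sum>i<k. \<Sum>j<?D. Q i j * y i * y j) = (\<Sum>i<k. \<Sum>j<?D. if i = j then (y i)^2 else 0)"
      by (intro sum.cong) (auto simp: Q_def power2_eq_square)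
    also have "\<dots> = (\<Sum>i<k. (y i)^2)"
      using k by (intro sum.cong) auto
    finally have 1: "(\<Sum>i<k. \<Sum>j<?D. Q i j * y i * y j) = (\<Sum>i<k. (y i)^2)" .
    have 2: "(\<Sum>i<k. \<Sum>j\<in>{k..<?D}. Q j i * y j * y i) = 0"
      by (intro sum.neutral ballI) (auto simp: Q_def)
    have 3: "(\<Sum>i\<in>{k..<?D}. \<Sum>j\<in>{k..<?D}. Q i j * y i * y j) = (\<Sum>i\<in>{k..<?D}. \<Sum>j\<in>{k..<?D}. q i j * y i * y j)"
      by (intro sum.cong) (auto simp: Q_def)
    show ?thesis unfolding sum_split_block[OF k] 1 2 3 by simp
  qed
  have "(\<Sum>i<?D. \<Sum>j<?D. Q i j * y i * y j) > 0" if y: "\<exists>i\<in>{..<?D}. y i \<noteq> 0" for y :: "nat \<Rightarrow> real"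
  proof (cases "\<exists>i\<in>{k..<?D}. y i \<noteq> 0")
    case True
    let ?y = "\<lambda>i. if i < k then 0 else y i"
    have "0 < (\<Sum>i<?D. \<Sum>j<?D. q i j * ?y i * ?y j)"
      using True by (intro q) auto
    also have "\<dots> = (\<Sum>i\<in>{k..<?D}. \<Sum>j\<in>{k..<?D}. q i j * y i * y j)"
    proof -
      have "(\<Sum>i\<in>{k..<?D}. \<Sum>j\<in>{k..<?D}. q i j * ?y i * ?y j) = (\<Sum>i\<in>{k..<?D}. \<Sum>j\<in>{k..<?D}. q i j * y i * y j)"
        by (intro sum.cong) auto
      then show ?thesis unfolding sum_split_block[OF k] by simp
    qed
    finally show ?thesis unfolding Q_sum by (intro add_pos_nonneg sum_nonneg) auto
  next
    case False
    then obtain i where i: "i < k" "y i \<noteq> 0" using y by (meson atLeastLessThan_iff lessThan_iff not_le)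
    have "(\<Sum>i<k. (y i)^2) > 0" using i by (intro sum_pos2[of _ i]) auto
    then show ?thesis unfolding Q_sum using False by simp
  qed
  then obtain c where c: "c > 0" "\<And>y. (\<Sum>i<?D. \<Sum>j<?D. Q i j * y i * y j) \<ge> c * (\<Sum>i<?D. (y i)^2)"
    using pd_form_bound[of "{..<?D}" Q] by blast
  obtain C where C: "C > 0" "\<forall>\<^sub>F x in nhds p. norm (rho p x) \<le> C * norm (\<Sum>i<?D. \<bar>eval_at x (\<tau> i)\<bar>)"
    using rho by (elim landau_o.bigE)
  have D0: "real ?D > 0" by simp
  have "growth p H"
    unfolding growth_def
  \<comment> \<open>Here \<open>C\<close> bounds rho by the sum of |tau_i|, the factor
    \<open>D\<close> (the number of variables) comes from the Cauchy-Schwarz inequality, and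
    \<open>c\<close> from the positive definite form.\<close>
  proof (intro exI[of _ "c / (C^2 * real ?D)"] conjI)
    show "c / (C^2 * real ?D) > 0" using c C D0 by simp
    show "\<forall>\<^sub>F x in nhds p. c / (C^2 * real ?D) * (rho p x)^2 \<le> eval_at x H"
      using C(2)
    proof eventually_elim
      case (elim x)
      let ?s = "\<Sum>i<?D. \<bar>eval_at x (\<tau> i)\<bar>" and ?S = "\<Sum>i<?D. (eval_at x (\<tau> i))^2"
      have "?s \<ge> 0" by (intro sum_nonneg) auto
      then have "rho p x \<le> C * ?s" using elim by simp
      then have "(rho p x)^2 \<le> (C * ?s)^2" by (intro power_mono) auto
      also have "\<dots> = C^2 * ?s^2" by (simp add: power_mult_distrib)
      also have "?s^2 \<le> real ?D * ?S"
        using sum_squared_le_sum_of_squares[where I = "{..<?D}" and f = "\<lambda>i. \<bar>eval_at x (\<tau> i)\<bar>"]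
        by (simp add: mult.commute)
      finally have "(rho p x)^2 \<le> C^2 * (real ?D * ?S)" using C(1) by simp
      then have "c / (C^2 * real ?D) * (rho p x)^2 \<le> c / (C^2 * real ?D) * (C^2 * (real ?D * ?S))"
        using c(1) C(1) by (intro mult_left_mono) auto
      also have "\<dots> = c * ?S" using C(1) D0 by simp
      also have "\<dots> \<le> (\<Sum>i<?D. \<Sum>j<?D. Q i j * eval_at x (\<tau> i) * eval_at x (\<tau> j))"
        by (rule c(2))
      also have "\<dots> = eval_at x H" unfolding Q_sum H_def by simp
      finally show ?case .
    qed
  qed
  then have "growth p (f - m)"
    unfolding decomp by (intro growth_diff_bigo_3[OF growth_add_bigo_3] rest E_bigo)
  moreover have "eval_at p m = 0"
    using k by (simp add: m_def \<tau>_zero)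
  ultimately show ?thesis using mM by blast
qed

section \<open>Diagonal matrices\<close>

lemma psd_diag_nonneg:
  fixes d :: "nat \<Rightarrow> 'v mpoly"
  assumes psd: "psd_on n K (diag_D n r d)" and x: "x \<in> K" and i: "i < r" "r \<le> n"
  shows "eval_at x (d i) \<ge> 0"
proof -
  let ?A = "map_mat (eval_at x) (diag_D n r d)"
  have A: "?A \<in> carrier_mat n n" by (simp add: diag_D_def)
  have "unit_vec n i \<bullet> (?A *\<^sub>v unit_vec n i) \<ge> 0"
    using psd x by (auto simp: psd_on_def psd_mat_def)
  moreover have "unit_vec n i \<bullet> (?A *\<^sub>v unit_vec n i) = ?A $$ (i, i)"
  proof -
    have "unit_vec n i \<bullet> (?A *\<^sub>v unit_vec n i) = vec_index (?A *\<^sub>v unit_vec n i) i"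
      using A i by (intro scalar_prod_left_unit) auto
    also have "\<dots> = ?A $$ (i, i)"
      using i by (simp add: diag_D_def mat_diag_def)
    finally show ?thesis .
  qed
  ultimately show ?thesis using i by (simp add: diag_D_def mat_diag_def)
qed

text \<open>A diagonal matrix unit is symmetric and idempotent, so it equals its transpose times
  itself; the diagonal matrix is the sum of these units with weights \<open>d i\<close>.\<close>

lemma diag_in_mat_power_module:
  fixes d :: "nat \<Rightarrow> 'a::comm_ring_1"
  assumes d: "\<And>i. i < r \<Longrightarrow> d i \<in> M" and r: "r \<le> n"
  shows "diag_D n r d \<in> mat_power_module n M"
proof -
  define U where "U = (\<lambda>i. mat n n (\<lambda>(k, l). if k = i \<and> l = i then 1 else 0 :: 'a))"
  have U: "U i \<in> carrier_mat n n" for i by (simp add: U_def)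
  have UU: "transpose_mat (U i) * U i = U i" if "i < n" for i
  proof (rule eq_matI)
    fix k l assume "k < dim_row (U i)" "l < dim_col (U i)"
    then have kl: "k < n" "l < n" by (auto simp: U_def)
    have "(transpose_mat (U i) * U i) $$ (k, l) = (\<Sum>j\<in>{0..<n}. U i $$ (j, k) * U i $$ (j, l))"
      using kl by (simp add: U_def scalar_prod_def)
    also have "\<dots> = (\<Sum>j\<in>{0..<n}. if j = i then U i $$ (k, l) else 0)"
      using kl that by (intro sum.cong) (auto simp: U_def)
    also have "\<dots> = U i $$ (k, l)" using that by simp
    finally show "(transpose_mat (U i) * U i) $$ (k, l) = U i $$ (k, l)" .
  qed (auto simp: U_def)
  let ?f = "\<lambda>(m, A). m \<cdot>\<^sub>m (transpose_mat A * A)"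
  have "foldr (+) (map ?f (map (\<lambda>i. (d i, U i)) [s..<r])) (0\<^sub>m n n) =
      mat_diag n (\<lambda>i. if s \<le> i \<and> i < r then d i else 0)" if "s \<le> r" for s
    using that
  proof (induction rule: inc_induct)
    case base
    show ?case by (rule eq_matI) (auto simp: mat_diag_def)
  next
    case (step s)
    have "foldr (+) (map ?f (map (\<lambda>i. (d i, U i)) [s..<r])) (0\<^sub>m n n) =
        d s \<cdot>\<^sub>m (transpose_mat (U s) * U s) + mat_diag n (\<lambda>i. if Suc s \<le> i \<and> i < r then d i else 0)"
      using step by (simp add: upt_conv_Cons)
    also have "\<dots> = mat_diag n (\<lambda>i. if s \<le> i \<and> i < r then d i else 0)"
      using step.hyps r by (subst UU, simp, intro eq_matI) (auto simp: mat_diag_def U_def)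
    finally show ?case .
  qed
  from this[of 0] have "diag_D n r d = foldr (+) (map ?f (map (\<lambda>i. (d i, U i)) [0..<r])) (0\<^sub>m n n)"
    by (simp add: diag_D_def)
  moreover have "set (map (\<lambda>i. (d i, U i)) [0..<r]) \<subseteq> M \<times> carrier_mat n n"
    using d U by auto
  ultimately show ?thesis unfolding mat_power_module_def by blast
qed

theorem proposition6p9:
  fixes n r :: nat
    and \<G> :: "'d::{finite,linorder} mpoly mat set"
    and G :: "'d mpoly set"
    and d :: "nat \<Rightarrow> 'd mpoly"
  assumes "n \<ge> 1"
    and "\<G> \<subseteq> sym_mats n"
    and "mat_pos_set n \<G> = pos_set G"
    and "mat_power_module n (qmod G) \<subseteq> mat_qmod n \<G>"
    and "mat_power_module n (preord G) \<subseteq> mat_preord n \<G>"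
    and "r \<le> n"
    and "archimedean (qmod G)"
    and "psd_on n (mat_pos_set n \<G>) (diag_D n r d)"
    and "\<And>i p. i < r \<Longrightarrow> p \<in> mat_pos_set n \<G> \<Longrightarrow> eval_at p (d i) = 0 \<Longrightarrow>
           nonsingular_point p \<and>
           (\<exists>k g. 1 \<le> k \<and> k \<le> CARD('d) \<and> (\<forall>j<k. g j \<in> qmod G) \<and>
              part_of_uniformizing_system p k g \<and> BHC p k g (d i))"
  shows "diag_D n r d \<in> mat_power_module n (qmod G) \<and>
         mat_power_module n (qmod G) \<subseteq> mat_qmod n \<G>"
proof (intro conjI diag_in_mat_power_module)
  fix i assume i: "i < r"
  show "d i \<in> qmod G"
  proof (rule nonneg_in_archimedean_quadratic_module)
    show "archimedean (qmod G)" by fact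
  next
    fix x assume "x \<in> pos_set G"
    then show "eval_at x (d i) \<ge> 0"
      using psd_diag_nonneg[OF assms(8) _ i assms(6)] assms(3) by simp
  next
    fix p assume "p \<in> pos_set G" and zero: "eval_at p (d i) = 0"
    then obtain k g where "\<forall>j<k. g j \<in> qmod G" "BHC p k g (d i)"
      using assms(9)[OF i] assms(3) by metis
    then show "\<exists>m\<in>qmod G. growth p (d i - m) \<and> eval_at p m = 0"
      using BHC_local_growth[OF quadratic_module_qmod _ _ zero] by blast
  qed
qed (use assms in auto)

end
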